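(* Let $\mathbb X^3\in\{\mathbb E^3,\mathbb H^3\}$, let $q\in\mathbb R\setminus\{0\}$ and $p>0$, and assume $p+q>0$ in the case $\mathbb X^3=\mathbb H^3$. Consider the LWR potential on $\mathbb C^*$ $$\xi=\begin{pmatrix} 0 & 1 \\ {q\lambda+p} & 0 \end{pmatrix}\frac{dz}{z},$$ the evaluation points $(\lambda_0,\lambda_1)=(0,1)$ and the LWR frame $\Phi$ on $\widetilde{\mathbb C^*}$ for $\xi$ with ($\lambda$-independent) initial condition $$\Phi(1)=\frac1{\sqrt2}\begin{pmatrix} 1 & \frac1\mu \\ -\mu & 1 \end{pmatrix},\qquad\mu:=\begin{cases} \sqrt p & \text{in }\mathbb E^3, \\ \sqrt{p+q} & \text{in }\mathbb H^3. \end{cases}$$ Then the induced immersion is a catenoid with Hopf differential $qz^{-2}dz^2$, wrapping number $2\sqrt p$ and metric $$ds^2=\frac{q^2}{4\mu^2}\left(\mu^{-1}|z|^{2\mu}+\mu|z|^{-2\mu}\right)^2|z|^{-2}|dz|^2 .$$ Moreover, any catenoid can be obtained this way, up to a rigid motion and a coordinate change.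
   Context: Ambient spaces. $\mathcal H_2$: $2\times2$ Hermitian matrices with $\langle x,y\rangle=-\frac12\operatorname{tr}(x\widehat y)$ ($\widehat y$ the adjugate), extended complex-bilinearly. $\mathbb H^3=\{x\in\mathcal H_2:\det x=1,\operatorname{tr}x>0\}$; $\mathbb E^3=T_{\mathrm I}\mathbb H^3$ = trace-free Hermitian matrices, oriented so that $(x,y,-\frac i2[x,y])$ is positive; the orientation is transported to $\mathbb H^3$ by $x\mapsto VxV^*$, $V\in \mathrm{SL}_2\mathbb C$. For a conformal immersion $f$: metric $ds^2=2\langle f_z,f_{\bar z}\rangle|dz|^2$, unit normal $N$ with $(f_x,f_y,N)$ positively oriented orthogonal, Hopf differential $Q\,dz^2$ and mean curvature $H$ defined by $-\langle df,dN\rangle=Q\,dz^2+H\,ds^2+\bar Q\,d\bar z^2$; minimal: $H\equiv 0$ in $\mathbb E^3$; CMC 1: $H\equiv1$ in $\mathbb H^3$; flat: $Q\equiv0$. $\widetilde{\mathbb C^*}$ is the universal cover of $\mathbb C^*$. The frame $\Phi_\lambda$ is the $\mathrm{SL}_2\mathbb C$-valued solution of $\Phi^{-1}d\Phi=\xi$ with the given initial value, for all $\lambda\in\mathbb C$; the induced immersions at $(\lambda_0,\lambda_1)$ are $f^{\mathbb E}=\psi+\psi^*$ with $\psi=(\lambda_1-\lambda_0)(\dot\Phi\Phi^{-1})_{\lambda_0}$ (dot $=\partial_\lambda$) and $f^{\mathbb H}=\Psi^*\Psi$ with $\Psi=\Phi_{\lambda_1}\Phi_{\lambda_0}^{-1}$.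 A minimal (in $\mathbb E^3$) or CMC 1 (in $\mathbb H^3$) conformal immersion $f:\widetilde{\mathbb C^*}\to\mathbb X^3$ is a catenoid if it is a non-flat extrinsic surface of revolution: for all $t\in\mathbb R$, $\tau_t^*f=\mathcal R(t)\circ f$, where $\tau_t$ is the lift of $z\mapsto e^{it}z$ to $\widetilde{\mathbb C^*}$ (depending continuously on $t$, $\tau_0=\mathrm{id}$) and $\mathcal R:\mathbb R\to\mathrm{Iso}(\mathbb X^3)$ is a 1-parameter group of rotations (about a common axis). Its wrapping number is $2\pi/t_0$ with $t_0=\min\{t>0:\tau_t^*f=f\}$. A rigid motion of $f$ is $\mathcal J\circ f$ with $\mathcal J$ an orientation-preserving isometry of $\mathbb X^3$. *)

theory Defs
  imports "HOL-Analysis.Analysis"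
begin

section \<open>Hermitian matrices\<close>

type_synonym cmat = "complex^2^2"

definition mat2 :: "complex \<Rightarrow> complex \<Rightarrow> complex \<Rightarrow> complex \<Rightarrow> cmat" where
  "mat2 a b c d = vector [vector [a, b], vector [c, d]]"

definition cscale :: "complex \<Rightarrow> cmat \<Rightarrow> cmat" where
  "cscale c A = (\<chi> i j. c * A $ i $ j)"

definition cadj :: "cmat \<Rightarrow> cmat" where
  "cadj A = (\<chi> i j. cnj (A $ j $ i))"

definition adjugate2 :: "cmat \<Rightarrow> cmat" where
  "adjugate2 A = mat2 (A $ 2 $ 2) (- (A $ 1 $ 2)) (- (A $ 2 $ 1)) (A $ 1 $ 1)"

definition hermitian :: "cmat \<Rightarrow> bool" where
  "hermitian A \<longleftrightarrow> cadj A = A"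

text \<open>The complex-bilinear extension to all of \<open>cmat\<close>, the complexification of the Hermitian
  matrices. It is real on Hermitian arguments; on these we use \<open>hip\<close>.\<close>

definition cip :: "cmat \<Rightarrow> cmat \<Rightarrow> complex" where
  "cip x y = - (1/2) * trace (x ** adjugate2 y)"

definition hip :: "cmat \<Rightarrow> cmat \<Rightarrow> real" where
  "hip x y = Re (cip x y)"

section \<open>The ambient spaces\<close>

datatype ambient = E3 | H3

fun space_of :: "ambient \<Rightarrow> cmat set" where
  "space_of E3 = {x. hermitian x \<and> trace x = 0}"
| "space_of H3 = {x. hermitian x \<and> det x = 1 \<and> Re (trace x) > 0}"

fun tangent_space :: "ambient \<Rightarrow> cmat \<Rightarrow> cmat set" where
  "tangent_space E3 p = space_of E3"
| "tangent_space H3 p = {v. hermitian v \<and> cip p v = 0}"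

text \<open>\<open>hcross x y\<close> is orthogonal to \<open>x\<close> and \<open>y\<close>. Hence \<open>(x, y, hcross x y)\<close> being positive means
  that \<open>(x, y, n)\<close> is a positive basis iff \<open>n\<close> has positive inner product with \<open>hcross x y\<close>.\<close>

definition hcross :: "cmat \<Rightarrow> cmat \<Rightarrow> cmat" where
  "hcross x y = cscale (- (\<i> / 2)) (x ** y - y ** x)"

definition positive_E3 :: "cmat \<Rightarrow> cmat \<Rightarrow> cmat \<Rightarrow> bool" where
  "positive_E3 x y n \<longleftrightarrow>
     x \<in> space_of E3 \<and> y \<in> space_of E3 \<and> n \<in> space_of E3 \<and> hip (hcross x y) n > 0"

text \<open>\<open>positive_basis X p x y n\<close>: \<open>(x, y, n)\<close> is a positively oriented basis of the tangent space of
  \<open>X\<close> at \<open>p\<close>. In \<open>H3\<close>, whose tangent space at the identity matrix is \<open>E3\<close>, the orientation is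
  transported from there by \<open>x \<mapsto> V x V\<^sup>*\<close>; the choice of \<open>V\<close> is immaterial, since the stabilizer
  \<open>SU(2)\<close> of the identity matrix is connected.\<close>

fun positive_basis :: "ambient \<Rightarrow> cmat \<Rightarrow> cmat \<Rightarrow> cmat \<Rightarrow> cmat \<Rightarrow> bool" where
  "positive_basis E3 p x y n \<longleftrightarrow> positive_E3 x y n"
| "positive_basis H3 p x y n \<longleftrightarrow>
     (\<exists>V x' y' n'. det V = 1 \<and> p = V ** cadj V \<and> positive_E3 x' y' n' \<and>
        x = V ** x' ** cadj V \<and> y = V ** y' ** cadj V \<and> n = V ** n' ** cadj V)"

fun distance :: "ambient \<Rightarrow> cmat \<Rightarrow> cmat \<Rightarrow> real" where
  "distance E3 x y = sqrt (hip (x - y) (x - y))"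
| "distance H3 x y = arcosh (- hip x y)"

definition isometry_of :: "ambient \<Rightarrow> (cmat \<Rightarrow> cmat) \<Rightarrow> bool" where
  "isometry_of X J \<longleftrightarrow> bij_betw J (space_of X) (space_of X) \<and>
     (\<forall>x\<in>space_of X. \<forall>y\<in>space_of X. distance X (J x) (J y) = distance X x y)"

text \<open>The derivative within \<open>space_of X\<close> is determined on tangent vectors, and no others are used.\<close>

definition orientation_preserving :: "ambient \<Rightarrow> (cmat \<Rightarrow> cmat) \<Rightarrow> bool" where
  "orientation_preserving X J \<longleftrightarrow> (\<forall>p\<in>space_of X. \<exists>J'.
     (J has_derivative J') (at p within space_of X) \<and>
     (\<forall>x y n. positive_basis X p x y n \<longrightarrow> positive_basis X (J p) (J' x) (J' y) (J' n)))"

definition rigid_motion :: "ambient \<Rightarrow> (cmat \<Rightarrow> cmat) \<Rightarrow> bool" where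
  "rigid_motion X J \<longleftrightarrow> isometry_of X J \<and> orientation_preserving X J"

fun geodesic :: "ambient \<Rightarrow> cmat \<Rightarrow> cmat \<Rightarrow> real \<Rightarrow> cmat" where
  "geodesic E3 p v s = p + s *\<^sub>R v"
| "geodesic H3 p v s = cosh s *\<^sub>R p + sinh s *\<^sub>R v"

definition is_geodesic :: "ambient \<Rightarrow> cmat set \<Rightarrow> bool" where
  "is_geodesic X l \<longleftrightarrow> (\<exists>p\<in>space_of X. \<exists>v\<in>tangent_space X p. hip v v = 1 \<and>
     l = range (geodesic X p v))"

definition rotation_about :: "ambient \<Rightarrow> cmat set \<Rightarrow> (cmat \<Rightarrow> cmat) \<Rightarrow> bool" where
  "rotation_about X l J \<longleftrightarrow> rigid_motion X J \<and> (\<forall>x\<in>l. J x = x)"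

text \<open>Only the restrictions of the maps \<open>R t\<close> to \<open>space_of X\<close> are meaningful.\<close>

definition rotation_group :: "ambient \<Rightarrow> (real \<Rightarrow> cmat \<Rightarrow> cmat) \<Rightarrow> bool" where
  "rotation_group X R \<longleftrightarrow>
     (\<exists>l. is_geodesic X l \<and> (\<forall>t. rotation_about X l (R t))) \<and>
     (\<forall>x\<in>space_of X. R 0 x = x \<and> (\<forall>s t. R (s + t) x = R s (R t x)) \<and>
        continuous_on UNIV (\<lambda>t. R t x))"

section \<open>Conformal immersions of the universal cover of the punctured plane\<close>

text \<open>The universal cover is modelled by the complex plane with covering map \<open>z = exp w\<close>, the base
  point over \<open>z = 1\<close> being \<open>w = 0\<close>. Below, \<open>w\<close> is a point of the cover and \<open>v\<close> a tangent vector there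
  in the coordinate \<open>w\<close>. Coefficient functions are taken with respect to the multivalued coordinate
  \<open>z\<close>, so \<open>dz\<close> is the one-form \<open>v \<mapsto> exp w * v\<close>.\<close>

definition dz :: "complex \<Rightarrow> complex \<Rightarrow> complex" where
  "dz w v = exp w * v"

definition diff :: "(complex \<Rightarrow> cmat) \<Rightarrow> complex \<Rightarrow> complex \<Rightarrow> cmat" where
  "diff f w v = frechet_derivative f (at w) v"

definition d_z :: "(complex \<Rightarrow> cmat) \<Rightarrow> complex \<Rightarrow> cmat" where
  "d_z f w = cscale (1 / (2 * exp w)) (diff f w 1 - cscale \<i> (diff f w \<i>))"

definition d_zbar :: "(complex \<Rightarrow> cmat) \<Rightarrow> complex \<Rightarrow> cmat" where
  "d_zbar f w = cscale (1 / (2 * cnj (exp w))) (diff f w 1 + cscale \<i> (diff f w \<i>))"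

fun C_k :: "nat \<Rightarrow> (complex \<Rightarrow> cmat) \<Rightarrow> bool" where
  "C_k 0 f \<longleftrightarrow> continuous_on UNIV f"
| "C_k (Suc k) f \<longleftrightarrow> f differentiable_on UNIV \<and>
     C_k k (\<lambda>w. diff f w 1) \<and> C_k k (\<lambda>w. diff f w \<i>)"

definition smooth :: "(complex \<Rightarrow> cmat) \<Rightarrow> bool" where
  "smooth f \<longleftrightarrow> (\<forall>k. C_k k f)"

definition metric_coeff :: "(complex \<Rightarrow> cmat) \<Rightarrow> complex \<Rightarrow> real" where
  "metric_coeff f w = Re (2 * cip (d_z f w) (d_zbar f w))"

definition conformal_immersion :: "ambient \<Rightarrow> (complex \<Rightarrow> cmat) \<Rightarrow> bool" where
  "conformal_immersion X f \<longleftrightarrow> smooth f \<and> range f \<subseteq> space_of X \<and>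
     (\<forall>w. inj (diff f w)) \<and>
     (\<forall>w v. hip (diff f w v) (diff f w v) = metric_coeff f w * (cmod (dz w v))\<^sup>2)"

text \<open>The coordinates \<open>w\<close> and \<open>z\<close> are related holomorphically, so both give the same normal.\<close>

definition unit_normal :: "ambient \<Rightarrow> (complex \<Rightarrow> cmat) \<Rightarrow> (complex \<Rightarrow> cmat) \<Rightarrow> bool" where
  "unit_normal X f N \<longleftrightarrow> (\<forall>w. hip (N w) (N w) = 1 \<and>
     hip (diff f w 1) (N w) = 0 \<and> hip (diff f w \<i>) (N w) = 0 \<and>
     positive_basis X (f w) (diff f w 1) (diff f w \<i>) (N w))"

text \<open>For a conformal immersion, \<open>N\<close>, \<open>Q\<close> and \<open>H\<close> exist and are uniquely determined.\<close>

definition second_form ::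
  "ambient \<Rightarrow> (complex \<Rightarrow> cmat) \<Rightarrow> (complex \<Rightarrow> complex) \<Rightarrow> (complex \<Rightarrow> real) \<Rightarrow> bool" where
  "second_form X f Q H \<longleftrightarrow> (\<exists>N. unit_normal X f N \<and>
     (\<forall>w v. complex_of_real (- hip (diff f w v) (diff N w v)) =
        Q w * (dz w v)\<^sup>2 + of_real (H w * metric_coeff f w * (cmod (dz w v))\<^sup>2)
        + cnj (Q w * (dz w v)\<^sup>2)))"

definition hopf_differential :: "ambient \<Rightarrow> (complex \<Rightarrow> cmat) \<Rightarrow> (complex \<Rightarrow> complex) \<Rightarrow> bool" where
  "hopf_differential X f Q \<longleftrightarrow> (\<exists>H. second_form X f Q H)"

definition mean_curvature :: "ambient \<Rightarrow> (complex \<Rightarrow> cmat) \<Rightarrow> (complex \<Rightarrow> real) \<Rightarrow> bool" where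
  "mean_curvature X f H \<longleftrightarrow> (\<exists>Q. second_form X f Q H)"

definition flat :: "ambient \<Rightarrow> (complex \<Rightarrow> cmat) \<Rightarrow> bool" where
  "flat X f \<longleftrightarrow> hopf_differential X f (\<lambda>w. 0)"

definition biholomorphic_change :: "(complex \<Rightarrow> complex) \<Rightarrow> bool" where
  "biholomorphic_change \<phi> \<longleftrightarrow>
     bij \<phi> \<and> \<phi> holomorphic_on UNIV \<and> inv \<phi> holomorphic_on UNIV"

section \<open>Catenoids\<close>

definition lift_rot :: "real \<Rightarrow> complex \<Rightarrow> complex" where
  "lift_rot t w = w + \<i> * of_real t"

definition catenoid :: "ambient \<Rightarrow> (complex \<Rightarrow> cmat) \<Rightarrow> bool" where
  "catenoid X f \<longleftrightarrow> conformal_immersion X f \<and>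
     mean_curvature X f (\<lambda>w. case X of E3 \<Rightarrow> 0 | H3 \<Rightarrow> 1) \<and> \<not> flat X f \<and>
     (\<exists>R. rotation_group X R \<and> (\<forall>t. f \<circ> lift_rot t = R t \<circ> f))"

definition wrapping_number :: "(complex \<Rightarrow> cmat) \<Rightarrow> real \<Rightarrow> bool" where
  "wrapping_number f k \<longleftrightarrow> (\<exists>t0>0. f \<circ> lift_rot t0 = f \<and>
     (\<forall>t>0. f \<circ> lift_rot t = f \<longrightarrow> t0 \<le> t) \<and> k = 2 * pi / t0)"

section \<open>LWR frames and induced immersions\<close>

text \<open>The spectral parameter \<open>\<lambda>\<close> is written \<open>l\<close>. A potential \<open>\<xi>\<close> is given by its \<open>dz\<close>-coefficient \<open>\<xi> l z\<close>. The frame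
  \<open>\<Phi> l\<close> is the unique \<open>SL(2,\<complex>)\<close>-valued solution on the cover of \<open>d\<Phi> = \<Phi> \<xi>\<close> with value \<open>\<Phi>0\<close> over \<open>z = 1\<close>.\<close>

definition lwr_frame ::
  "(complex \<Rightarrow> complex \<Rightarrow> cmat) \<Rightarrow> cmat \<Rightarrow> complex \<Rightarrow> complex \<Rightarrow> cmat" where
  "lwr_frame \<xi> \<Phi>0 = (THE \<Phi>. \<forall>l. \<Phi> l 0 = \<Phi>0 \<and> (\<forall>w. det (\<Phi> l w) = 1 \<and>
     (\<Phi> l has_derivative (\<lambda>v. \<Phi> l w ** cscale (dz w v) (\<xi> l (exp w)))) (at w)))"

definition psi_E3 ::
  "(complex \<Rightarrow> complex \<Rightarrow> cmat) \<Rightarrow> complex \<Rightarrow> complex \<Rightarrow> complex \<Rightarrow> cmat" where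
  "psi_E3 \<Phi> l0 l1 w = cscale (l1 - l0)
     ((\<chi> i j. deriv (\<lambda>l. \<Phi> l w $ i $ j) l0) ** matrix_inv (\<Phi> l0 w))"

definition psi_H3 ::
  "(complex \<Rightarrow> complex \<Rightarrow> cmat) \<Rightarrow> complex \<Rightarrow> complex \<Rightarrow> complex \<Rightarrow> cmat" where
  "psi_H3 \<Phi> l0 l1 w = \<Phi> l1 w ** matrix_inv (\<Phi> l0 w)"

fun induced_immersion ::
  "ambient \<Rightarrow> (complex \<Rightarrow> complex \<Rightarrow> cmat) \<Rightarrow> complex \<Rightarrow> complex \<Rightarrow> complex \<Rightarrow> cmat" where
  "induced_immersion E3 \<Phi> l0 l1 w = psi_E3 \<Phi> l0 l1 w + cadj (psi_E3 \<Phi> l0 l1 w)"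
| "induced_immersion H3 \<Phi> l0 l1 w = cadj (psi_H3 \<Phi> l0 l1 w) ** psi_H3 \<Phi> l0 l1 w"

definition cat_potential :: "real \<Rightarrow> real \<Rightarrow> complex \<Rightarrow> complex \<Rightarrow> cmat" where
  "cat_potential q p l z = cscale (1 / z) (mat2 0 1 (of_real q * l + of_real p) 0)"

fun cat_mu :: "ambient \<Rightarrow> real \<Rightarrow> real \<Rightarrow> real" where
  "cat_mu E3 q p = sqrt p"
| "cat_mu H3 q p = sqrt (p + q)"

definition cat_init :: "real \<Rightarrow> cmat" where
  "cat_init \<mu> = cscale (1 / of_real (sqrt 2)) (mat2 1 (1 / of_real \<mu>) (- of_real \<mu>) 1)"

definition cat_immersion :: "ambient \<Rightarrow> real \<Rightarrow> real \<Rightarrow> complex \<Rightarrow> cmat" where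
  "cat_immersion X q p =
     induced_immersion X (lwr_frame (cat_potential q p) (cat_init (cat_mu X q p))) 0 1"

definition cat_admissible :: "ambient \<Rightarrow> real \<Rightarrow> real \<Rightarrow> bool" where
  "cat_admissible X q p \<longleftrightarrow> q \<noteq> 0 \<and> p > 0 \<and> (X = H3 \<longrightarrow> p + q > 0)"

end

theory Submission
  imports Defs
begin

text \<open>
  In the coordinate \<open>w = u + i v = log z\<close> the potential has constant coefficients, so the frame is an explicit
  matrix exponential. The initial value is chosen such that it diagonalizes this exponential at one evaluation
  point (\<open>\<lambda> = 0\<close> in \<open>E3\<close>, \<open>\<lambda> = 1\<close> in \<open>H3\<close>). Up to a rigid motion the induced immersion then becomes a Hermitian
  matrix whose diagonal entries depend on \<open>u\<close> only and whose upper right entry is \<open>b(u) e\<^bsup>i\<omega>v\<^esup>\<close> with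
  \<open>\<omega> = 2 \<surd>p\<close> (\<open>induced_E3\<close>, \<open>induced_H3\<close>). In both spaces this is a surface of revolution about the geodesic of
  diagonal matrices, and \<open>\<omega>\<close> is its wrapping number.

  For such surfaces everything is expressed by three real functions of one variable. The unit normal has the same
  form, the metric is \<open>(\<omega> b)\<^sup>2 \<bar>dw\<bar>\<^sup>2\<close>, and the second fundamental form is diagonal (\<open>second_form_rot\<close>). For the
  functions at hand, sums of two exponentials, the sum and the difference of its two coefficients give the mean
  curvature and the Hopf differential (\<open>Luu_model\<close>, \<open>Lvv_model\<close>).

  Conversely, let a catenoid be given and move its axis to the diagonal. Distances to the points of the axis are
  invariant under the rotations, so the diagonal entries and the modulus of the off-diagonal entry depend on \<open>u\<close>
  only. Conformality then forces the phase of the off-diagonal entry to be an affine function of \<open>v\<close>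
  (\<open>normal_form\<close>). The mean curvature equation has a first integral, coming from the translations along the axis;
  its value \<open>q\<close> is the Hopf differential, nonzero because the surface is not flat (\<open>first_integrals\<close>). It turns the
  equation for \<open>b\<close> into \<open>b'' = k b\<close> with an energy relation that makes \<open>k\<close> positive, so \<open>b\<close> is a translate of a
  hyperbolic cosine, which is the profile of the model with the same \<open>q\<close> and \<open>\<omega>\<close> (\<open>profile_is_model\<close>). The
  remaining constants are absorbed by a rigid motion and the translation of \<open>w\<close>.
\<close>

section \<open>Two-by-two complex matrices\<close>

lemma mat2_nth [simp]:
  "mat2 a b c d $ 1 $ 1 = a" "mat2 a b c d $ 1 $ 2 = b"
  "mat2 a b c d $ 2 $ 1 = c" "mat2 a b c d $ 2 $ 2 = d"
  by (simp_all add: mat2_def)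

lemma cmat_eq_iff: "A = B \<longleftrightarrow> A$1$1 = B$1$1 \<and> A$1$2 = B$1$2 \<and> A$2$1 = B$2$1 \<and> A$2$2 = B$2$2"
  for A B :: cmat
  by (auto simp: vec_eq_iff forall_2)

lemma mat2_cases [cases type]:
  fixes A :: cmat obtains a b c d where "A = mat2 a b c d"
  using that[of "A$1$1" "A$1$2" "A$2$1" "A$2$2"] by (simp add: cmat_eq_iff)

lemma mat2_eq [simp]: "mat2 a b c d = mat2 a' b' c' d' \<longleftrightarrow> a = a' \<and> b = b' \<and> c = c' \<and> d = d'"
  by (simp add: cmat_eq_iff)

lemma mat2_mult [simp]:
  "mat2 a b c d ** mat2 e f g h = mat2 (a*e + b*g) (a*f + b*h) (c*e + d*g) (c*f + d*h)"
  by (simp add: cmat_eq_iff matrix_matrix_mult_def sum_2)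

lemma mat2_arith [simp]:
  "mat2 a b c d + mat2 a' b' c' d' = mat2 (a+a') (b+b') (c+c') (d+d')"
  "mat2 a b c d - mat2 a' b' c' d' = mat2 (a-a') (b-b') (c-c') (d-d')"
  "- mat2 a b c d = mat2 (-a) (-b) (-c) (-d)"
  "r *\<^sub>R mat2 a b c d = mat2 (r *\<^sub>R a) (r *\<^sub>R b) (r *\<^sub>R c) (r *\<^sub>R d)"
  "cscale z (mat2 a b c d) = mat2 (z*a) (z*b) (z*c) (z*d)"
  "cadj (mat2 a b c d) = mat2 (cnj a) (cnj c) (cnj b) (cnj d)"
  "adjugate2 (mat2 a b c d) = mat2 d (-b) (-c) a"
  by (simp_all add: cmat_eq_iff cscale_def cadj_def adjugate2_def)

lemma mat2_const: "(0::cmat) = mat2 0 0 0 0" "(mat 1::cmat) = mat2 1 0 0 1"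
  by (simp_all add: cmat_eq_iff mat_def)

lemma mat2_eq_0 [simp]: "mat2 a b c d = 0 \<longleftrightarrow> a = 0 \<and> b = 0 \<and> c = 0 \<and> d = 0"
  by (simp add: mat2_const)

lemma mat2_det_trace [simp]:
  "det (mat2 a b c d) = a*d - b*c" "trace (mat2 a b c d) = a + d"
  by (simp_all add: det_2 trace_def sum_2)

lemma cip_mat2 [simp]: "cip (mat2 a b c d) (mat2 a' b' c' d') = (b*c' + c*b' - a*d' - d*a') / 2"
  by (simp add: cip_def field_simps)

lemma matrix_mult_bilinear:
  fixes A :: cmat
  shows "(A + B) ** C = A ** C + B ** C" "A ** (B + C) = A ** B + A ** C"
    "(A - B) ** C = A ** C - B ** C" "A ** (B - C) = A ** B - A ** C"
    "cscale z A ** C = cscale z (A ** C)" "A ** cscale z C = cscale z (A ** C)"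
    "(r *\<^sub>R A) ** C = r *\<^sub>R (A ** C)" "A ** (r *\<^sub>R C) = r *\<^sub>R (A ** C)"
  by (cases A; cases B; cases C; simp add: algebra_simps)+

lemma cadj_simps [simp]:
  "cadj (A ** B) = cadj B ** cadj A" "cadj (cadj A) = A"
  "cadj (A + B) = cadj A + cadj B" "det (cadj A) = cnj (det A)"
  by (cases A; cases B; simp add: algebra_simps)+

lemma adjugate2_simps [simp]:
  "adjugate2 (A ** B) = adjugate2 B ** adjugate2 A" "det (adjugate2 A) = det A"
  "adjugate2 (cadj A) = cadj (adjugate2 A)" "adjugate2 (adjugate2 A) = A"
  by (cases A; cases B; simp add: algebra_simps)+

lemma adjugate2_inverse:
  assumes "det A = 1"
  shows "A ** adjugate2 A = mat 1" "adjugate2 A ** A = mat 1"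
  using assms by (cases A; simp add: mat2_const algebra_simps)+

lemma matrix_inv_adjugate2:
  assumes "det A = 1" shows "matrix_inv A = adjugate2 A"
proof -
  note A = adjugate2_inverse[OF assms]
  have "A ** matrix_inv A = mat 1"
    unfolding matrix_inv_def by (rule someI2[of _ "adjugate2 A"]) (use A in auto)
  then have "adjugate2 A ** (A ** matrix_inv A) = adjugate2 A" by simp
  then show ?thesis by (simp add: matrix_mul_assoc A)
qed

section \<open>Hermitian matrices in real coordinates\<close>

definition hm :: "real \<Rightarrow> complex \<Rightarrow> real \<Rightarrow> cmat" where
  "hm a b d = mat2 (of_real a) b (cnj b) (of_real d)"

lemma hermitian_hm [simp]: "hermitian (hm a b d)"
  by (simp add: hermitian_def hm_def)

lemma hermitian_cases:
  assumes "hermitian A" obtains a b d where "A = hm a b d"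
proof -
  obtain a b c d where A: "A = mat2 a b c d" by (cases A)
  have "cnj a = a" "cnj d = d" "c = cnj b" using assms by (auto simp: A hermitian_def)
  then have "A = hm (Re a) b (Re d)"
    by (simp add: A hm_def complex_eq_iff)
  then show ?thesis using that by blast
qed

lemma hm_eq [simp]: "hm a b d = hm a' b' d' \<longleftrightarrow> a = a' \<and> b = b' \<and> d = d'"
  by (auto simp: hm_def)

lemma hm_arith [simp]:
  "hm a b d + hm a' b' d' = hm (a+a') (b+b') (d+d')"
  "hm a b d - hm a' b' d' = hm (a-a') (b-b') (d-d')"
  "- hm a b d = hm (-a) (-b) (-d)"
  "r *\<^sub>R hm a b d = hm (r*a) (of_real r*b) (r*d)"
  by (simp_all add: hm_def) (simp_all add: scaleR_conv_of_real)

lemma hm_eq_0 [simp]: "hm a b d = 0 \<longleftrightarrow> a = 0 \<and> b = 0 \<and> d = 0"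
  by (simp add: hm_def)

lemma cip_hm [simp]:
  "cip (hm a b d) (hm a' b' d') = of_real (Re (b * cnj b') - (a*d' + d*a') / 2)"
  by (simp add: hm_def complex_eq_iff field_simps)

lemma hip_hm [simp]: "hip (hm a b d) (hm a' b' d') = Re (b * cnj b') - (a*d' + d*a') / 2"
  by (simp add: hip_def)

lemma det_trace_hm [simp]:
  "det (hm a b d) = of_real (a*d - (cmod b)\<^sup>2)" "trace (hm a b d) = of_real (a+d)"
  by (simp_all add: hm_def of_real_diff of_real_mult complex_norm_square del: of_real_power)

lemma space_E3_hm [simp]: "hm a b d \<in> space_of E3 \<longleftrightarrow> d = -a"
proof -
  have "hm a b d \<in> space_of E3 \<longleftrightarrow> complex_of_real (a + d) = 0"
    by (simp del: of_real_add)
  also have "\<dots> \<longleftrightarrow> d = -a" unfolding of_real_eq_0_iff by linarith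
  finally show ?thesis .
qed

lemma space_H3_hm [simp]: "hm a b d \<in> space_of H3 \<longleftrightarrow> a*d - (cmod b)\<^sup>2 = 1 \<and> a + d > 0"
proof -
  have "hm a b d \<in> space_of H3 \<longleftrightarrow>
      complex_of_real (a*d - (cmod b)\<^sup>2) = 1 \<and> Re (of_real (a + d)) > 0"
    unfolding space_of.simps mem_Collect_eq det_trace_hm by simp
  then show ?thesis unfolding of_real_eq_1_iff Re_complex_of_real .
qed

lemma space_of_cases:
  assumes "x \<in> space_of X" obtains a b d where "x = hm a b d"
  using assms by (cases X) (auto elim: hermitian_cases)

lemma H3_diagonal_pos:
  assumes "hm a b d \<in> space_of H3" shows "a > 0" "d > 0" "a * d \<ge> 1"
proof -
  have ad: "a*d = 1 + (cmod b)\<^sup>2" and s: "a + d > 0" using assms unfolding space_H3_hm by auto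
  show "a*d \<ge> 1" using ad by simp
  then have "a*d > 0" by linarith
  then show "a > 0" "d > 0" using s by (auto simp: zero_less_mult_iff)
qed

section \<open>Rigid motions\<close>

text \<open>One family of maps serves both spaces: \<open>V\<close> runs through \<open>SU(2)\<close> and \<open>c\<close> through the translations in
\<open>E3\<close>, while in \<open>H3\<close> all of \<open>SL(2,\<complex>)\<close> acts and \<open>c = 0\<close>. The derivative is \<open>congr_by V\<close> in either case.\<close>

definition motion :: "cmat \<Rightarrow> cmat \<Rightarrow> cmat \<Rightarrow> cmat" where
  "motion V c x = V ** x ** cadj V + c"

definition is_motion :: "ambient \<Rightarrow> cmat \<Rightarrow> cmat \<Rightarrow> bool" where
  "is_motion X V c \<longleftrightarrow> det V = 1 \<and>
     (case X of E3 \<Rightarrow> V ** cadj V = mat 1 \<and> c \<in> space_of E3 | H3 \<Rightarrow> c = 0)"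

abbreviation congr_by :: "cmat \<Rightarrow> cmat \<Rightarrow> cmat" where
  "congr_by V x \<equiv> V ** x ** cadj V"

lemma motion_0 [simp]: "motion V 0 = congr_by V"
  by (simp add: motion_def fun_eq_iff)

lemma is_motion_det [simp]: "is_motion X V c \<Longrightarrow> det V = 1"
  by (simp add: is_motion_def)

lemma bounded_linear_congr_by: "bounded_linear (congr_by V)"
  by (rule linear_conv_bounded_linear[THEN iffD1], rule linearI)
     (simp_all add: matrix_mult_bilinear)

lemma congr_by_linear:
  "congr_by V (x + y) = congr_by V x + congr_by V y"
  "congr_by V (x - y) = congr_by V x - congr_by V y"
  "congr_by V (- x) = - congr_by V x" "congr_by V 0 = 0"
proof -
  have "linear (congr_by V)" using bounded_linear_congr_by by (simp add: linear_conv_bounded_linear)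
  then show "congr_by V (x + y) = congr_by V x + congr_by V y"
    "congr_by V (x - y) = congr_by V x - congr_by V y"
    "congr_by V (- x) = - congr_by V x" "congr_by V 0 = 0"
    by (rule linear_add linear_diff linear_neg linear_0)+
qed

lemma congr_by_compose: "congr_by V (congr_by W x) = congr_by (V ** W) x"
  by (simp add: matrix_mul_assoc)

lemma cadj_one [simp]: "cadj (mat 1) = mat 1" "cadj 0 = 0" "adjugate2 (mat 1) = mat 1"
  by (simp_all add: mat2_const)

lemma congr_by_adjugate:
  assumes "det V = 1"
  shows "congr_by V (congr_by (adjugate2 V) x) = x" "congr_by (adjugate2 V) (congr_by V x) = x"
  by (simp_all only: congr_by_compose adjugate2_inverse[OF assms] matrix_mul_lid cadj_one
        matrix_mul_rid)

lemma trace_comm: "trace (A ** B) = trace (B ** A)" for A B :: cmat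
  by (cases A; cases B; simp add: algebra_simps)

lemma cip_congr_by [simp]:
  assumes "det V = 1" shows "cip (congr_by V x) (congr_by V y) = cip x y"
proof -
  have d: "det (cadj V) = 1" using assms by simp
  have "trace (congr_by V x ** adjugate2 (congr_by V y)) =
        trace (V ** (x ** (cadj V ** adjugate2 (cadj V)) ** adjugate2 y ** adjugate2 V))"
    by (simp add: matrix_mul_assoc)
  also have "\<dots> = trace (x ** adjugate2 y ** (adjugate2 V ** V))"
    by (subst trace_comm) (simp only: adjugate2_inverse[OF d] matrix_mul_rid matrix_mul_assoc)
  finally show ?thesis by (simp add: cip_def adjugate2_inverse[OF assms])
qed

lemma hip_congr_by [simp]: "det V = 1 \<Longrightarrow> hip (congr_by V x) (congr_by V y) = hip x y"
  by (simp add: hip_def)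

lemma hermitian_congr_by [simp]: "hermitian x \<Longrightarrow> hermitian (congr_by V x)"
  by (simp add: hermitian_def matrix_mul_assoc)

lemma unitary_conv_adjugate:
  assumes "det V = 1" "V ** cadj V = mat 1"
  shows "cadj V = adjugate2 V" "cadj V ** V = mat 1"
proof -
  have "adjugate2 V ** (V ** cadj V) = adjugate2 V" using assms by simp
  then show *: "cadj V = adjugate2 V"
    by (simp add: matrix_mul_assoc adjugate2_inverse[OF assms(1)])
  show "cadj V ** V = mat 1" by (simp add: * adjugate2_inverse[OF assms(1)])
qed

lemma space_E3_add: "x \<in> space_of E3 \<Longrightarrow> y \<in> space_of E3 \<Longrightarrow> x + y \<in> space_of E3"
  by (cases x; cases y) (auto simp: hermitian_def add_eq_0_iff)

lemma space_E3_minus: "x \<in> space_of E3 \<Longrightarrow> - x \<in> space_of E3"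
  by (cases x) (auto simp: hermitian_def add_eq_0_iff)

lemma congr_by_E3:
  assumes "V ** cadj V = mat 1" "x \<in> space_of E3" "det V = 1"
  shows "congr_by V x \<in> space_of E3"
proof -
  have "trace (congr_by V x) = trace x"
    by (subst trace_comm) (simp add: matrix_mul_assoc unitary_conv_adjugate(2)[OF assms(3,1)])
  then show ?thesis using assms by simp
qed

lemma hcross_congr_by:
  assumes "cadj V ** V = mat 1"
  shows "hcross (congr_by V x) (congr_by V y) = congr_by V (hcross x y)"
proof -
  have *: "congr_by V x ** congr_by V y = congr_by V (x ** y)" for x y
  proof -
    have "congr_by V x ** congr_by V y = V ** x ** (cadj V ** V) ** y ** cadj V"
      by (simp only: matrix_mul_assoc)
    then show ?thesis using assms by (simp add: matrix_mul_assoc)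
  qed
  show ?thesis unfolding hcross_def * by (simp add: matrix_mult_bilinear)
qed

lemma positive_E3_congr_by:
  assumes "det V = 1" "V ** cadj V = mat 1" "positive_E3 x y n"
  shows "positive_E3 (congr_by V x) (congr_by V y) (congr_by V n)"
  using assms(3) congr_by_E3[OF assms(2) _ assms(1)]
  unfolding positive_E3_def hcross_congr_by[OF unitary_conv_adjugate(2)[OF assms(1,2)]]
    hip_congr_by[OF assms(1)] by blast

text \<open>A point of hyperbolic space is \<open>W W\<^sup>*\<close> with \<open>W\<close> lower triangular (Cholesky), so \<open>SL(2,\<complex>)\<close>
  acts transitively and questions about a point can be moved to the identity matrix.\<close>

lemma H3_factorization:
  assumes "p \<in> space_of H3" obtains W where "det W = 1" "p = W ** cadj W"
proof -
  obtain a b d where p: "p = hm a b d" using assms by (rule space_of_cases)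
  have a: "a > 0" and ad: "a*d = 1 + (cmod b)\<^sup>2"
    using assms H3_diagonal_pos[of a b d] unfolding p space_H3_hm by auto
  define s where "s = sqrt a"
  have s: "s > 0" "s * s = a" using a by (auto simp: s_def)
  let ?W = "mat2 (of_real s) 0 (cnj b / of_real s) (1 / of_real s)"
  have d: "d = (1 + (cmod b)\<^sup>2) / (s * s)" using ad s a by (simp add: field_simps)
  have "of_real d = (cnj b * b + 1) / (of_real s * of_real s :: complex)"
    unfolding d by (simp add: complex_norm_square[symmetric] mult.commute[of "cnj b"] flip: of_real_power)
  then have "p = ?W ** cadj ?W"
    using s by (simp add: p hm_def add_divide_distrib flip: s(2))
  moreover have "det ?W = 1" using s by simp
  ultimately show ?thesis using that by blast
qed

lemma congr_by_H3:
  assumes "det V = 1" "x \<in> space_of H3"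
  shows "congr_by V x \<in> space_of H3"
proof -
  obtain W where W: "x = W ** cadj W" "det W = 1" using H3_factorization[OF assms(2)] by blast
  have *: "congr_by V x = (V ** W) ** cadj (V ** W)" by (simp add: W matrix_mul_assoc)
  have det: "det (V ** W) = 1" using assms W by (simp add: det_mul)
  obtain a b c d where M: "V ** W = mat2 a b c d" by (cases "V ** W")
  have "Re (trace (mat2 a b c d ** cadj (mat2 a b c d))) =
      (cmod a)\<^sup>2 + (cmod b)\<^sup>2 + (cmod c)\<^sup>2 + (cmod d)\<^sup>2"
    unfolding cmod_power2 by (simp add: power2_eq_square)
  also have "\<dots> > 0"
  proof -
    have "a \<noteq> 0 \<or> b \<noteq> 0" using det by (auto simp: M)
    then have "(cmod a)\<^sup>2 + (cmod b)\<^sup>2 > 0" by (auto simp: add_pos_nonneg add_nonneg_pos)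
    then show ?thesis by (smt (verit) zero_le_power2)
  qed
  finally have "Re (trace (congr_by V x)) > 0" by (simp only: * M)
  moreover have "det (congr_by V x) = 1"
    unfolding * det_mul[of "V ** W"] cadj_simps(4)[of "V ** W"] det by simp
  moreover have "hermitian (congr_by V x)" using assms by simp
  ultimately show ?thesis by simp
qed

lemma motion_space:
  assumes "is_motion X V c" "x \<in> space_of X"
  shows "motion V c x \<in> space_of X"
proof (cases X)
  case E3
  then have "congr_by V x \<in> space_of E3" "c \<in> space_of E3"
    using assms congr_by_E3 by (auto simp: is_motion_def simp del: space_of.simps)
  then show ?thesis
    unfolding motion_def E3 by (rule space_E3_add)
next
  case H3
  then show ?thesis using assms by (auto simp: is_motion_def intro: congr_by_H3 simp del: space_of.simps)
qed

lemma motion_inverse: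
  assumes "is_motion X V c"
  obtains V' c' where "is_motion X V' c'"
    "\<And>x. motion V' c' (motion V c x) = x" "\<And>x. motion V c (motion V' c' x) = x"
proof
  let ?V = "adjugate2 V" and ?c = "- congr_by (adjugate2 V) c"
  have det: "det V = 1" using assms by simp
  show "motion ?V ?c (motion V c x) = x" "motion V c (motion ?V ?c x) = x" for x
    unfolding motion_def by (simp_all only: congr_by_linear congr_by_adjugate[OF det]) simp_all
  show "is_motion X ?V ?c"
  proof (cases X)
    case E3
    then have u: "V ** cadj V = mat 1" and c: "c \<in> space_of E3"
      using assms by (auto simp: is_motion_def)
    note u' = unitary_conv_adjugate[OF det u]
    have "?V ** cadj ?V = mat 1" using u' by (simp flip: u'(1))
    moreover have "?c \<in> space_of E3"
      using congr_by_E3[OF calculation c] det by (auto intro: space_E3_minus simp del: space_of.simps)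
    ultimately show ?thesis using det E3 by (simp add: is_motion_def del: space_of.simps)
  next
    case H3
    then show ?thesis using assms det
      by (auto simp: is_motion_def congr_by_linear)
  qed
qed

lemma motion_compose:
  assumes "is_motion X V c" "is_motion X V' c'"
  obtains V'' c'' where "is_motion X V'' c''" "\<And>x. motion V c (motion V' c' x) = motion V'' c'' x"
proof
  let ?V = "V ** V'" and ?c = "congr_by V c' + c"
  show "motion V c (motion V' c' x) = motion ?V ?c x" for x
    unfolding motion_def by (simp only: congr_by_linear congr_by_compose add.assoc)
  show "is_motion X ?V ?c"
  proof (cases X)
    case E3
    then have u: "V ** cadj V = mat 1" "V' ** cadj V' = mat 1" and c: "c \<in> space_of E3" "c' \<in> space_of E3"
      using assms by (auto simp: is_motion_def)
    have "?V ** cadj ?V = V ** (V' ** cadj V') ** cadj V" by (simp add: matrix_mul_assoc)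
    then have "?V ** cadj ?V = mat 1" using u by simp
    moreover have "?c \<in> space_of E3"
      using congr_by_E3[OF u(1) c(2)] assms(1) c(1)
      by (metis E3 c(2) motion_def motion_space)
    ultimately show ?thesis using assms E3 by (simp add: is_motion_def det_mul del: space_of.simps)
  next
    case H3
    then show ?thesis using assms
      by (auto simp: is_motion_def det_mul congr_by_linear)
  qed
qed

lemma motion_has_derivative:
  assumes "(f has_derivative f') F"
  shows "((\<lambda>w. motion V c (f w)) has_derivative (\<lambda>v. congr_by V (f' v))) F"
proof -
  have "((\<lambda>w. congr_by V (f w) + c) has_derivative (\<lambda>v. congr_by V (f' v) + 0)) F"
    by (rule has_derivative_add[OF bounded_linear.has_derivative[OF bounded_linear_congr_by assms]
          has_derivative_const])
  then show ?thesis by (simp add: motion_def)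
qed

lemma positive_basis_motion:
  assumes "is_motion X V c" "positive_basis X p x y n"
  shows "positive_basis X (motion V c p) (congr_by V x) (congr_by V y) (congr_by V n)"
proof (cases X)
  case E3
  then show ?thesis
    using assms positive_E3_congr_by by (auto simp: is_motion_def)
next
  case H3
  then obtain W x' y' n' where W: "det W = 1" "p = W ** cadj W" "positive_E3 x' y' n'"
    "x = congr_by W x'" "y = congr_by W y'" "n = congr_by W n'" using assms(2) by auto
  have c: "c = 0" using assms H3 by (simp add: is_motion_def)
  have "det (V ** W) = 1" "congr_by V p = (V ** W) ** cadj (V ** W)"
    using W assms by (simp_all add: det_mul matrix_mul_assoc)
  then show ?thesis using W(3) unfolding H3 c motion_0 W(4-6) congr_by_compose positive_basis.simps
    by blast
qed

lemma motion_distance: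
  assumes "is_motion X V c"
  shows "distance X (motion V c x) (motion V c y) = distance X x y"
proof (cases X)
  case E3
  have "motion V c x - motion V c y = congr_by V (x - y)" by (simp add: motion_def congr_by_linear)
  then show ?thesis using assms by (simp add: E3)
next
  case H3
  then show ?thesis using assms by (simp add: is_motion_def)
qed

lemma motion_rigid:
  assumes "is_motion X V c" shows "rigid_motion X (motion V c)"
proof -
  obtain V' c' where I: "is_motion X V' c'" "\<And>x. motion V' c' (motion V c x) = x"
    "\<And>x. motion V c (motion V' c' x) = x" using motion_inverse[OF assms] by blast
  have "bij_betw (motion V c) (space_of X) (space_of X)"
    by (rule bij_betwI[where g = "motion V' c'"]) (use I assms motion_space in auto)
  moreover have "orientation_preserving X (motion V c)"
    unfolding orientation_preserving_def
    using motion_has_derivative[OF has_derivative_ident] positive_basis_motion[OF assms] by blast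
  ultimately show ?thesis
    by (simp add: rigid_motion_def isometry_of_def motion_distance[OF assms])
qed

section \<open>The unit normal of a conformally parametrized surface\<close>

lemma E3_cases:
  assumes "x \<in> space_of E3" obtains a b c where "x = hm a (Complex b c) (-a)"
proof -
  obtain a z d where x: "x = hm a z d" using assms by (rule space_of_cases)
  show ?thesis
    using assms that[of a "Re z" "Im z"] unfolding x space_E3_hm by (simp add: complex_surj)
qed

lemma hcross_hm:
  "hcross (hm a (Complex b c) (-a)) (hm a' (Complex b' c') (-a')) =
   hm (c * b' - b * c') (Complex (a * c' - c * a') (b * a' - a * b')) (- (c * b' - b * c'))"
  by (simp add: hcross_def hm_def complex_eq_iff) (simp add: field_simps)

lemma hip_E3: "hip (hm a (Complex b c) (-a)) (hm a' (Complex b' c') (-a')) = a * a' + b * b' + c * c'"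
  by simp

text \<open>Since \<open>x\<close>, \<open>y\<close> and their cross product are orthogonal, with squared lengths \<open>e\<close>, \<open>e\<close>, \<open>e\<^sup>2\<close>, a vector
orthogonal to \<open>x\<close> and \<open>y\<close> is a multiple of the cross product; unit length and positivity fix the factor.\<close>

lemma normal_E3:
  assumes xy: "x \<in> space_of E3" "y \<in> space_of E3"
    and e: "hip x x = e" "hip y y = e" "hip x y = 0" "e > 0"
  shows "hip n n = 1 \<and> hip x n = 0 \<and> hip y n = 0 \<and> positive_E3 x y n \<longleftrightarrow>
         n = (1/e) *\<^sub>R hcross x y"
proof -
  obtain a b c where x: "x = hm a (Complex b c) (-a)" using xy(1) by (rule E3_cases)
  obtain a' b' c' where y: "y = hm a' (Complex b' c') (-a')" using xy(2) by (rule E3_cases)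
  note e' = e(1-3)[unfolded x y hip_E3]
  define m1 m2 m3 where m: "m1 = c*b' - b*c'" "m2 = a*c' - c*a'" "m3 = b*a' - a*b'"
  have m_norm: "m1*m1 + m2*m2 + m3*m3 = e*e"
  proof -
    have "m1*m1 + m2*m2 + m3*m3 =
        (a*a + b*b + c*c) * (a'*a' + b'*b' + c'*c') - (a*a' + b*b' + c*c') * (a*a' + b*b' + c*c')"
      unfolding m by algebra
    then show ?thesis unfolding e' by simp
  qed
  have m_orth: "a*m1 + b*m2 + c*m3 = 0" "a'*m1 + b'*m2 + c'*m3 = 0"
    unfolding m by algebra+
  have cross: "hcross x y = hm m1 (Complex m2 m3) (-m1)" by (simp add: x y hcross_hm m)
  show ?thesis
  proof
    assume "n = (1/e) *\<^sub>R hcross x y"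
    then have n: "n = hm (m1/e) (Complex (m2/e) (m3/e)) (-(m1/e))"
      by (simp add: cross complex_eq_iff)
    have "n \<in> space_of E3" unfolding n space_E3_hm by simp
    moreover have "hip n n = 1"
    proof -
      have "hip n n = (m1*m1 + m2*m2 + m3*m3) / (e*e)"
        unfolding n hip_E3 by (simp add: add_divide_distrib)
      then show ?thesis using m_norm e(4) by simp
    qed
    moreover have "hip x n = 0" "hip y n = 0"
    proof -
      have "hip x n = (a*m1 + b*m2 + c*m3) / e" "hip y n = (a'*m1 + b'*m2 + c'*m3) / e"
        unfolding n x y hip_E3 by (simp_all add: add_divide_distrib)
      then show "hip x n = 0" "hip y n = 0" using m_orth by simp_all
    qed
    moreover have "hip (hcross x y) n > 0"
    proof -
      have "hip (hcross x y) n = (m1*m1 + m2*m2 + m3*m3) / e"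
        unfolding n cross hip_E3 by (simp add: add_divide_distrib)
      then show ?thesis using m_norm e(4) by simp
    qed
    ultimately show "hip n n = 1 \<and> hip x n = 0 \<and> hip y n = 0 \<and> positive_E3 x y n"
      using xy unfolding positive_E3_def by blast
  next
    assume *: "hip n n = 1 \<and> hip x n = 0 \<and> hip y n = 0 \<and> positive_E3 x y n"
    then have "n \<in> space_of E3" by (simp add: positive_E3_def del: space_of.simps)
    then obtain k l r where n: "n = hm k (Complex l r) (-k)" by (rule E3_cases)
    define s where "s = m1*k + m2*l + m3*r"
    have s: "s > 0" using * unfolding positive_E3_def cross n hip_E3 s_def by simp
    have h: "k*k + l*l + r*r = 1" "a*k + b*l + c*r = 0" "a'*k + b'*l + c'*r = 0"
      using * unfolding n x y hip_E3 by simp_all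
    \<comment> \<open>expansion of \<open>n\<close> in the orthogonal frame \<open>x, y, x \<times> y\<close>\<close>
    have ex: "e*e*k = s*m1" "e*e*l = s*m2" "e*e*r = s*m3"
    proof -
      have "(m1*m1 + m2*m2 + m3*m3) * k = s*m1 + (a*k + b*l + c*r) * ((a'*a' + b'*b' + c'*c') * a - (a*a' + b*b' + c*c') * a')
          + (a'*k + b'*l + c'*r) * ((a*a + b*b + c*c) * a' - (a*a' + b*b' + c*c') * a)"
        "(m1*m1 + m2*m2 + m3*m3) * l = s*m2 + (a*k + b*l + c*r) * ((a'*a' + b'*b' + c'*c') * b - (a*a' + b*b' + c*c') * b')
          + (a'*k + b'*l + c'*r) * ((a*a + b*b + c*c) * b' - (a*a' + b*b' + c*c') * b)"
        "(m1*m1 + m2*m2 + m3*m3) * r = s*m3 + (a*k + b*l + c*r) * ((a'*a' + b'*b' + c'*c') * c - (a*a' + b*b' + c*c') * c')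
          + (a'*k + b'*l + c'*r) * ((a*a + b*b + c*c) * c' - (a*a' + b*b' + c*c') * c)"
        unfolding s_def m by algebra+
      then show "e*e*k = s*m1" "e*e*l = s*m2" "e*e*r = s*m3"
        unfolding h m_norm by simp_all
    qed
    have "(e*e)*(e*e) = (e*e*k)*(e*e*k) + (e*e*l)*(e*e*l) + (e*e*r)*(e*e*r)"
      using h(1) by algebra
    also have "\<dots> = s * s * (m1*m1 + m2*m2 + m3*m3)" unfolding ex by algebra
    finally have "(e*e)*(e*e) = (s * s)*(e*e)" unfolding m_norm .
    then have "e * e = s * s" using e(4) by (subst (asm) mult_right_cancel) auto
    then have "s = e" using e(4) s square_eq_iff[of e s] by auto
    then have "k = m1/e" "l = m2/e" "r = m3/e" using ex e(4) by (simp_all add: field_simps)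
    then show "n = (1/e) *\<^sub>R hcross x y" by (simp add: n cross complex_eq_iff)
  qed
qed

text \<open>Transporting the cross product from the identity to \<open>p = V V\<^sup>*\<close> by \<open>x \<mapsto> V x V\<^sup>*\<close> turns
  the product \<open>x y\<close> into \<open>x p\<^sup>-\<^sup>1 y\<close>, so \<open>V\<close> drops out.\<close>

fun cross_at :: "ambient \<Rightarrow> cmat \<Rightarrow> cmat \<Rightarrow> cmat \<Rightarrow> cmat" where
  "cross_at E3 p x y = hcross x y"
| "cross_at H3 p x y = cscale (- (\<i> / 2)) (x ** adjugate2 p ** y - y ** adjugate2 p ** x)"

lemma cross_at_H3_congr_by:
  assumes "det V = 1"
  shows "cross_at H3 (V ** cadj V) (congr_by V x) (congr_by V y) = congr_by V (hcross x y)"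
proof -
  have *: "congr_by V x ** adjugate2 (V ** cadj V) ** congr_by V y = congr_by V (x ** y)" for x y
  proof -
    have d: "det (cadj V) = 1" using assms by simp
    have "congr_by V x ** adjugate2 (V ** cadj V) ** congr_by V y =
        V ** x ** (cadj V ** adjugate2 (cadj V)) ** (adjugate2 V ** V) ** y ** cadj V"
      by (simp add: matrix_mul_assoc)
    then show ?thesis
      unfolding adjugate2_inverse[OF d] adjugate2_inverse[OF assms] by (simp add: matrix_mul_assoc)
  qed
  show ?thesis unfolding hcross_def cross_at.simps * by (simp add: matrix_mult_bilinear)
qed

text \<open>The tangent space at the identity consists of the trace-free Hermitian matrices, and \<open>congr_by V\<close> is an
isometry of the bilinear form that carries the identity to \<open>V V\<^sup>*\<close>.\<close>

lemma tangent_H3_transport: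
  assumes "det V = 1"
  shows "congr_by V x \<in> tangent_space H3 (V ** cadj V) \<longleftrightarrow> x \<in> space_of E3"
proof -
  have "cip (V ** cadj V) (congr_by V x) = cip (mat 1) x"
    using cip_congr_by[OF assms, of "mat 1" x] by simp
  moreover have "cip (mat 1) x = 0 \<longleftrightarrow> trace x = 0"
    by (cases x) (auto simp: mat2_const algebra_simps add_eq_0_iff)
  moreover have "hermitian (congr_by V x) \<longleftrightarrow> hermitian x"
    using congr_by_adjugate[OF assms] hermitian_congr_by by metis
  ultimately show ?thesis by simp
qed

text \<open>In \<open>H3\<close> the statement at \<open>p = V V\<^sup>*\<close> is the Euclidean one pulled back by \<open>congr_by V\<close>. The definition of a
positive basis allows any such \<open>V\<close>; as the cross product does not depend on \<open>V\<close>, all choices agree.\<close>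

lemma normal_iff:
  assumes p: "p \<in> space_of X" and xy: "x \<in> tangent_space X p" "y \<in> tangent_space X p"
    and e: "hip x x = e" "hip y y = e" "hip x y = 0" "e > 0"
  shows "hip n n = 1 \<and> hip x n = 0 \<and> hip y n = 0 \<and> positive_basis X p x y n \<longleftrightarrow>
         n = (1/e) *\<^sub>R cross_at X p x y"
proof (cases X)
  case E3
  then show ?thesis using normal_E3[of x y e n] assms by simp
next
  case H3
  have scale: "congr_by V ((1/e) *\<^sub>R z) = (1/e) *\<^sub>R congr_by V z" for V z
    by (simp add: matrix_mult_bilinear)
  have main: "hip n n = 1 \<and> hip x n = 0 \<and> hip y n = 0 \<and> positive_E3 x' y' n' \<longleftrightarrow>
         n = (1/e) *\<^sub>R cross_at X p x y"
    if V: "det V = 1" "p = V ** cadj V" "x = congr_by V x'" "y = congr_by V y'" "n = congr_by V n'"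
    for V x' y' n'
  proof -
    have "x' \<in> space_of E3" "y' \<in> space_of E3"
      using xy tangent_H3_transport[OF V(1)] unfolding H3 V(2-4) by blast+
    moreover have "hip x' x' = e" "hip y' y' = e" "hip x' y' = 0"
      using e V by simp_all
    ultimately have "hip n' n' = 1 \<and> hip x' n' = 0 \<and> hip y' n' = 0 \<and> positive_E3 x' y' n' \<longleftrightarrow>
         n' = (1/e) *\<^sub>R hcross x' y'" using normal_E3 e(4) by blast
    moreover have "n = (1/e) *\<^sub>R cross_at X p x y \<longleftrightarrow> n' = (1/e) *\<^sub>R hcross x' y'"
      unfolding H3 V(2-5) cross_at_H3_congr_by[OF V(1)] scale[symmetric]
      using congr_by_adjugate[OF V(1)] by metis
    ultimately show ?thesis using V by simp
  qed
  obtain W where W: "det W = 1" "p = W ** cadj W" using H3_factorization p H3 by metis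
  have inv: "z = congr_by W (congr_by (adjugate2 W) z)" for z
    using congr_by_adjugate(1)[OF W(1)] by simp
  show ?thesis
    using main main[OF W inv inv inv] unfolding H3 positive_basis.simps
    using W inv by blast
qed

lemma cross_at_motion:
  assumes "is_motion X V c"
    and "p \<in> space_of X" "x \<in> tangent_space X p" "y \<in> tangent_space X p"
  shows "cross_at X (motion V c p) (congr_by V x) (congr_by V y) = congr_by V (cross_at X p x y)"
proof (cases X)
  case E3
  then have "det V = 1" "V ** cadj V = mat 1" using assms by (auto simp: is_motion_def)
  then show ?thesis using hcross_congr_by unitary_conv_adjugate(2) by (simp add: E3)
next
  case H3
  then have c: "c = 0" and V: "det V = 1" using assms by (auto simp: is_motion_def)
  obtain W where W: "p = W ** cadj W" "det W = 1" using H3_factorization assms(2) H3 by metis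
  define x' y' where "x' = congr_by (adjugate2 W) x" "y' = congr_by (adjugate2 W) y"
  then have xy: "x = congr_by W x'" "y = congr_by W y'" using congr_by_adjugate[OF W(2)] by simp_all
  have VW: "det (V ** W) = 1" "congr_by V p = (V ** W) ** cadj (V ** W)"
    using V W by (simp_all add: det_mul matrix_mul_assoc)
  show ?thesis
    unfolding H3 c motion_0 VW(2) unfolding xy congr_by_compose cross_at_H3_congr_by[OF VW(1)]
    unfolding W(1) cross_at_H3_congr_by[OF W(2)] congr_by_compose ..
qed

section \<open>Surfaces of revolution about the diagonal axis\<close>

lemma bounded_linear_hm: "bounded_linear (\<lambda>(a, b, d). hm a b d)"
  by (rule linear_conv_bounded_linear[THEN iffD1], rule linearI) (auto simp: scaleR_conv_of_real[where 'a = complex])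

lemma hm_has_derivative:
  assumes "(a has_derivative a') (at x within S)" "(b has_derivative b') (at x within S)"
    "(d has_derivative d') (at x within S)"
  shows "((\<lambda>w. hm (a w) (b w) (d w)) has_derivative (\<lambda>v. hm (a' v) (b' v) (d' v))) (at x within S)"
  using bounded_linear.has_derivative[OF bounded_linear_hm
      has_derivative_Pair[OF assms(1) has_derivative_Pair[OF assms(2,3)]]] by simp

text \<open>The rotations about the geodesic of diagonal matrices multiply the upper right entry by a phase and fix the
diagonal, so a surface of revolution with this axis is given by three real functions of \<open>u = Re w\<close>.\<close>

definition rot :: "(real \<Rightarrow> real) \<Rightarrow> (real \<Rightarrow> real) \<Rightarrow> (real \<Rightarrow> real) \<Rightarrow> real \<Rightarrow> complex \<Rightarrow> cmat" where
  "rot a b d om w = hm (a (Re w)) (of_real (b (Re w)) * cis (om * Im w)) (d (Re w))"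

lemma real_chain_Re:
  assumes "(f has_real_derivative f') (at (Re w))"
  shows "((\<lambda>w. f (Re w)) has_derivative (\<lambda>v. f' * Re v)) (at w)"
  using has_derivative_compose[OF bounded_linear_imp_has_derivative[OF bounded_linear_Re, where net = "at w"],
      of f "(*) f'"] assms by (simp add: has_field_derivative_def)

lemma rot_has_derivative:
  assumes "(a has_real_derivative a') (at (Re w))" "(b has_real_derivative b') (at (Re w))"
    "(d has_real_derivative d') (at (Re w))"
  shows "(rot a b d om has_derivative (\<lambda>v. hm (a' * Re v)
    (Complex (b' * Re v) (om * b (Re w) * Im v) * cis (om * Im w)) (d' * Re v))) (at w)"
proof -
  have c: "((\<lambda>w. cis (om * Im w)) has_derivative (\<lambda>v. (om * Im v) *\<^sub>R (\<i> * cis (om * Im w)))) (at w)"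
    by (auto intro!: derivative_eq_intros)
  have b: "((\<lambda>w. complex_of_real (b (Re w))) has_derivative (\<lambda>v. of_real (b' * Re v))) (at w)"
    by (rule bounded_linear.has_derivative[OF bounded_linear_of_real real_chain_Re[OF assms(2)]])
  have "((\<lambda>w. of_real (b (Re w)) * cis (om * Im w)) has_derivative
      (\<lambda>v. of_real (b (Re w)) * ((om * Im v) *\<^sub>R (\<i> * cis (om * Im w))) + of_real (b' * Re v) * cis (om * Im w))) (at w)"
    by (rule has_derivative_mult[OF b c])
  also have "(\<lambda>v. of_real (b (Re w)) * ((om * Im v) *\<^sub>R (\<i> * cis (om * Im w))) + of_real (b' * Re v) * cis (om * Im w))
     = (\<lambda>v. Complex (b' * Re v) (om * b (Re w) * Im v) * cis (om * Im w))"
    by (auto simp: fun_eq_iff complex_eq_iff algebra_simps)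
  finally show ?thesis
    unfolding rot_def
    by (intro hm_has_derivative real_chain_Re assms)
qed

lemma diff_eqI: "(f has_derivative f') (at w) \<Longrightarrow> diff f w = f'"
  unfolding diff_def using frechet_derivative_at by force

lemma metric_coeff_eq:
  assumes "hermitian (diff f w 1)" "hermitian (diff f w \<i>)"
  shows "metric_coeff f w =
    (hip (diff f w 1) (diff f w 1) + hip (diff f w \<i>) (diff f w \<i>)) / (2 * (cmod (exp w))\<^sup>2)"
proof -
  obtain a b d where x: "diff f w 1 = hm a b d" using assms(1) by (rule hermitian_cases)
  obtain a' b' d' where y: "diff f w \<i> = hm a' b' d'" using assms(2) by (rule hermitian_cases)
  have e: "cmod (exp w) * cmod (exp w) \<noteq> 0" by simp
  have "2 * cip (d_z f w) (d_zbar f w) =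
      (cip (hm a b d) (hm a b d) + cip (hm a' b' d') (hm a' b' d')) / (2 * (exp w * cnj (exp w)))"
    unfolding d_z_def d_zbar_def x y hm_def by (simp add: field_simps)
  also have "\<dots> = of_real ((hip (diff f w 1) (diff f w 1) + hip (diff f w \<i>) (diff f w \<i>)) / (2 * (cmod (exp w))\<^sup>2))"
    unfolding cip_hm x y hip_hm
    by (simp only: of_real_divide of_real_mult of_real_numeral of_real_add complex_norm_square)
  finally show ?thesis unfolding metric_coeff_def by simp
qed

lemma cis_mult_cnj: "cis t * cnj (cis t) = 1" "cis t * (cnj (cis t) * z) = z"
  by (simp_all add: cis_cnj cis_mult flip: mult.assoc)

lemma cis_cancel: "z * cis t * cnj (z' * cis t) = z * cnj z'"
  using cis_mult_cnj(1)[of t] by (simp add: algebra_simps)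

text \<open>The relation between the first derivatives says that \<open>u + i v\<close> is a conformal parameter: its two sides are the
squared lengths of the tangent vectors in the directions of \<open>u\<close> and of \<open>v\<close>.\<close>

locale revolution =
  fixes X :: ambient and a b d a1 b1 d1 a2 b2 d2 :: "real \<Rightarrow> real" and om :: real
  assumes deriv1: "(a has_real_derivative a1 u) (at u)" "(b has_real_derivative b1 u) (at u)"
      "(d has_real_derivative d1 u) (at u)"
    and deriv2: "(a1 has_real_derivative a2 u) (at u)" "(b1 has_real_derivative b2 u) (at u)"
      "(d1 has_real_derivative d2 u) (at u)"
    and in_E3: "X = E3 \<Longrightarrow> d u = - a u"
    and in_H3: "X = H3 \<Longrightarrow> a u * d u - (b u)\<^sup>2 = 1" "X = H3 \<Longrightarrow> a u + d u > 0"
    and conformal: "(b1 u)\<^sup>2 - a1 u * d1 u = (om * b u)\<^sup>2"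
    and nonzero: "om \<noteq> 0" "b u \<noteq> 0"
begin

text \<open>All tangent spaces of \<open>E3\<close> are the one of \<open>H3\<close> at the identity matrix. With the entries of that matrix
  in the place of those of the base point, the formula for the normal is the same in both spaces.\<close>

definition A where "A u = (case X of E3 \<Rightarrow> 1 | H3 \<Rightarrow> a u)"
definition B where "B u = (case X of E3 \<Rightarrow> 0 | H3 \<Rightarrow> b u)"
definition D where "D u = (case X of E3 \<Rightarrow> 1 | H3 \<Rightarrow> d u)"

definition n1 where "n1 u = (B u * a1 u - A u * b1 u) / (om * b u)"
definition n2 where "n2 u = (a1 u * D u - A u * d1 u) / (2 * om * b u)"
definition n3 where "n3 u = (D u * b1 u - B u * d1 u) / (om * b u)"

lemma in_space: "rot a b d om w \<in> space_of X"
  using in_E3 in_H3 by (cases X) (simp_all add: rot_def norm_mult del: space_of.simps)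

lemma d1_E3: "X = E3 \<Longrightarrow> d1 u = - a1 u"
proof -
  assume "X = E3"
  then have "d = (\<lambda>u. - a u)" using in_E3 by auto
  then have "(d has_real_derivative - a1 u) (at u)" using DERIV_minus[OF deriv1(1)] by simp
  then show ?thesis using deriv1(3) DERIV_unique by blast
qed

lemma tangent_H3: "X = H3 \<Longrightarrow> a1 u * d u + a u * d1 u = 2 * b u * b1 u"
proof -
  assume X: "X = H3"
  have "((\<lambda>u. a u * d u - (b u)\<^sup>2) has_real_derivative a1 u * d u + a u * d1 u - 2 * b u * b1 u) (at u)"
    by (auto intro!: derivative_eq_intros deriv1 simp: algebra_simps)
  moreover have "(\<lambda>u. a u * d u - (b u)\<^sup>2) = (\<lambda>u. 1)" using in_H3 X by auto
  ultimately have "((\<lambda>u. 1) has_real_derivative a1 u * d u + a u * d1 u - 2 * b u * b1 u) (at u)" by simp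
  then show ?thesis using DERIV_unique[OF _ DERIV_const] by fastforce
qed

lemma rot_deriv: "(rot a b d om has_derivative (\<lambda>v. hm (a1 (Re w) * Re v)
    (Complex (b1 (Re w) * Re v) (om * b (Re w) * Im v) * cis (om * Im w)) (d1 (Re w) * Re v))) (at w)"
  by (rule rot_has_derivative deriv1)+

lemmas diff_rot = diff_eqI[OF rot_deriv]

lemma hip_diff_rot: "hip (diff (rot a b d om) w v) (diff (rot a b d om) w v') =
   (om * b (Re w))\<^sup>2 * Re (v * cnj v')"
proof -
  have "hip (diff (rot a b d om) w v) (diff (rot a b d om) w v') =
     ((b1 (Re w))\<^sup>2 - a1 (Re w) * d1 (Re w)) * Re v * Re v' + (om * b (Re w))\<^sup>2 * Im v * Im v'"
    unfolding diff_rot hip_hm cis_cancel by (simp add: algebra_simps power2_eq_square)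
  then show ?thesis unfolding conformal by (simp add: algebra_simps)
qed

lemma tangent_rot: "diff (rot a b d om) w v \<in> tangent_space X (rot a b d om w)"
proof (cases X)
  case E3
  then show ?thesis by (simp add: diff_rot d1_E3 del: space_of.simps)
next
  case H3
  have R: "Re (of_real x * cis t * cnj (z * cis t)) = x * Re z" for x t z
    unfolding cis_cancel by simp
  have "b (Re w) * (b1 (Re w) * Re v) - (a (Re w) * (d1 (Re w) * Re v) + d (Re w) * (a1 (Re w) * Re v)) / 2 = 0"
    using tangent_H3[OF H3, of "Re w"] by algebra
  then have "cip (rot a b d om w) (diff (rot a b d om) w v) = of_real 0"
    unfolding diff_rot rot_def cip_hm R complex.sel by (rule arg_cong)
  then show ?thesis by (simp add: H3 diff_rot)
qed

lemma cross_at_rot: "cross_at X (rot a b d om w) (diff (rot a b d om) w 1) (diff (rot a b d om) w \<i>) =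
    (om * b (Re w))\<^sup>2 *\<^sub>R rot n1 n2 n3 om w"
proof -
  define c where "c = cis (om * Im w)"
  have c: "c * cnj c = 1" by (simp add: c_def cis_mult_cnj)
  define u where "u = Re w"
  have u: "om * b u \<noteq> 0" using nonzero by simp
  have n: "rot n1 n2 n3 om w = mat2 (n1 u) (n2 u * c) (n2 u * cnj c) (n3 u)"
    by (simp add: rot_def c_def u_def hm_def)
  have p: "rot a b d om w = mat2 (a u) (b u * c) (b u * cnj c) (d u)"
    by (simp add: rot_def c_def u_def hm_def)
  have x: "diff (rot a b d om) w 1 = mat2 (a1 u) (b1 u * c) (b1 u * cnj c) (d1 u)"
    by (simp add: diff_rot c_def u_def hm_def complex_eq_iff)
  have y: "diff (rot a b d om) w \<i> = mat2 0 (\<i> * (om * b u) * c) (- (\<i> * (om * b u) * cnj c)) 0"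
    by (simp add: diff_rot c_def u_def hm_def complex_eq_iff)
  have N: "(om * b u)\<^sup>2 * n1 u = om * b u * (B u * a1 u - A u * b1 u)"
    "(om * b u)\<^sup>2 * n2 u = om * b u * (a1 u * D u - A u * d1 u) / 2"
    "(om * b u)\<^sup>2 * n3 u = om * b u * (D u * b1 u - B u * d1 u)"
    using u by (simp_all add: n1_def n2_def n3_def power2_eq_square)
  have i: "\<i> * \<i> = -1" by simp
  have R: "(om * b u)\<^sup>2 *\<^sub>R rot n1 n2 n3 om w = mat2 (of_real (om * b u * (B u * a1 u - A u * b1 u)))
      (of_real (om * b u * (a1 u * D u - A u * d1 u) / 2) * c)
      (of_real (om * b u * (a1 u * D u - A u * d1 u) / 2) * cnj c)
      (of_real (om * b u * (D u * b1 u - B u * d1 u)))"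
    unfolding n N[symmetric] by (simp add: scaleR_conv_of_real[where 'a = complex])
  show ?thesis
  proof (cases X)
    case E3
    have d: "of_real (d1 u) = - (of_real (a1 u) :: complex)" by (simp add: d1_E3[OF E3])
    show ?thesis
      unfolding u_def[symmetric] R x y A_def B_def D_def
      unfolding E3 cross_at.simps hcross_def ambient.case mat2_mult mat2_arith mat2_eq
        of_real_mult of_real_diff of_real_divide of_real_numeral of_real_1 of_real_0 d
      by (intro conjI; use c i in algebra)
  next
    case H3
    show ?thesis
      unfolding u_def[symmetric] R x y p A_def B_def D_def
      unfolding H3 cross_at.simps ambient.case mat2_mult mat2_arith mat2_eq
        of_real_mult of_real_diff of_real_divide of_real_numeral
      by (intro conjI; use c i in algebra)
  qed
qed

lemma n_deriv:
  "(n1 has_real_derivative deriv n1 u) (at u)" "(n2 has_real_derivative deriv n2 u) (at u)"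
  "(n3 has_real_derivative deriv n3 u) (at u)"
proof -
  have fd: "a field_differentiable at u" "b field_differentiable at u" "d field_differentiable at u"
    "a1 field_differentiable at u" "b1 field_differentiable at u" "d1 field_differentiable at u"
    unfolding field_differentiable_def using deriv1 deriv2 by blast+
  have ABD: "A field_differentiable at u" "B field_differentiable at u" "D field_differentiable at u"
    unfolding A_def[abs_def] B_def[abs_def] D_def[abs_def] by (cases X; simp add: fd)+
  have nz: "om * b u \<noteq> 0" "2 * om * b u \<noteq> 0" using nonzero by simp_all
  note intros = field_differentiable_divide field_differentiable_diff field_differentiable_mult
    field_differentiable_const fd ABD nz
  have "n1 field_differentiable at u" unfolding n1_def[abs_def] by (intro intros)
  moreover have "n2 field_differentiable at u" unfolding n2_def[abs_def] by (intro intros)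
  moreover have "n3 field_differentiable at u" unfolding n3_def[abs_def] by (intro intros)
  ultimately have "n1 field_differentiable at u \<and> n2 field_differentiable at u \<and> n3 field_differentiable at u"
    by blast
  then show "(n1 has_real_derivative deriv n1 u) (at u)" "(n2 has_real_derivative deriv n2 u) (at u)"
    "(n3 has_real_derivative deriv n3 u) (at u)"
    by (auto simp: field_differentiable_derivI)
qed

lemma n_orthogonal: "b1 u * n2 u - (a1 u * n3 u + d1 u * n1 u) / 2 = 0"
  using nonzero by (simp add: n1_def n2_def n3_def field_simps)

text \<open>By the mirror symmetry in planes through the axis the second fundamental form has no mixed term; it is
\<open>Luu du\<^sup>2 + Lvv dv\<^sup>2\<close>. Differentiating the orthogonality of the normal to the tangent vector in the direction
of \<open>u\<close> removes the derivatives of the normal from \<open>Luu\<close>.\<close>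

definition Luu where "Luu u = b2 u * n2 u - (a2 u * n3 u + d2 u * n1 u) / 2"
definition Lvv where "Lvv u = - om\<^sup>2 * b u * n2 u"

lemma Luu_eq: "- (b1 u * deriv n2 u - (a1 u * deriv n3 u + d1 u * deriv n1 u) / 2) = Luu u"
proof -
  have "((\<lambda>u. b1 u * n2 u - (a1 u * n3 u + d1 u * n1 u) / 2) has_real_derivative
      Luu u + (b1 u * deriv n2 u - (a1 u * deriv n3 u + d1 u * deriv n1 u) / 2)) (at u)"
    unfolding Luu_def
    by (auto intro!: derivative_eq_intros deriv2 n_deriv simp: field_simps)
  then have "((\<lambda>u. 0) has_real_derivative
      Luu u + (b1 u * deriv n2 u - (a1 u * deriv n3 u + d1 u * deriv n1 u) / 2)) (at u)"
    unfolding n_orthogonal .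
  then show ?thesis using DERIV_unique[OF _ DERIV_const] by fastforce
qed

lemma hip_diff_normal: "- hip (diff (rot a b d om) w v) (diff (rot n1 n2 n3 om) w v) =
    Luu (Re w) * (Re v)\<^sup>2 + Lvv (Re w) * (Im v)\<^sup>2"
proof -
  have "diff (rot n1 n2 n3 om) w = (\<lambda>v. hm (deriv n1 (Re w) * Re v)
    (Complex (deriv n2 (Re w) * Re v) (om * n2 (Re w) * Im v) * cis (om * Im w)) (deriv n3 (Re w) * Re v))"
    by (rule diff_eqI rot_has_derivative n_deriv)+
  then show ?thesis
    unfolding diff_rot Luu_eq[symmetric] Lvv_def
    by (simp only: hip_hm cis_cancel) (simp add: algebra_simps power2_eq_square add_divide_distrib)
qed

context
  fixes V c assumes motion: "is_motion X V c"
begin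

abbreviation "surf \<equiv> motion V c \<circ> rot a b d om"

lemma diff_motion_rot: "diff surf w v = congr_by V (diff (rot a b d om) w v)"
  unfolding comp_def diff_eqI[OF motion_has_derivative[OF rot_deriv]] diff_rot ..

lemma metric_rot: "metric_coeff surf w = (om * b (Re w) / cmod (exp w))\<^sup>2"
proof -
  have "hermitian (diff (rot a b d om) w v)" for v by (simp add: diff_rot)
  then show ?thesis
    by (subst metric_coeff_eq)
       (simp_all add: diff_motion_rot is_motion_det[OF motion] hip_diff_rot power_divide)
qed

lemma metric_rot_dz:
  "metric_coeff surf w * (cmod (dz w v))\<^sup>2 = (om * b (Re w))\<^sup>2 * (cmod v)\<^sup>2"
  unfolding metric_rot dz_def by (simp add: norm_mult power_mult_distrib power_divide)

text \<open>Stating this and the next results for the image under a rigid motion makes them applicable both to the immersion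
induced by the frame and to an arbitrary catenoid, whose axis need not be the diagonal one.\<close>

lemma unit_normal_rot:
  "unit_normal X surf N \<longleftrightarrow> N = (\<lambda>w. congr_by V (rot n1 n2 n3 om w))"
proof -
  let ?r = "rot a b d om" and ?f = surf
  have det: "det V = 1" using motion by simp
  have "hip (N w) (N w) = 1 \<and> hip (diff ?f w 1) (N w) = 0 \<and> hip (diff ?f w \<i>) (N w) = 0 \<and>
     positive_basis X (?f w) (diff ?f w 1) (diff ?f w \<i>) (N w) \<longleftrightarrow> N w = congr_by V (rot n1 n2 n3 om w)" for w
  proof -
    let ?e = "(om * b (Re w))\<^sup>2"
    have e: "?e > 0" using nonzero by simp
    have tangent: "diff ?f w v \<in> tangent_space X (?f w)" for v
    proof (cases X)
      case E3
      then show ?thesis using tangent_rot[of w v] motion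
        unfolding diff_motion_rot by (auto simp: is_motion_def intro: congr_by_E3 simp del: space_of.simps)
    next
      case H3
      then have "c = 0" using motion by (simp add: is_motion_def)
      then show ?thesis using tangent_rot[of w v] det H3
        unfolding diff_motion_rot by simp
    qed
    have "hip (N w) (N w) = 1 \<and> hip (diff ?f w 1) (N w) = 0 \<and> hip (diff ?f w \<i>) (N w) = 0 \<and>
       positive_basis X (?f w) (diff ?f w 1) (diff ?f w \<i>) (N w) \<longleftrightarrow>
       N w = (1 / ?e) *\<^sub>R cross_at X (?f w) (diff ?f w 1) (diff ?f w \<i>)"
    proof (rule normal_iff)
      show "?f w \<in> space_of X" using motion_space[OF motion in_space] by simp
    qed (use tangent e in \<open>simp_all add: diff_motion_rot det hip_diff_rot\<close>)
    also have "cross_at X (?f w) (diff ?f w 1) (diff ?f w \<i>) = congr_by V (?e *\<^sub>R rot n1 n2 n3 om w)"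
      unfolding diff_motion_rot comp_apply
      by (subst cross_at_motion[OF motion in_space tangent_rot tangent_rot]) (simp only: cross_at_rot)
    also have "(1 / ?e) *\<^sub>R \<dots> = congr_by V (rot n1 n2 n3 om w)"
      using e by (simp add: matrix_mult_bilinear)
    finally show ?thesis .
  qed
  then show ?thesis unfolding unit_normal_def fun_eq_iff by blast
qed

text \<open>Both sides of the defining equation of the second form are real quadratic forms in the tangent vector; the
equations are the comparison of their coefficients, evaluated at \<open>1\<close>, \<open>\<i>\<close> and \<open>1 + \<i>\<close>.\<close>

lemma second_form_rot:
  "second_form X surf Q H \<longleftrightarrow>
    (\<forall>w. Im (Q w * (exp w)\<^sup>2) = 0 \<and>
       H w * (om * b (Re w))\<^sup>2 + 2 * Re (Q w * (exp w)\<^sup>2) = Luu (Re w) \<and>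
       H w * (om * b (Re w))\<^sup>2 - 2 * Re (Q w * (exp w)\<^sup>2) = Lvv (Re w))"
proof -
  let ?f = surf and ?N = "\<lambda>w. congr_by V (rot n1 n2 n3 om w)"
  have dN: "diff ?N w v = congr_by V (diff (rot n1 n2 n3 om) w v)" for w v
  proof -
    note * = rot_has_derivative[OF n_deriv(1) n_deriv(2) n_deriv(3), where w = w and om = om]
    show ?thesis
      unfolding diff_eqI[OF *] diff_eqI[OF bounded_linear.has_derivative[OF bounded_linear_congr_by *]] ..
  qed
  have hip: "- hip (diff ?f w v) (diff ?N w v) = Luu (Re w) * (Re v)\<^sup>2 + Lvv (Re w) * (Im v)\<^sup>2" for w v
    unfolding diff_motion_rot dN hip_congr_by[OF is_motion_det[OF motion]] hip_diff_normal ..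
  have rhs: "Q w * (dz w v)\<^sup>2 + of_real (H w * metric_coeff ?f w * (cmod (dz w v))\<^sup>2) + cnj (Q w * (dz w v)\<^sup>2) =
     of_real (H w * (om * b (Re w))\<^sup>2 * ((Re v)\<^sup>2 + (Im v)\<^sup>2) + 2 * Re (Q w * (exp w)\<^sup>2) * ((Re v)\<^sup>2 - (Im v)\<^sup>2)
       - 4 * Im (Q w * (exp w)\<^sup>2) * Re v * Im v)" for w v
  proof -
    have *: "Q w * (dz w v)\<^sup>2 = Q w * (exp w)\<^sup>2 * v\<^sup>2" by (simp add: dz_def power_mult_distrib)
    show ?thesis
      unfolding mult.assoc[of "H w"] metric_rot_dz unfolding cmod_power2 *
      by (simp add: complex_eq_iff power2_eq_square algebra_simps)
  qed
  have "second_form X ?f Q H \<longleftrightarrow> (\<forall>w v. Luu (Re w) * (Re v)\<^sup>2 + Lvv (Re w) * (Im v)\<^sup>2 =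
      H w * (om * b (Re w))\<^sup>2 * ((Re v)\<^sup>2 + (Im v)\<^sup>2) + 2 * Re (Q w * (exp w)\<^sup>2) * ((Re v)\<^sup>2 - (Im v)\<^sup>2)
       - 4 * Im (Q w * (exp w)\<^sup>2) * Re v * Im v)"
    unfolding second_form_def unit_normal_rot rhs of_real_eq_iff by (simp only: simp_thms hip)
  also have "\<dots> \<longleftrightarrow> (\<forall>w. Im (Q w * (exp w)\<^sup>2) = 0 \<and>
       H w * (om * b (Re w))\<^sup>2 + 2 * Re (Q w * (exp w)\<^sup>2) = Luu (Re w) \<and>
       H w * (om * b (Re w))\<^sup>2 - 2 * Re (Q w * (exp w)\<^sup>2) = Lvv (Re w))" (is "(\<forall>w. \<forall>v. ?P w v) \<longleftrightarrow> (\<forall>w. ?R w)")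
  proof (intro iff_allI iffI)
    fix w assume P: "\<forall>v. ?P w v"
    show "?R w" using P[rule_format, of 1] P[rule_format, of \<i>] P[rule_format, of "Complex 1 1"] by auto
  next
    fix w assume R: "?R w"
    then have l: "Luu (Re w) = H w * (om * b (Re w))\<^sup>2 + 2 * Re (Q w * (exp w)\<^sup>2)"
      "Lvv (Re w) = H w * (om * b (Re w))\<^sup>2 - 2 * Re (Q w * (exp w)\<^sup>2)" by simp_all
    show "\<forall>v. ?P w v" unfolding l R[THEN conjunct1] by (simp add: algebra_simps)
  qed
  finally show ?thesis .
qed

lemma conformal_immersion_rot:
  assumes "smooth surf"
  shows "conformal_immersion X surf"
proof -
  let ?f = surf
  have hip: "hip (diff ?f w v) (diff ?f w v) = (om * b (Re w))\<^sup>2 * (cmod v)\<^sup>2" for w v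
    unfolding diff_motion_rot hip_congr_by[OF is_motion_det[OF motion]] hip_diff_rot cmod_power2
    by (simp add: power2_eq_square)
  have "inj (diff ?f w)" for w
  proof -
    have "linear (diff ?f w)"
      unfolding comp_def diff_eqI[OF motion_has_derivative[OF rot_deriv]]
      by (rule has_derivative_linear[OF motion_has_derivative[OF rot_deriv]])
    moreover have "v = 0" if "diff ?f w v = 0" for v
      using hip[of w v] nonzero that by (simp add: hip_def mat2_const)
    ultimately show ?thesis by (simp add: linear_injective_0)
  qed
  moreover have "range ?f \<subseteq> space_of X" using motion_space[OF motion in_space] by auto
  ultimately show ?thesis
    unfolding conformal_immersion_def hip metric_rot_dz using assms by blast
qed

end

end

section \<open>Smoothness, rotations and the wrapping number\<close>

lemma continuous_on_hm:
  assumes "continuous_on S a" "continuous_on S b" "continuous_on S d"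
  shows "continuous_on S (\<lambda>w. hm (a w) (b w) (d w))"
  using bounded_linear.continuous_on[OF bounded_linear_hm
      continuous_on_Pair[OF assms(1) continuous_on_Pair[OF assms(2,3)]]] by simp

lemma differentiable_on_UNIV:
  fixes f :: "complex \<Rightarrow> cmat"
  assumes "\<And>w. (f has_derivative F w) (at w)" shows "f differentiable_on UNIV"
  unfolding differentiable_on_def differentiable_def using assms by blast

lemma C_k_const: "C_k k (\<lambda>w. c)"
proof (induction k arbitrary: c)
  case (Suc k)
  have "diff (\<lambda>w. c) = (\<lambda>w v. 0)" by (auto simp: diff_def fun_eq_iff frechet_derivative_const)
  then show ?case using Suc by simp
qed simp

lemma diff_works: "f differentiable (at w) \<Longrightarrow> (f has_derivative diff f w) (at w)"
  using frechet_derivative_works[of f "at w"] by (simp add: diff_def[abs_def])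

lemma C_k_add: "C_k k f \<Longrightarrow> C_k k g \<Longrightarrow> C_k k (\<lambda>w. f w + g w)"
proof (induction k arbitrary: f g)
  case 0
  then show ?case by (simp add: continuous_on_add)
next
  case (Suc k)
  then have fg: "f differentiable (at w)" "g differentiable (at w)" for w
    by (auto simp: differentiable_on_eq_differentiable_at)
  then have "diff (\<lambda>w. f w + g w) = (\<lambda>w v. diff f w v + diff g w v)"
    using diff_eqI[OF has_derivative_add[OF diff_works diff_works]] by (auto simp: fun_eq_iff)
  then show ?case using Suc fg by (simp add: differentiable_on_add)
qed

lemma C_k_motion: "C_k k f \<Longrightarrow> C_k k (motion V c \<circ> f)"
proof (induction k arbitrary: f c)
  case 0
  then show ?case
    using bounded_linear.continuous_on[OF bounded_linear_congr_by, of UNIV f V]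
    by (auto simp: motion_def comp_def intro!: continuous_intros)
next
  case (Suc k)
  then have "f differentiable (at w)" for w
    by (auto simp: differentiable_on_eq_differentiable_at)
  then have "(f has_derivative diff f w) (at w)" for w
    by (rule diff_works)
  then have d: "(motion V c \<circ> f has_derivative (\<lambda>v. congr_by V (diff f w v))) (at w)" for w
    unfolding comp_def by (rule motion_has_derivative)
  have eq: "(\<lambda>w. diff (motion V c \<circ> f) w v) = motion V 0 \<circ> (\<lambda>w. diff f w v)" for v
    using diff_eqI[OF d] by (auto simp: fun_eq_iff)
  show ?case unfolding C_k.simps eq
    using Suc.prems Suc.IH[of _ 0] differentiable_on_UNIV[OF d] unfolding C_k.simps by blast
qed

text \<open>The family below is closed under both partial derivatives, so \<open>C\<^sup>k\<close> follows by induction.\<close>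

lemma C_k_exp:
  "C_k k (\<lambda>w. hm (x * exp (s * Re w)) (z * of_real (exp (s * Re w)) * cis (t * Im w)) (y * exp (s * Re w)))"
proof (induction k arbitrary: x y z)
  case 0
  have "continuous_on UNIV (\<lambda>w. hm (x * exp (s * Re w)) (z * of_real (exp (s * Re w)) * cis (t * Im w)) (y * exp (s * Re w)))"
    by (intro continuous_on_hm continuous_intros)
  then show ?case by simp
next
  case (Suc k)
  let ?f = "\<lambda>w. hm (x * exp (s * Re w)) (z * of_real (exp (s * Re w)) * cis (t * Im w)) (y * exp (s * Re w))"
  have e: "((\<lambda>w. x * exp (s * Re w)) has_derivative (\<lambda>v. s * x * exp (s * Re w) * Re v)) (at w)" for x w
    by (auto intro!: derivative_eq_intros simp: fun_eq_iff)
  have ce: "((\<lambda>w. z * of_real (exp (s * Re w)) * cis (t * Im w)) has_derivative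
     (\<lambda>v. (of_real (s * Re v) + \<i> * of_real (t * Im v)) * z * of_real (exp (s * Re w)) * cis (t * Im w))) (at w)" for w
    by (auto intro!: derivative_eq_intros simp: fun_eq_iff scaleR_conv_of_real algebra_simps)
  have d: "(?f has_derivative (\<lambda>v. hm (s * x * exp (s * Re w) * Re v)
      ((of_real (s * Re v) + \<i> * of_real (t * Im v)) * z * of_real (exp (s * Re w)) * cis (t * Im w))
      (s * y * exp (s * Re w) * Re v))) (at w)" for w
    by (rule hm_has_derivative e ce)+
  have 1: "(\<lambda>w. diff ?f w 1) = (\<lambda>w. hm ((s * x) * exp (s * Re w))
      ((of_real s * z) * of_real (exp (s * Re w)) * cis (t * Im w)) ((s * y) * exp (s * Re w)))"
    unfolding diff_eqI[OF d] by simp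
  have 2: "(\<lambda>w. diff ?f w \<i>) = (\<lambda>w. hm (0 * exp (s * Re w))
      ((\<i> * of_real t * z) * of_real (exp (s * Re w)) * cis (t * Im w)) (0 * exp (s * Re w)))"
    unfolding diff_eqI[OF d] by simp
  have "?f differentiable_on UNIV"
    by (rule differentiable_on_UNIV[OF d])
  then show ?case unfolding C_k.simps 1 2 using Suc.IH by blast
qed

lemma C_k_linear: "C_k k (\<lambda>w. hm (x * Re w) 0 (y * Re w))"
proof -
  have d: "((\<lambda>w. hm (x * Re w) 0 (y * Re w)) has_derivative (\<lambda>v. hm (x * Re v) 0 (y * Re v))) (at w)" for w
    by (rule hm_has_derivative) (auto intro!: derivative_eq_intros)
  have "(\<lambda>w. hm (x * Re w) 0 (y * Re w)) differentiable_on UNIV"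
    by (rule differentiable_on_UNIV[OF d])
  moreover from this have "continuous_on UNIV (\<lambda>w. hm (x * Re w) 0 (y * Re w))"
    by (rule differentiable_imp_continuous_on)
  ultimately show ?thesis
    by (cases k) (simp_all add: diff_eqI[OF d] C_k_const)
qed

definition axis_point :: "ambient \<Rightarrow> cmat" where
  "axis_point X = (case X of E3 \<Rightarrow> 0 | H3 \<Rightarrow> mat 1)"

definition axis_geodesic :: "ambient \<Rightarrow> real \<Rightarrow> cmat" where
  "axis_geodesic X s = (case X of E3 \<Rightarrow> hm s 0 (-s) | H3 \<Rightarrow> hm (exp s) 0 (exp (-s)))"

lemma hm_const: "mat 1 = hm 1 0 1" "0 = hm 0 0 0"
  by (simp_all add: hm_def mat2_const)

lemma geodesic_axis: "geodesic X (axis_point X) (hm 1 0 (-1)) s = axis_geodesic X s"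
  by (cases X) (simp_all add: axis_point_def axis_geodesic_def hm_const cosh_plus_sinh cosh_minus_sinh)

lemma geodesic_motion:
  assumes "is_motion X V c"
  shows "geodesic X (motion V c x) (congr_by V v) s = motion V c (geodesic X x v s)"
proof (cases X)
  case E3
  then show ?thesis by (simp add: motion_def congr_by_linear matrix_mult_bilinear)
next
  case H3
  then have "c = 0" using assms by (simp add: is_motion_def)
  then show ?thesis by (simp add: H3 congr_by_linear matrix_mult_bilinear)
qed

lemma is_geodesic_axis:
  assumes "is_motion X V c"
  shows "is_geodesic X (range (\<lambda>s. motion V c (axis_geodesic X s)))"
proof -
  have p: "axis_point X \<in> space_of X"
    by (cases X) (simp_all add: axis_point_def hm_const del: space_of.simps)
  have "congr_by V (hm 1 0 (-1)) \<in> tangent_space X (motion V c (axis_point X))"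
  proof (cases X)
    case E3
    then show ?thesis using assms congr_by_E3[of V "hm 1 0 (-1)"]
      by (simp add: is_motion_def del: space_of.simps)
  next
    case H3
    then show ?thesis using assms tangent_H3_transport[of V "hm 1 0 (-1)"]
      by (simp add: is_motion_def axis_point_def del: space_of.simps)
  qed
  moreover have "hip (congr_by V (hm 1 0 (-1))) (congr_by V (hm 1 0 (-1))) = 1"
    using assms by (simp add: hip_congr_by[OF is_motion_det])
  moreover have "(\<lambda>s. motion V c (axis_geodesic X s)) =
      geodesic X (motion V c (axis_point X)) (congr_by V (hm 1 0 (-1)))"
    by (simp add: fun_eq_iff geodesic_motion[OF assms] geodesic_axis)
  ultimately show ?thesis unfolding is_geodesic_def using motion_space[OF assms p] by metis
qed

definition turn :: "real \<Rightarrow> cmat" where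
  "turn t = mat2 (cis (t / 2)) 0 0 (cis (- t / 2))"

lemma congr_by_turn: "congr_by (turn t) (hm a b d) = hm a (cis t * b) d"
  by (simp add: turn_def hm_def cis_cnj cis_mult mult.commute mult.left_commute flip: mult.assoc)

lemma admissible_turn: "is_motion X (turn t) 0"
proof -
  have "(0::cmat) \<in> space_of E3" by (simp add: hm_const del: space_of.simps)
  then show ?thesis
    by (cases X) (simp_all add: is_motion_def turn_def cis_cnj cis_mult mat2_const del: space_of.simps)
qed

lemma rot_lift_rot: "rot a b d om (lift_rot t w) = congr_by (turn (om * t)) (rot a b d om w)"
  by (simp add: rot_def congr_by_turn lift_rot_def algebra_simps cis_mult[symmetric])

text \<open>The group is that of the diagonal unitary matrices, conjugated by the given rigid motion, and the axis is the image
of the diagonal geodesic.\<close>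

lemma rotation_group_rot:
  assumes V: "is_motion X V c"
  obtains R where "rotation_group X R"
    "\<And>t. (motion V c \<circ> rot a b d om) \<circ> lift_rot t = R t \<circ> (motion V c \<circ> rot a b d om)"
proof -
  obtain V' c' where I: "is_motion X V' c'" "\<And>x. motion V' c' (motion V c x) = x"
    "\<And>x. motion V c (motion V' c' x) = x" using motion_inverse[OF V] by blast
  define R where "R t x = motion V c (congr_by (turn (om * t)) (motion V' c' x))" for t x
  have "rigid_motion X (R t)" for t
  proof -
    obtain V1 c1 where 1: "is_motion X V1 c1" "\<And>x. congr_by (turn (om * t)) (motion V' c' x) = motion V1 c1 x"
      using motion_compose[OF admissible_turn I(1)] unfolding motion_0 by metis
    obtain V2 c2 where 2: "is_motion X V2 c2" "\<And>x. motion V c (motion V1 c1 x) = motion V2 c2 x"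
      using motion_compose[OF V 1(1)] by metis
    have "R t = motion V2 c2" by (simp add: fun_eq_iff R_def 1 2)
    then show ?thesis using motion_rigid[OF 2(1)] by simp
  qed
  moreover have "R t x = x" if "x \<in> range (\<lambda>s. motion V c (axis_geodesic X s))" for t x
    using that by (cases X) (auto simp: R_def I axis_geodesic_def congr_by_turn)
  moreover have "R 0 x = x \<and> (\<forall>s t. R (s + t) x = R s (R t x)) \<and> continuous_on UNIV (\<lambda>t. R t x)"
    if x: "x \<in> space_of X" for x
  proof -
    obtain a b d where y: "motion V' c' x = hm a b d"
      using motion_space[OF I(1) x] by (rule space_of_cases)
    have R: "R t x = motion V c (hm a (cis (om * t) * b) d)" for t
      by (simp add: R_def y congr_by_turn)
    have "R 0 x = x" unfolding R by (simp add: I flip: y)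
    moreover have "R (s + t) x = R s (R t x)" for s t
      unfolding R unfolding R_def I congr_by_turn by (simp add: cis_mult[symmetric] distrib_left mult.assoc)
    moreover have "continuous_on UNIV (\<lambda>t. hm a (cis (om * t) * b) d)"
      by (intro continuous_on_hm continuous_intros)
    then have "continuous_on UNIV (\<lambda>t. R t x)"
      unfolding R motion_def
      by (intro continuous_on_add continuous_on_const bounded_linear.continuous_on[OF bounded_linear_congr_by])
    ultimately show ?thesis by blast
  qed
  ultimately have "rotation_group X R"
    unfolding rotation_group_def rotation_about_def using is_geodesic_axis[OF V] by blast
  moreover have "(motion V c \<circ> rot a b d om) \<circ> lift_rot t = R t \<circ> (motion V c \<circ> rot a b d om)" for t
    by (simp add: fun_eq_iff rot_lift_rot R_def I)
  ultimately show ?thesis using that by blast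
qed

lemma wrapping_number_rot:
  assumes V: "is_motion X V c" and om: "om > 0" and b: "b 0 \<noteq> 0"
  shows "wrapping_number (motion V c \<circ> rot a b d om) om"
proof -
  let ?f = "motion V c \<circ> rot a b d om"
  obtain V' c' where I: "\<And>x. motion V' c' (motion V c x) = x" by (rule motion_inverse[OF V]) blast
  have cis: "cis (om * t) = 1" if "?f \<circ> lift_rot t = ?f" for t
  proof -
    have "motion V' c' (?f (lift_rot t 0)) = motion V' c' (?f 0)" using that by (metis comp_apply)
    then have "rot a b d om (lift_rot t 0) = rot a b d om 0" by (simp add: I)
    then show ?thesis using b by (simp add: rot_def lift_rot_def)
  qed
  have "?f \<circ> lift_rot (2 * pi / om) = ?f"
    using om by (simp add: fun_eq_iff rot_lift_rot) (simp add: rot_def congr_by_turn)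
  moreover have "2 * pi / om \<le> t" if "t > 0" "?f \<circ> lift_rot t = ?f" for t
  proof -
    have "cos (om * t) = 1" using cis[OF that(2)] by (metis cis.simps(1) one_complex.simps(1))
    then obtain n :: int where n: "om * t = of_int n * 2 * pi" using cos_one_2pi_int by blast
    have "of_int n * (2 * pi) > 0" using n om that(1) by (metis mult.assoc mult_pos_pos)
    then have "n > 0" by (simp add: zero_less_mult_iff)
    then have "1 * (2 * pi) \<le> of_int n * (2 * pi)" by (intro mult_right_mono) auto
    then show ?thesis using n om by (simp add: field_simps)
  qed
  ultimately show ?thesis
    unfolding wrapping_number_def using om by (intro exI[of _ "2 * pi / om"]) auto
qed

section \<open>The catenoids in normal position\<close>

definition cmc :: "ambient \<Rightarrow> real" where
  "cmc X = (case X of E3 \<Rightarrow> 0 | H3 \<Rightarrow> 1)"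

lemma cmc_simps [simp]: "cmc E3 = 0" "cmc H3 = 1"
  by (simp_all add: cmc_def)

text \<open>The families of profile functions, with parameters \<open>q\<close>, \<open>\<mu>\<close>, \<open>\<nu>\<close>, of the catenoids with diagonal axis. Here \<open>\<nu>\<close> is
half the angular speed of the rotation and \<open>\<mu>\<close> half the rate of growth of the profile. In \<open>E3\<close> the two agree and the height is a linear function. In \<open>H3\<close> the diagonal entries
are those of \<open>M\<^sup>* M\<close> with \<open>M = D\<^sub>\<mu> T D\<^sub>\<nu>\<^sup>-\<^sup>1\<close>, where \<open>D\<close> denotes diagonal exponentials and \<open>T\<close> is the constant real
matrix of determinant 1 with entries \<open>(\<mu> + \<nu>) / 2 \<mu>\<close>, \<open>(\<nu> - \<mu>) / 2 \<mu> \<nu>\<close>, \<open>(\<nu> - \<mu>) / 2\<close>, \<open>(\<mu> + \<nu>) / 2 \<nu>\<close>.\<close>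

type_synonym profile = "real \<Rightarrow> real \<Rightarrow> real \<Rightarrow> real \<Rightarrow> real"

definition model_b :: profile where
  "model_b q mu nu u = - (q / (4 * nu)) * (exp (2 * mu * u) / mu\<^sup>2 + exp (- 2 * mu * u))"

fun model_a :: "ambient \<Rightarrow> profile" where
  "model_a E3 q mu nu u = q * u / nu"
| "model_a H3 q mu nu u = exp (- 2 * nu * u) *
    (((mu + nu) / (2 * mu))\<^sup>2 * exp (2 * mu * u) + ((nu - mu) / 2)\<^sup>2 * exp (- 2 * mu * u))"

fun model_d :: "ambient \<Rightarrow> profile" where
  "model_d E3 q mu nu u = - (q * u / nu)"
| "model_d H3 q mu nu u = exp (2 * nu * u) *
    (((nu - mu) / (2 * mu * nu))\<^sup>2 * exp (2 * mu * u) + ((mu + nu) / (2 * nu))\<^sup>2 * exp (- 2 * mu * u))"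

definition model_b1 :: profile where
  "model_b1 q mu nu u = - (q * mu / (2 * nu)) * (exp (2 * mu * u) / mu\<^sup>2 - exp (- 2 * mu * u))"

lemma model_b_deriv:
  assumes "mu > 0" "nu > 0"
  shows "(model_b q mu nu has_real_derivative model_b1 q mu nu u) (at u)"
    "(model_b1 q mu nu has_real_derivative 4 * mu\<^sup>2 * model_b q mu nu u) (at u)"
  unfolding model_b_def[abs_def] model_b1_def[abs_def]
  using assms by (auto intro!: derivative_eq_intros simp: field_simps power2_eq_square)

fun model_a1 :: "ambient \<Rightarrow> profile" where
  "model_a1 E3 q mu nu u = q / nu"
| "model_a1 H3 q mu nu u = - nu * exp (- 2 * nu * u) * (model_b1 q mu nu u + 2 * nu * model_b q mu nu u)"

fun model_d1 :: "ambient \<Rightarrow> profile" where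
  "model_d1 E3 q mu nu u = - (q / nu)"
| "model_d1 H3 q mu nu u = - (1 / nu) * exp (2 * nu * u) * (model_b1 q mu nu u - 2 * nu * model_b q mu nu u)"

fun model_a2 :: "ambient \<Rightarrow> profile" where
  "model_a2 E3 q mu nu u = 0"
| "model_a2 H3 q mu nu u = - (4 * nu * q) * exp (- 2 * nu * u) * model_b q mu nu u"

fun model_d2 :: "ambient \<Rightarrow> profile" where
  "model_d2 E3 q mu nu u = 0"
| "model_d2 H3 q mu nu u = - (4 * q / nu) * exp (2 * nu * u) * model_b q mu nu u"

definition model :: "ambient \<Rightarrow> real \<Rightarrow> real \<Rightarrow> real \<Rightarrow> complex \<Rightarrow> cmat" where
  "model X q mu nu = rot (model_a X q mu nu) (model_b q mu nu) (model_d X q mu nu) (2 * nu)"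

text \<open>The algebra behind the hyperbolic catenoids. The exponentials and the inverses of \<open>\<mu>\<close> and \<open>\<nu>\<close> enter as unknowns
\<open>E, F, G, K, m, n\<close> subject to \<open>E F = G K = \<mu> m = \<nu> n = 1\<close>. The first identity reflects \<open>det T = 1\<close>; the other
two express the momentum along the axis and the difference of the rescaled diagonal entries by the
profile and its derivative.\<close>

lemma cousin_identities:
 fixes E F G K m n mu nu q a b d a1 b1 d1 :: real
 assumes ef: "E * F = 1" and gk: "G * K = 1" and m: "mu * m = 1" and n: "nu * n = 1" and q_eq: "q = mu\<^sup>2 - nu\<^sup>2"
  and q: "q \<noteq> 0"
  and b: "4 * b = - (q * n) * (E * m\<^sup>2 + F)" "2 * b1 = - (q * mu * n) * (E * m\<^sup>2 - F)"
  and a: "4 * a = G * ((1 + nu * m)\<^sup>2 * E + (nu - mu)\<^sup>2 * F)"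
  and d: "4 * d = K * ((m - n)\<^sup>2 * E + (mu * n + 1)\<^sup>2 * F)"
  and a1: "a1 = - nu * G * (b1 + 2 * nu * b)" and d1: "d1 = - n * K * (b1 - 2 * nu * b)"
shows "a * d - b\<^sup>2 = 1" "a1 * d - a * d1 = 2 * (q * n - 2 * nu * b\<^sup>2)"
  "q * (K * a * n - nu * G * d) = - 2 * nu * b1"
proof -
  have Ka: "4 * (K * a) = (1 + nu * m)\<^sup>2 * E + (nu - mu)\<^sup>2 * F" using a gk by algebra
  have Gd: "4 * (G * d) = (m - n)\<^sup>2 * E + (mu * n + 1)\<^sup>2 * F" using d gk by algebra
  have t: "(1 + nu * m) * (m - n) = - (q * n * m\<^sup>2)" "(nu - mu) * (mu * n + 1) = - (q * n)"
    using m n q_eq by algebra+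
  have b': "4 * b = (1 + nu * m) * (m - n) * E + (nu - mu) * (mu * n + 1) * F" unfolding t b by algebra
  have det: "(1 + nu * m) * (mu * n + 1) - (m - n) * (nu - mu) = 4" using m n by algebra
  have "16 * (a * d) = (4 * (K * a)) * (4 * (G * d))" using gk by algebra
  also have "\<dots> = (4 * b)\<^sup>2 + (E * F) * ((1 + nu * m) * (mu * n + 1) - (m - n) * (nu - mu))\<^sup>2"
    unfolding Ka Gd b' by algebra
  also have "\<dots> = 16 * b\<^sup>2 + 16" unfolding ef det by algebra
  finally show "a * d - b\<^sup>2 = 1" by algebra
  have x: "n * (1 + nu * m)\<^sup>2 - nu * (m - n)\<^sup>2 = 4 * m" "n * (nu - mu)\<^sup>2 - nu * (mu * n + 1)\<^sup>2 = - (4 * mu)"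
    "n * (1 + nu * m)\<^sup>2 + nu * (m - n)\<^sup>2 = 2 * ((mu\<^sup>2 + nu\<^sup>2) * n * m\<^sup>2)"
    "n * (nu - mu)\<^sup>2 + nu * (mu * n + 1)\<^sup>2 = 2 * ((mu\<^sup>2 + nu\<^sup>2) * n)"
    using m n by algebra+
  have "4 * (K * a * n - nu * G * d) = n * (4 * (K * a)) - nu * (4 * (G * d))" by algebra
  also have "\<dots> = (n * (1 + nu * m)\<^sup>2 - nu * (m - n)\<^sup>2) * E + (n * (nu - mu)\<^sup>2 - nu * (mu * n + 1)\<^sup>2) * F"
    unfolding Ka Gd by algebra
  also have "\<dots> = 4 * (m * E - mu * F)" unfolding x by algebra
  finally have minus: "K * a * n - nu * G * d = m * E - mu * F" by simp
  show third: "q * (K * a * n - nu * G * d) = - 2 * nu * b1"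
    unfolding minus using m n b(2) by algebra
  have "4 * (K * a * n + nu * G * d) = n * (4 * (K * a)) + nu * (4 * (G * d))" by algebra
  also have "\<dots> = (n * (1 + nu * m)\<^sup>2 + nu * (m - n)\<^sup>2) * E + (n * (nu - mu)\<^sup>2 + nu * (mu * n + 1)\<^sup>2) * F"
    unfolding Ka Gd by algebra
  finally have "2 * (K * a * n + nu * G * d) = (mu\<^sup>2 + nu\<^sup>2) * n * (E * m\<^sup>2 + F)" unfolding x by algebra
  then have plus: "q * (K * a * n + nu * G * d) = - (2 * (mu\<^sup>2 + nu\<^sup>2) * b)" using b(1) by algebra
  have "4 * b1\<^sup>2 = (2 * b1)\<^sup>2" by algebra
  also have "\<dots> = mu\<^sup>2 * (4 * b)\<^sup>2 - 4 * (q * n)\<^sup>2 * (E * F) * (mu * m)\<^sup>2" unfolding b by algebra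
  finally have b1: "b1\<^sup>2 = 4 * mu\<^sup>2 * b\<^sup>2 - (q * n)\<^sup>2" unfolding ef m by (simp add: power_mult_distrib)
  have "q * (a1 * d - a * d1) = b1 * (q * (K * a * n - nu * G * d)) - 2 * nu * b * (q * (K * a * n + nu * G * d))"
    unfolding a1 d1 by algebra
  also have "\<dots> = - 2 * nu * b1\<^sup>2 + 4 * nu * (mu\<^sup>2 + nu\<^sup>2) * b\<^sup>2" unfolding third plus by algebra
  also have "\<dots> = q * (2 * (q * n - 2 * nu * b\<^sup>2))" unfolding b1 using n q_eq by algebra
  finally show "a1 * d - a * d1 = 2 * (q * n - 2 * nu * b\<^sup>2)" using q by simp
qed

locale cat_model =
  fixes X :: ambient and q mu nu :: real
  assumes pos: "mu > 0" "nu > 0" and q: "q \<noteq> 0"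
    and relation: "mu\<^sup>2 = (case X of E3 \<Rightarrow> nu\<^sup>2 | H3 \<Rightarrow> nu\<^sup>2 + q)"
begin

abbreviation "a \<equiv> model_a X q mu nu"
abbreviation "b \<equiv> model_b q mu nu"
abbreviation "d \<equiv> model_d X q mu nu"
abbreviation "a1 \<equiv> model_a1 X q mu nu"
abbreviation "b1 \<equiv> model_b1 q mu nu"
abbreviation "d1 \<equiv> model_d1 X q mu nu"
abbreviation "a2 \<equiv> model_a2 X q mu nu"
abbreviation "b2 \<equiv> (\<lambda>u. 4 * mu\<^sup>2 * model_b q mu nu u)"
abbreviation "d2 \<equiv> model_d2 X q mu nu"

lemma mu_nu_E3: "X = E3 \<Longrightarrow> mu = nu"
  using relation pos by simp

lemmas b_deriv = model_b_deriv[OF pos]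

text \<open>The energy of the equation \<open>b'' = 4 \<mu>\<^sup>2 b\<close>; up to a factor its value is the product of the coefficients of the
two exponentials.\<close>

lemma first_integral_b: "(b1 u)\<^sup>2 = 4 * mu\<^sup>2 * (b u)\<^sup>2 - (q / nu)\<^sup>2"
proof -
  define E F where EF: "E = exp (2 * mu * u)" "F = exp (- 2 * mu * u)"
  have ef: "E * F = 1" by (simp add: EF flip: exp_add)
  have "4 * mu\<^sup>2 * (b u)\<^sup>2 - (b1 u)\<^sup>2 = (q / nu)\<^sup>2 * (E * F)"
    unfolding model_b_def model_b1_def EF[symmetric] using pos by (simp add: field_simps power2_eq_square)
  then show ?thesis unfolding ef by simp
qed

lemma b_nonzero: "b u \<noteq> 0"
proof -
  have "exp (2 * mu * u) / mu\<^sup>2 + exp (- 2 * mu * u) > 0" using pos by (intro add_pos_pos) auto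
  then show ?thesis using q pos unfolding model_b_def by simp
qed

context
  assumes X: "X = H3"
begin

lemma q_eq: "q = mu\<^sup>2 - nu\<^sup>2" using relation X by simp

lemma hyperbolic_identities:
  "a u * d u - (b u)\<^sup>2 = 1"
  "a1 u * d u - a u * d1 u = 2 * (q / nu - 2 * nu * (b u)\<^sup>2)"
  "q * (exp (2 * nu * u) * a u / nu - nu * exp (- 2 * nu * u) * d u) = - 2 * nu * b1 u"
  "- 2 * nu * a u + exp (- 2 * nu * u) *
    (((mu + nu) / (2 * mu))\<^sup>2 * (2 * mu * exp (2 * mu * u)) - ((nu - mu) / 2)\<^sup>2 * (2 * mu * exp (- 2 * mu * u))) = a1 u"
  "2 * nu * d u + exp (2 * nu * u) *
    (((nu - mu) / (2 * mu * nu))\<^sup>2 * (2 * mu * exp (2 * mu * u)) - ((mu + nu) / (2 * nu))\<^sup>2 * (2 * mu * exp (- 2 * mu * u))) = d1 u"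
proof -
  define E F G K where EF: "E = exp (2 * mu * u)" "F = exp (- 2 * mu * u)"
     "G = exp (- 2 * nu * u)" "K = exp (2 * nu * u)"
  have ef: "E * F = 1" and gk: "G * K = 1" by (simp_all add: EF flip: exp_add)
  define m n where mn: "m = 1 / mu" "n = 1 / nu"
  have m: "mu * m = 1" and n: "nu * n = 1" using pos by (simp_all add: mn)
  have div: "x / mu = x * m" "x / nu = x * n" for x by (simp_all add: mn)
  have b: "4 * b u = - (q * n) * (E * m\<^sup>2 + F)" "2 * b1 u = - (q * mu * n) * (E * m\<^sup>2 - F)"
    unfolding model_b_def model_b1_def EF[symmetric] mn using pos by (simp_all add: field_simps power2_eq_square)
  have a: "4 * a u = G * ((1 + nu * m)\<^sup>2 * E + (nu - mu)\<^sup>2 * F)"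
    unfolding X model_a.simps EF[symmetric] mn using pos by (simp add: field_simps power2_eq_square)
  have d: "4 * d u = K * ((m - n)\<^sup>2 * E + (mu * n + 1)\<^sup>2 * F)"
    unfolding X model_d.simps EF[symmetric] mn using pos by (simp add: field_simps power2_eq_square)
  have a1: "a1 u = - nu * G * (b1 u + 2 * nu * b u)" and d1: "d1 u = - n * K * (b1 u - 2 * nu * b u)"
    unfolding X by (simp_all add: EF mn)
  note ids = cousin_identities[OF ef gk m n q_eq q b a d a1 d1]
  show "a u * d u - (b u)\<^sup>2 = 1" "a1 u * d u - a u * d1 u = 2 * (q / nu - 2 * nu * (b u)\<^sup>2)"
    "q * (exp (2 * nu * u) * a u / nu - nu * exp (- 2 * nu * u) * d u) = - 2 * nu * b1 u"
    using ids unfolding div EF[symmetric] by simp_all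
  have T: "((mu + nu) / (2 * mu))\<^sup>2 = (1 + nu * m)\<^sup>2 / 4" "((nu - mu) / 2)\<^sup>2 = (nu - mu)\<^sup>2 / 4"
    "((nu - mu) / (2 * mu * nu))\<^sup>2 = (m - n)\<^sup>2 / 4" "((mu + nu) / (2 * nu))\<^sup>2 = (mu * n + 1)\<^sup>2 / 4"
    unfolding mn using pos by (simp_all add: field_simps power2_eq_square)
  show "- 2 * nu * a u + exp (- 2 * nu * u) *
    (((mu + nu) / (2 * mu))\<^sup>2 * (2 * mu * exp (2 * mu * u)) - ((nu - mu) / 2)\<^sup>2 * (2 * mu * exp (- 2 * mu * u))) = a1 u"
    unfolding EF[symmetric] T using a b a1 m n q_eq by algebra
  show "2 * nu * d u + exp (2 * nu * u) *
    (((nu - mu) / (2 * mu * nu))\<^sup>2 * (2 * mu * exp (2 * mu * u)) - ((mu + nu) / (2 * nu))\<^sup>2 * (2 * mu * exp (- 2 * mu * u))) = d1 u"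
    unfolding EF[symmetric] T using d b d1 m n q_eq by algebra
qed

lemma H3_deriv:
  "(a has_real_derivative a1 u) (at u)" "(d has_real_derivative d1 u) (at u)"
  "(a1 has_real_derivative a2 u) (at u)" "(d1 has_real_derivative d2 u) (at u)"
proof -
  show "(a has_real_derivative a1 u) (at u)"
    unfolding hyperbolic_identities(4)[symmetric] unfolding X model_a.simps[abs_def]
    by (rule derivative_eq_intros refl)+ (simp add: algebra_simps)
  show "(d has_real_derivative d1 u) (at u)"
    unfolding hyperbolic_identities(5)[symmetric] unfolding X model_d.simps[abs_def]
    by (rule derivative_eq_intros refl)+ (simp add: algebra_simps)
  have "- nu * (exp (- 2 * nu * u) * (4 * mu\<^sup>2 * b u + 2 * nu * b1 u) - 2 * nu * exp (- 2 * nu * u) * (b1 u + 2 * nu * b u)) = a2 u"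
    unfolding X model_a2.simps using q_eq by algebra
  then show "(a1 has_real_derivative a2 u) (at u)"
    unfolding X model_a1.simps[abs_def]
    by (auto intro!: derivative_eq_intros b_deriv simp: algebra_simps)
  have "- (1 / nu) * (exp (2 * nu * u) * (4 * mu\<^sup>2 * b u - 2 * nu * b1 u) + 2 * nu * exp (2 * nu * u) * (b1 u - 2 * nu * b u)) = d2 u"
    unfolding X model_d2.simps using q_eq pos by (simp add: field_simps) algebra
  moreover have "((\<lambda>u. - (1 / nu) * (exp (2 * nu * u) * (b1 u - 2 * nu * b u))) has_real_derivative
      - (1 / nu) * (exp (2 * nu * u) * (4 * mu\<^sup>2 * b u - 2 * nu * b1 u) + 2 * nu * exp (2 * nu * u) * (b1 u - 2 * nu * b u))) (at u)"
    by (rule DERIV_cmult) (auto intro!: derivative_eq_intros b_deriv simp: algebra_simps)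
  ultimately show "(d1 has_real_derivative d2 u) (at u)"
    unfolding X model_d1.simps[abs_def] by (simp only: mult.assoc)
qed

end

sublocale revolution X a b d a1 b1 d1 a2 b2 d2 "2 * nu"
proof
  show "(b has_real_derivative b1 u) (at u)" "(b1 has_real_derivative b2 u) (at u)" for u
    by (rule b_deriv)+
  have "(a has_real_derivative a1 u) (at u) \<and> (d has_real_derivative d1 u) (at u) \<and>
    (a1 has_real_derivative a2 u) (at u) \<and> (d1 has_real_derivative d2 u) (at u)" for u
  proof (cases X)
    case E3
    show ?thesis unfolding E3 model_a.simps[abs_def] model_d.simps[abs_def] model_a1.simps[abs_def]
        model_d1.simps[abs_def] model_a2.simps model_d2.simps
      using pos by (auto intro!: derivative_eq_intros)
  qed (use H3_deriv in blast)
  then show "(a has_real_derivative a1 u) (at u)" "(d has_real_derivative d1 u) (at u)"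
    "(a1 has_real_derivative a2 u) (at u)" "(d1 has_real_derivative d2 u) (at u)" for u by blast+
  show "X = E3 \<Longrightarrow> d u = - a u" for u by auto
  show "X = H3 \<Longrightarrow> a u * d u - (b u)\<^sup>2 = 1" for u by (rule hyperbolic_identities)
  show "X = H3 \<Longrightarrow> a u + d u > 0" for u
  proof -
    assume X: "X = H3"
    have "a u \<ge> 0" "d u \<ge> 0" using X by simp_all
    moreover have "a u \<noteq> 0"
    proof
      assume "a u = 0"
      then have "- (b u)\<^sup>2 = 1" using hyperbolic_identities(1)[OF X, of u]
        by (metis diff_0 mult_zero_left)
      then show False using zero_le_power2[of "b u"] by linarith
    qed
    ultimately show "a u + d u > 0" by linarith
  qed
  show "(b1 u)\<^sup>2 - a1 u * d1 u = (2 * nu * b u)\<^sup>2" for u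
  proof (cases X)
    case E3
    show ?thesis unfolding first_integral_b unfolding E3 mu_nu_E3[OF E3] by (simp add: power2_eq_square)
  next
    case H3
    have "a1 u * d1 u = (exp (- 2 * nu * u) * exp (2 * nu * u)) * ((b1 u)\<^sup>2 - (2 * nu * b u)\<^sup>2)"
      unfolding H3 model_a1.simps model_d1.simps using pos by (simp add: field_simps power2_eq_square)
    then show ?thesis by (simp flip: exp_add)
  qed
  show "2 * nu \<noteq> 0" using pos by simp
  show "b u \<noteq> 0" for u by (rule b_nonzero)
qed

lemma n2_H3:
  assumes H3: "X = H3" shows "n2 u = (q / nu - 2 * nu * (b u)\<^sup>2) / (2 * nu * b u)"
proof -
  have "n2 u = (a1 u * d u - a u * d1 u) / (2 * (2 * nu) * b u)"
    unfolding n2_def A_def D_def unfolding H3 ambient.case ..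
  then show ?thesis unfolding hyperbolic_identities(2)[OF H3]
    using pos b_nonzero[of u] by (simp add: field_simps)
qed

lemma Lvv_model: "Lvv u = cmc X * (2 * nu * b u)\<^sup>2 - 2 * q"
proof (cases X)
  case E3
  then show ?thesis unfolding Lvv_def n2_def A_def D_def using pos b_nonzero[of u]
    by (simp add: field_simps power2_eq_square)
next
  case H3
  note n2 = n2_H3[OF H3, of u]
  then show ?thesis unfolding Lvv_def n2 using pos b_nonzero[of u] H3
    by (simp add: field_simps power2_eq_square)
qed

text \<open>The difference of the two coefficients is the constant \<open>4 q\<close>, which becomes the Hopf differential; their sum is
the mean curvature term.\<close>

lemma Luu_model: "Luu u = cmc X * (2 * nu * b u)\<^sup>2 + 2 * q"
proof (cases X)
  case E3
  then show ?thesis unfolding Luu_def n2_def A_def D_def using pos b_nonzero[of u] mu_nu_E3[OF E3]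
    by (simp add: field_simps power2_eq_square)
next
  case H3
  note n2 = n2_H3[OF H3, of u]
  define G K where GK: "G = exp (- 2 * nu * u)" "K = exp (2 * nu * u)"
  have gk: "G * K = 1" by (simp add: GK flip: exp_add)
  have a1: "a1 u = - nu * G * (b1 u + 2 * nu * b u)" and nd1: "nu * d1 u = - K * (b1 u - 2 * nu * b u)"
    and a2: "a2 u = - (4 * nu * q) * G * b u" and nd2: "nu * d2 u = - (4 * q) * K * b u"
    unfolding GK H3 using pos by simp_all
  have h3: "q * (K * a u - nu * nu * G * d u) = - 2 * nu * nu * b1 u"
    using hyperbolic_identities(3)[OF H3, of u] pos unfolding GK by (simp add: field_simps)
  have n13: "2 * nu * b u * n1 u = b u * a1 u - a u * b1 u" "2 * nu * b u * n3 u = d u * b1 u - b u * d1 u"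
    unfolding n1_def n3_def A_def B_def D_def using pos b_nonzero[of u]
    unfolding H3 ambient.case by simp_all
  have "nu * (2 * nu * b u * (a2 u * n3 u + d2 u * n1 u)) =
     a2 u * nu * (d u * b1 u - b u * d1 u) + (nu * d2 u) * (b u * a1 u - a u * b1 u)"
    using n13 by algebra
  also have "\<dots> = - 8 * nu * nu * b u * (b1 u)\<^sup>2 + 16 * nu * nu * q * (b u)\<^sup>2 * b u"
    unfolding a2 nd2 using a1 nd1 h3 gk by algebra
  finally have "(2 * nu * nu * b u) * (a2 u * n3 u + d2 u * n1 u) =
      (2 * nu * nu * b u) * (- 4 * (b1 u)\<^sup>2 + 8 * q * (b u)\<^sup>2)" by algebra
  moreover have "2 * nu * nu * b u \<noteq> 0" using pos b_nonzero[of u] by simp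
  ultimately have S: "a2 u * n3 u + d2 u * n1 u = - 4 * (b1 u)\<^sup>2 + 8 * q * (b u)\<^sup>2"
    by (metis mult_left_cancel)
  have bn2: "b u * n2 u = q / (2 * nu\<^sup>2) - (b u)\<^sup>2"
    unfolding n2 using pos b_nonzero[of u] by (simp add: divide_simps) algebra
  have "Luu u = 4 * mu\<^sup>2 * (b u * n2 u) - (a2 u * n3 u + d2 u * n1 u) / 2"
    by (simp add: Luu_def)
  also have "\<dots> = 4 * mu\<^sup>2 * (q / (2 * nu\<^sup>2) - (b u)\<^sup>2) + 2 * (4 * mu\<^sup>2 * (b u)\<^sup>2 - (q / nu)\<^sup>2) - 4 * q * (b u)\<^sup>2"
    unfolding S bn2 first_integral_b by (simp add: field_simps)
  also have "\<dots> = 4 * (nu\<^sup>2 + q) * (q / (2 * nu\<^sup>2) - (b u)\<^sup>2) + 2 * (4 * (nu\<^sup>2 + q) * (b u)\<^sup>2 - (q / nu)\<^sup>2) - 4 * q * (b u)\<^sup>2"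
    using relation H3 by simp
  also have "\<dots> = (2 * nu * b u)\<^sup>2 + 2 * q"
    using pos by (simp add: divide_simps power_divide) algebra
  finally show ?thesis using H3 by simp
qed

abbreviation "cat V c \<equiv> motion V c \<circ> model X q mu nu"

lemma smooth_model: "smooth (cat V c)"
proof -
  let ?B = "\<lambda>w. hm (0 * exp (2 * mu * Re w)) (of_real (- (q / (4 * nu * mu\<^sup>2))) * of_real (exp (2 * mu * Re w)) * cis (2 * nu * Im w)) (0 * exp (2 * mu * Re w))
     + hm (0 * exp (- 2 * mu * Re w)) (of_real (- (q / (4 * nu))) * of_real (exp (- 2 * mu * Re w)) * cis (2 * nu * Im w)) (0 * exp (- 2 * mu * Re w))"
  have B: "?B w = hm 0 (of_real (b (Re w)) * cis (2 * nu * Im w)) 0" for w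
    by (simp add: model_b_def algebra_simps)
  have CB: "C_k k ?B" for k by (rule C_k_add C_k_exp)+
  have "C_k k (model X q mu nu)" for k
  proof (cases X)
    case E3
    have "model X q mu nu w = ?B w + hm (q / nu * Re w) 0 (- (q / nu) * Re w)" for w
      unfolding B by (simp add: model_def rot_def E3)
    then have eq: "model X q mu nu = (\<lambda>w. ?B w + hm (q / nu * Re w) 0 (- (q / nu) * Re w))" by blast
    show ?thesis unfolding eq by (rule C_k_add[OF CB C_k_linear])
  next
    case H3
    let ?D = "\<lambda>s x y w. hm (x * exp (s * Re w)) (0 * of_real (exp (s * Re w)) * cis (0 * Im w)) (y * exp (s * Re w))"
    let ?S = "\<lambda>w. ?B w + (?D (- 2 * nu + 2 * mu) (((mu + nu) / (2 * mu))\<^sup>2) 0 w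
        + (?D (- 2 * nu + - 2 * mu) (((nu - mu) / 2)\<^sup>2) 0 w + (?D (2 * nu + 2 * mu) 0 (((nu - mu) / (2 * mu * nu))\<^sup>2) w
        + ?D (2 * nu + - 2 * mu) 0 (((mu + nu) / (2 * nu))\<^sup>2) w)))"
    have "model X q mu nu w = ?S w" for w
    proof -
      have "exp (s * u) * (x * exp (t * u) + y * exp (r * u)) = x * exp ((s + t) * u) + y * exp ((s + r) * u)"
        for s t r u x y :: real
        by (simp add: distrib_left distrib_right exp_add)
      then show ?thesis
        unfolding B by (simp only: model_def rot_def H3 model_a.simps model_d.simps) simp
    qed
    then have eq: "model X q mu nu = ?S" by blast
    show ?thesis unfolding eq by (intro C_k_add[OF CB] C_k_add C_k_exp)
  qed
  then show ?thesis unfolding smooth_def using C_k_motion by blast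
qed

lemma second_form_model:
  assumes "is_motion X V c"
  shows "second_form X (cat V c) (\<lambda>w. of_real q / (exp w)\<^sup>2) (\<lambda>w. cmc X)"
  unfolding model_def second_form_rot[OF assms] Luu_model Lvv_model by simp

text \<open>The unit normal is unique, hence so is the Hopf differential; a vanishing one would force \<open>Luu = Lvv\<close>.\<close>

lemma not_flat_model:
  assumes "is_motion X V c"
  shows "\<not> flat X (cat V c)"
proof
  assume "flat X (cat V c)"
  then obtain H where "second_form X (cat V c) (\<lambda>w. 0) H"
    by (auto simp: flat_def hopf_differential_def)
  then have "H 0 * (2 * nu * b (Re 0))\<^sup>2 = Luu (Re 0) \<and> H 0 * (2 * nu * b (Re 0))\<^sup>2 = Lvv (Re 0)"
    unfolding model_def second_form_rot[OF assms] by (elim allE[of _ 0]) simp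
  then have "Luu (Re 0) = Lvv (Re 0)" by metis
  then show False using q by (simp add: Luu_model Lvv_model)
qed

lemma catenoid_model:
  assumes V: "is_motion X V c"
  shows "catenoid X (cat V c)"
    "hopf_differential X (cat V c) (\<lambda>w. of_real q / (exp w)\<^sup>2)"
    "wrapping_number (cat V c) (2 * nu)"
    "metric_coeff (cat V c) w =
      (q / 2 * (exp (2 * mu * Re w) / mu\<^sup>2 + exp (- 2 * mu * Re w)) / exp (Re w))\<^sup>2"
proof -
  show "wrapping_number (cat V c) (2 * nu)"
    unfolding model_def by (rule wrapping_number_rot[OF V]) (use pos b_nonzero in auto)
  show "hopf_differential X (cat V c) (\<lambda>w. of_real q / (exp w)\<^sup>2)"
    unfolding hopf_differential_def using second_form_model[OF V] by blast
  show "metric_coeff (cat V c) w =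
      (q / 2 * (exp (2 * mu * Re w) / mu\<^sup>2 + exp (- 2 * mu * Re w)) / exp (Re w))\<^sup>2"
    unfolding model_def metric_rot[OF V] using pos by (simp add: model_b_def power_divide power_mult_distrib)
  have "conformal_immersion X (cat V c)"
    using conformal_immersion_rot[OF V] smooth_model unfolding model_def by blast
  moreover have "mean_curvature X (cat V c) (\<lambda>w. cmc X)"
    unfolding mean_curvature_def using second_form_model[OF V] by blast
  moreover have "\<exists>R. rotation_group X R \<and> (\<forall>t. (cat V c) \<circ> lift_rot t = R t \<circ> (cat V c))"
    unfolding model_def by (rule rotation_group_rot[OF V]) blast
  ultimately show "catenoid X (cat V c)"
    using not_flat_model[OF V] unfolding catenoid_def cmc_def by blast
qed

end

section \<open>The frame of the potential and its immersion\<close>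

lemma bounded_bilinear_mult: "bounded_bilinear (\<lambda>(A :: cmat) (B :: cmat). A ** B)"
  by (rule bilinear_conv_bounded_bilinear[THEN iffD1])
     (simp add: bilinear_def linear_iff matrix_mult_bilinear)

lemma bounded_linear_adjugate2: "bounded_linear adjugate2"
  by (rule linear_conv_bounded_linear[THEN iffD1], rule linearI) (metis (no_types) mat2_cases mat2_arith add_uminus_conv_diff minus_add_distrib scaleR_minus_right)+

lemma bounded_linear_mat2: "bounded_linear (\<lambda>(a, b, c, d). mat2 a b c d)"
  by (rule linear_conv_bounded_linear[THEN iffD1], rule linearI) auto

lemma mat2_has_derivative:
  assumes "(a has_field_derivative a') (at w)" "(b has_field_derivative b') (at w)"
    "(c has_field_derivative c') (at w)" "(d has_field_derivative d') (at w)"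
  shows "((\<lambda>w. mat2 (a w) (b w) (c w) (d w)) has_derivative (\<lambda>v. cscale v (mat2 a' b' c' d'))) (at w)"
proof -
  have "((\<lambda>w. (a w, b w, c w, d w)) has_derivative (\<lambda>v. (a' * v, b' * v, c' * v, d' * v))) (at w)"
    using assms unfolding has_field_derivative_def by (intro has_derivative_Pair)
  from bounded_linear.has_derivative[OF bounded_linear_mat2 this]
  show ?thesis by (simp add: mult.commute)
qed

text \<open>For two solutions \<open>\<Phi>, \<Psi>\<close> of the same equation, \<open>\<Phi> \<Psi>\<^sup>-\<^sup>1\<close> has derivative \<open>\<Phi> (\<xi> - \<xi>) \<Psi>\<^sup>-\<^sup>1 = 0\<close>. The
  inverse is the adjugate, whose derivative involves \<open>- \<xi>\<close> because \<open>\<xi>\<close> is trace-free.\<close>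

lemma frame_unique:
  fixes F G :: "complex \<Rightarrow> cmat"
  assumes F: "\<And>w. (F has_derivative (\<lambda>v. F w ** \<xi> w v)) (at w)"
    and G: "\<And>w. (G has_derivative (\<lambda>v. G w ** \<xi> w v)) (at w)" "\<And>w. det (G w) = 1"
    and 0: "F 0 = G 0" and tr: "\<And>w v. adjugate2 (\<xi> w v) = - \<xi> w v"
  shows "F w = G w"
proof -
  have "((\<lambda>w. F w ** adjugate2 (G w)) has_derivative (\<lambda>v. 0)) (at w)" for w
  proof -
    have "((\<lambda>w. F w ** adjugate2 (G w)) has_derivative
       (\<lambda>v. F w ** adjugate2 (G w ** \<xi> w v) + (F w ** \<xi> w v) ** adjugate2 (G w))) (at w)"
      by (rule bounded_bilinear.FDERIV[OF bounded_bilinear_mult F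
            bounded_linear.has_derivative[OF bounded_linear_adjugate2 G(1)]])
    moreover have "F w ** (- X ** Y) + (F w ** X) ** Y = 0" for X Y :: cmat
      by (cases X; cases Y; cases "F w"; simp add: algebra_simps)
    ultimately show ?thesis by (simp add: tr)
  qed
  then obtain c where "\<And>w. F w ** adjugate2 (G w) = c"
    using has_derivative_zero_constant[of UNIV "\<lambda>w. F w ** adjugate2 (G w)"] by auto
  then have "F w ** adjugate2 (G w) = G 0 ** adjugate2 (G 0)" by (metis 0)
  then have "F w ** adjugate2 (G w) = mat 1" by (simp add: adjugate2_inverse G(2))
  then have "F w ** (adjugate2 (G w) ** G w) = G w" by (simp add: matrix_mul_assoc)
  then show ?thesis by (simp add: adjugate2_inverse G(2))
qed

text \<open>The exponential of \<open>w\<close> times the matrix with rows \<open>(0, 1)\<close> and \<open>(m\<^sup>2, 0)\<close>, whose square is \<open>m\<^sup>2\<close>. The value at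
\<open>m = 0\<close>, which occurs for one real \<open>\<lambda>\<close>, is the limit.\<close>

definition exp_mat :: "complex \<Rightarrow> complex \<Rightarrow> cmat" where
  "exp_mat m w = (if m = 0 then mat2 1 w 0 1
     else mat2 (cosh (m * w)) (sinh (m * w) / m) (m * sinh (m * w)) (cosh (m * w)))"

lemma det_exp_mat: "det (exp_mat m w) = 1"
  using hyperbolic_pythagoras[of "m * w"] by (simp add: exp_mat_def power2_eq_square)

lemma exp_mat_has_derivative:
  "(exp_mat m has_derivative (\<lambda>v. exp_mat m w ** cscale v (mat2 0 1 (m\<^sup>2) 0))) (at w)"
proof (cases "m = 0")
  case True
  have "((\<lambda>w. mat2 1 w 0 1) has_derivative (\<lambda>v. cscale v (mat2 0 1 0 0))) (at w)"
    by (rule mat2_has_derivative) (auto intro!: derivative_eq_intros)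
  then show ?thesis by (simp add: True exp_mat_def[abs_def])
next
  case False
  have "((\<lambda>w. mat2 (cosh (m * w)) (sinh (m * w) / m) (m * sinh (m * w)) (cosh (m * w))) has_derivative
     (\<lambda>v. cscale v (mat2 (m * sinh (m * w)) (cosh (m * w)) (m\<^sup>2 * cosh (m * w)) (m * sinh (m * w))))) (at w)"
    by (rule mat2_has_derivative) (use False in \<open>auto intro!: derivative_eq_intros simp: power2_eq_square\<close>)
  then show ?thesis using False by (simp add: exp_mat_def[abs_def] power2_eq_square mult.commute mult.left_commute)
qed

lemma exp_mat_0 [simp]: "exp_mat m 0 = mat 1"
  by (simp add: exp_mat_def mat2_const)

text \<open>In the coordinate \<open>w = log z\<close> the potential has constant coefficients, so the frame is a matrix exponential.
A description by \<open>THE\<close> needs uniqueness as well.\<close>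

lemma lwr_frame_cat:
  assumes "det \<Phi>0 = 1"
  shows "lwr_frame (cat_potential q p) \<Phi>0 = (\<lambda>l w. \<Phi>0 ** exp_mat (csqrt (of_real q * l + of_real p)) w)"
proof -
  have xi: "cscale (dz w v) (cat_potential q p l (exp w)) = cscale v (mat2 0 1 (of_real q * l + of_real p) 0)" for w v l
    by (simp add: dz_def cat_potential_def)
  let ?F = "\<lambda>l w. \<Phi>0 ** exp_mat (csqrt (of_real q * l + of_real p)) w"
  have d: "(?F l has_derivative (\<lambda>v. ?F l w ** cscale v (mat2 0 1 (of_real q * l + of_real p) 0))) (at w)" for l w
    using bounded_linear.has_derivative[OF bounded_bilinear.bounded_linear_right[OF bounded_bilinear_mult] exp_mat_has_derivative,
        of \<Phi>0 "csqrt (of_real q * l + of_real p)" w]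
    by (simp add: matrix_mul_assoc)
  show ?thesis
    unfolding lwr_frame_def xi
  proof (rule the_equality)
    show "\<forall>l. ?F l 0 = \<Phi>0 \<and> (\<forall>w. det (?F l w) = 1 \<and>
       (?F l has_derivative (\<lambda>v. ?F l w ** cscale v (mat2 0 1 (of_real q * l + of_real p) 0))) (at w))"
      using d by (simp add: det_mul det_exp_mat assms)
    fix \<Phi> :: "complex \<Rightarrow> complex \<Rightarrow> cmat"
    assume *: "\<forall>l. \<Phi> l 0 = \<Phi>0 \<and> (\<forall>w. det (\<Phi> l w) = 1 \<and>
       (\<Phi> l has_derivative (\<lambda>v. \<Phi> l w ** cscale v (mat2 0 1 (of_real q * l + of_real p) 0))) (at w))"
    have "\<Phi> l w = ?F l w" for l w
      by (rule frame_unique[where \<xi> = "\<lambda>w v. cscale v (mat2 0 1 (of_real q * l + of_real p) 0)"])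
         (use * d in \<open>auto simp: det_mul det_exp_mat assms\<close>)
    then show "\<Phi> = ?F" by blast
  qed
qed

definition diag_exp :: "real \<Rightarrow> complex \<Rightarrow> cmat" where
  "diag_exp m w = mat2 (exp (of_real m * w)) 0 0 (exp (- of_real m * w))"

lemma cat_init_eq:
  obtains r :: complex where "r * r = 1 / 2"
    "\<And>m. cat_init m = mat2 r (r / of_real m) (- (of_real m * r)) r"
proof (rule that[of "1 / of_real (sqrt 2)"])
  show "(1 / of_real (sqrt 2)) * (1 / of_real (sqrt 2)) = (1 / 2 :: complex)"
    by (simp flip: of_real_mult)
qed (simp add: cat_init_def)

lemma det_cat_init: "m \<noteq> 0 \<Longrightarrow> det (cat_init m) = 1"
proof -
  obtain r :: complex where r: "r * r = 1 / 2" "\<And>m. cat_init m = mat2 r (r / of_real m) (- (of_real m * r)) r"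
    by (rule cat_init_eq) blast
  then show "m \<noteq> 0 \<Longrightarrow> det (cat_init m) = 1" by (simp add: r)
qed

text \<open>The rows of \<open>cat_init m\<close> are left eigenvectors of the coefficient matrix, which explains the choice of
  the initial value: it diagonalizes the frame at the evaluation point where \<open>\<mu>\<^sup>2\<close> is the lower left entry.\<close>

lemma cat_init_exp_mat:
  assumes "m > 0" shows "cat_init m ** exp_mat (of_real m) w = diag_exp m w ** cat_init m"
proof -
  define E F where EF: "E = exp (of_real m * w)" "F = exp (- (of_real m * w))"
  have c: "cosh (of_real m * w) = (E + F) / 2" "sinh (of_real m * w) = (E - F) / 2"
    by (simp_all add: EF cosh_field_def sinh_field_def)
  obtain r :: complex where r: "\<And>m. cat_init m = mat2 r (r / of_real m) (- (of_real m * r)) r"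
    by (rule cat_init_eq) blast
  show ?thesis
    using assms by (simp add: r exp_mat_def diag_exp_def c flip: EF) (simp add: field_simps)
qed

lemma csqrt_real: "m > 0 \<Longrightarrow> csqrt ((of_real m)\<^sup>2) = of_real m"
  using of_real_sqrt[of "m\<^sup>2"] by (metis less_imp_le of_real_power real_sqrt_unique zero_le_power2)

lemma exp_cnj_products:
  "cnj (exp (of_real s * w)) * exp (of_real t * w) = of_real (exp ((s + t) * Re w)) * cis ((t - s) * Im w)"
  by (simp add: exp_eq_polar cis_cnj cis_mult norm_exp_eq_Re algebra_simps exp_add exp_diff)

text \<open>Let \<open>T\<close> be the quotient of the initial values with parameters \<open>\<mu>\<close> and \<open>\<nu>\<close>. Diagonalizing the frame at both
evaluation points gives \<open>\<Psi> = D\<^sub>\<mu> T D\<^sub>\<nu>\<^sup>-\<^sup>1 T\<^sup>-\<^sup>1\<close>. The last factor is constant and acts on \<open>\<Psi>\<^sup>* \<Psi>\<close> as a rigid motion;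
the remaining product yields the model.\<close>

lemma induced_H3:
  assumes mu: "mu > 0" "mu\<^sup>2 = p + q" and nu: "nu > 0" "nu\<^sup>2 = p" and q: "q \<noteq> 0"
  obtains V where "is_motion H3 V 0" "cat_immersion H3 q p = motion V 0 \<circ> model H3 q mu nu"
proof -
  define T where "T = cat_init mu ** adjugate2 (cat_init nu)"
  have det: "det (cat_init mu) = 1" "det (cat_init nu) = 1" using mu nu by (simp_all add: det_cat_init)
  have det_T: "det T = 1" using det by (simp add: T_def det_mul)
  define V where "V = cadj (adjugate2 T)"
  have cat_mu: "cat_mu H3 q p = mu" and sqrt_p: "sqrt p = nu"
    using mu nu by (auto simp: real_sqrt_unique)
  have csqrt: "csqrt (of_real q * 1 + of_real p) = of_real mu" "csqrt (of_real q * 0 + of_real p) = of_real nu"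
  proof -
    have e: "of_real q * 1 + of_real p = (of_real mu :: complex)\<^sup>2" "of_real q * 0 + of_real p = (of_real nu :: complex)\<^sup>2"
      using mu(2) nu(2) by (simp_all flip: of_real_power)
    show "csqrt (of_real q * 1 + of_real p) = of_real mu" "csqrt (of_real q * 0 + of_real p) = of_real nu"
      unfolding e by (rule csqrt_real mu nu)+
  qed
  let ?\<Phi> = "lwr_frame (cat_potential q p) (cat_init mu)"
  have \<Phi>1: "?\<Phi> 1 w = diag_exp mu w ** cat_init mu" for w
    unfolding lwr_frame_cat[OF det(1)] csqrt cat_init_exp_mat[OF mu(1)] ..
  have \<Phi>0: "?\<Phi> 0 w = T ** diag_exp nu w ** cat_init nu" for w
  proof -
    have "?\<Phi> 0 w = cat_init mu ** (adjugate2 (cat_init nu) ** cat_init nu) ** exp_mat (of_real nu) w"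
      unfolding lwr_frame_cat[OF det(1)] csqrt adjugate2_inverse[OF det(2)] by simp
    also have "\<dots> = T ** (cat_init nu ** exp_mat (of_real nu) w)"
      by (simp add: T_def matrix_mul_assoc)
    finally show ?thesis unfolding cat_init_exp_mat[OF nu(1)] by (simp add: matrix_mul_assoc)
  qed
  have det_D: "det (diag_exp m w) = 1" for m w by (simp add: diag_exp_def flip: exp_add)
  have "det (?\<Phi> 0 w) = 1" for w unfolding \<Phi>0 by (simp add: det_mul det_T det_D det)
  then have inv: "matrix_inv (?\<Phi> 0 w) = adjugate2 (cat_init nu) ** adjugate2 (diag_exp nu w) ** adjugate2 T" for w
    by (subst matrix_inv_adjugate2) (simp_all add: \<Phi>0 matrix_mul_assoc)
  define M where "M w = diag_exp mu w ** T ** adjugate2 (diag_exp nu w)" for w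
  have psi: "psi_H3 ?\<Phi> 0 1 w = M w ** adjugate2 T" for w
    unfolding psi_H3_def \<Phi>1 inv M_def by (simp add: T_def matrix_mul_assoc)
  have T: "T = mat2 (of_real ((mu + nu) / (2 * mu))) (of_real ((nu - mu) / (2 * mu * nu)))
     (of_real ((nu - mu) / 2)) (of_real ((mu + nu) / (2 * nu)))"
  proof -
    obtain r :: complex where r: "r * r = 1 / 2" "\<And>m. cat_init m = mat2 r (r / of_real m) (- (of_real m * r)) r"
      by (rule cat_init_eq) blast
    have r': "r * (r * z) = z / 2" for z using r(1) by (simp flip: mult.assoc)
    show ?thesis
      unfolding T_def r using mu nu by (simp add: r(1) r' field_simps)
  qed
  have "cadj (M w) ** M w = model H3 q mu nu w" for w
  proof -
    define t11 t12 t21 t22 where t: "t11 = (mu + nu) / (2 * mu)" "t12 = (nu - mu) / (2 * mu * nu)"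
      "t21 = (nu - mu) / 2" "t22 = (mu + nu) / (2 * nu)"
    define E F G K where EF: "E = exp (2 * mu * Re w)" "F = exp (- 2 * mu * Re w)"
       "G = exp (- 2 * nu * Re w)" "K = exp (2 * nu * Re w)"
    define c where "c = cis (2 * nu * Im w)"
    define P P' N N' where PN: "P = exp (of_real mu * w)" "P' = exp (of_real (- mu) * w)"
       "N = exp (of_real nu * w)" "N' = exp (of_real (- nu) * w)"
    have PN': "cnj P * P = of_real E" "cnj P' * P' = of_real F" "cnj N * N = of_real K" "cnj N' * N' = of_real G"
       "cnj N' * N = c" "cnj N * N' = cnj c"
      unfolding PN exp_cnj_products EF c_def by (simp_all add: cis_cnj)
    have M: "M w = mat2 (of_real t11 * P * N') (of_real t12 * P * N) (of_real t21 * P' * N') (of_real t22 * P' * N)"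
      unfolding M_def T diag_exp_def t PN by (simp add: mult.assoc)
    have q': "q = (mu + nu) * (mu - nu)" using mu(2) nu(2) by algebra
    have tt: "t11 * t12 = - (q / (4 * nu)) / mu\<^sup>2" "t21 * t22 = - (q / (4 * nu))"
      unfolding t q' using mu(1) nu(1) by (simp_all add: field_simps power2_eq_square)
    have b: "model_b q mu nu (Re w) = t11 * t12 * E + t21 * t22 * F"
      unfolding tt model_b_def EF by (simp add: algebra_simps)
    have a: "model_a H3 q mu nu (Re w) = G * (t11\<^sup>2 * E + t21\<^sup>2 * F)"
      "model_d H3 q mu nu (Re w) = K * (t12\<^sup>2 * E + t22\<^sup>2 * F)"
      by (simp_all add: EF t)
    have "model H3 q mu nu w = mat2 (of_real (G * (t11\<^sup>2 * E + t21\<^sup>2 * F))) (of_real (t11 * t12 * E + t21 * t22 * F) * c)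
       (of_real (t11 * t12 * E + t21 * t22 * F) * cnj c) (of_real (K * (t12\<^sup>2 * E + t22\<^sup>2 * F)))"
      unfolding model_def rot_def a b c_def hm_def by simp
    also have "\<dots> = cadj (M w) ** M w"
      unfolding M mat2_arith mat2_mult mat2_eq complex_cnj_mult complex_cnj_complex_of_real of_real_mult of_real_add of_real_power
        PN'[symmetric] complex_cnj_cnj
      by (intro conjI; algebra)
    finally show ?thesis ..
  qed
  moreover have "cadj (M w ** adjugate2 T) ** (M w ** adjugate2 T) = congr_by V (cadj (M w) ** M w)" for w
    by (simp add: V_def matrix_mul_assoc)
  ultimately have "cat_immersion H3 q p w = congr_by V (model H3 q mu nu w)" for w
    unfolding cat_immersion_def cat_mu induced_immersion.simps psi by simp
  then have "cat_immersion H3 q p = motion V 0 \<circ> model H3 q mu nu" by (simp add: fun_eq_iff)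
  moreover have "is_motion H3 V 0" using det_T by (simp add: is_motion_def V_def)
  ultimately show ?thesis using that by blast
qed

lemma cscale_one: "cscale 1 A = A"
  by (cases A) simp

text \<open>Differentiating the exponential with respect to \<open>\<lambda>\<close> at \<open>\<lambda> = 0\<close> and conjugating by the diagonalizing initial
value makes \<open>\<psi>\<close> explicit: linear on the diagonal, exponential off it. The immersion vanishes at the base point,
which accounts for the translation.\<close>

lemma induced_E3:
  assumes mu: "mu > 0" "mu\<^sup>2 = p" and q: "q \<noteq> 0"
  obtains c where "is_motion E3 (mat 1) c" "cat_immersion E3 q p = motion (mat 1) c \<circ> model E3 q mu mu"
proof -
  have cat_mu: "cat_mu E3 q p = mu" using mu by (auto simp: real_sqrt_unique)
  obtain r :: complex where r: "r * r = 1 / 2" "\<And>m. cat_init m = mat2 r (r / of_real m) (- (of_real m * r)) r"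
    by (rule cat_init_eq) blast
  have det: "det (cat_init mu) = 1" using mu by (simp add: det_cat_init)
  define m where "m l = csqrt (of_real q * l + of_real p)" for l
  define z where "z = complex_of_real mu"
  have z: "z \<noteq> 0" "z * z = of_real p" using mu by (auto simp: z_def power2_eq_square simp flip: of_real_mult)
  have m0: "m 0 = z" unfolding m_def z_def using csqrt_real[OF mu(1)] mu(2) by (simp flip: of_real_power)
  define m' where "m' = of_real q / (2 * z)"
  let ?\<Phi> = "lwr_frame (cat_potential q p) (cat_init mu)"
  have \<Phi>: "?\<Phi> l w = cat_init mu ** exp_mat (m l) w" for l w
    unfolding lwr_frame_cat[OF det] m_def ..
  have dm: "(m has_field_derivative m') (at 0)"
  proof -
    have "of_real p \<notin> (\<real>\<^sub>\<le>\<^sub>0 :: complex set)" using mu by (auto simp: complex_nonpos_Reals_iff)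
    then have "(m has_field_derivative inverse (2 * csqrt (of_real q * 0 + of_real p)) * of_real q) (at 0)"
      unfolding m_def[abs_def] by (intro DERIV_chain2[where f = csqrt] has_field_derivative_csqrt)
        (auto intro!: derivative_eq_intros)
    moreover have "csqrt (of_real q * 0 + of_real p) = z" using m0 by (simp only: m_def)
    ultimately show ?thesis by (simp only: m'_def divide_inverse mult.commute)
  qed
  let ?S = "(\<lambda>l. of_real q * l + of_real p) -` (- \<real>\<^sub>\<le>\<^sub>0 :: complex set)"
  have S: "open ?S"
    by (rule open_vimage) (auto intro!: continuous_intros)
  have S0: "0 \<in> ?S" using mu by (auto simp: complex_nonpos_Reals_iff)
  have mS: "m l \<noteq> 0" if "l \<in> ?S" for l using that by (auto simp: m_def)
  have psi: "psi_E3 ?\<Phi> 0 1 w = cscale (of_real q / 2) (mat2 (w / z) (- ((exp (2 * z * w) - 1) / (2 * z ^ 3)))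
      (- ((exp (- 2 * z * w) - 1) / (2 * z))) (- w / z))" for w
  proof -
    define C s where cs: "C = cosh (z * w)" "s = sinh (z * w)"
    let ?Y = "mat2 (s * w * m') ((C * w * m' * z - s * m') / (z * z)) (m' * s + z * C * w * m') (s * w * m')"
    have X: "((\<lambda>l. cosh (m l * w)) has_field_derivative s * w * m') (at 0)"
      "((\<lambda>l. sinh (m l * w) / m l) has_field_derivative (C * w * m' * z - s * m') / (z * z)) (at 0)"
      "((\<lambda>l. m l * sinh (m l * w)) has_field_derivative m' * s + z * C * w * m') (at 0)"
      by (auto intro!: derivative_eq_intros dm simp: m0 cs z algebra_simps)
    have entries: "((\<lambda>l. ?\<Phi> l w $ i $ j) has_field_derivative
      (cat_init mu ** ?Y) $ i $ j) (at 0)" for i j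
    proof -
      have eq: "cat_init mu ** mat2 (cosh (m l * w)) (sinh (m l * w) / m l) (m l * sinh (m l * w)) (cosh (m l * w)) = ?\<Phi> l w"
        if "l \<in> ?S" for l using mS[OF that] by (simp add: \<Phi> exp_mat_def)
      have "((\<lambda>l. (cat_init mu ** mat2 (cosh (m l * w)) (sinh (m l * w) / m l) (m l * sinh (m l * w)) (cosh (m l * w))) $ i $ j) has_field_derivative
        (cat_init mu ** ?Y) $ i $ j) (at 0)"
        using exhaust_2[of i] exhaust_2[of j] unfolding r mat2_mult
        by (elim disjE; simp only: mat2_nth; intro DERIV_add DERIV_cmult X)
      then show ?thesis by (rule has_field_derivative_transform_within_open[OF _ S S0]) (simp only: eq)
    qed
    have "(\<chi> i j. deriv (\<lambda>l. ?\<Phi> l w $ i $ j) 0) = cat_init mu **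
        ?Y"
      unfolding DERIV_imp_deriv[OF entries] by (simp add: vec_eq_iff)
    moreover have "matrix_inv (?\<Phi> 0 w) = adjugate2 (cat_init mu ** exp_mat z w)"
      by (subst matrix_inv_adjugate2) (simp_all add: \<Phi> m0 det_mul det det_exp_mat)
    moreover have "exp_mat z w = mat2 C (s / z) (z * s) C" using z by (simp add: exp_mat_def cs)
    ultimately have psi: "psi_E3 ?\<Phi> 0 1 w = cat_init mu **
        ?Y **
        mat2 C (- (s / z)) (- (z * s)) C ** adjugate2 (cat_init mu)"
      using cscale_one by (simp add: psi_E3_def matrix_mul_assoc)
    define M N where MN: "M = exp (z * w)" "N = exp (- (z * w))"
    have MN1: "M * N = 1" by (simp add: MN flip: exp_add)
    have cs2: "2 * C = M + N" "2 * s = M - N" by (simp_all add: cs MN cosh_field_def sinh_field_def)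
    have EF: "exp (2 * z * w) = M * M" "exp (- 2 * z * w) = N * N"
      by (simp_all add: MN mult.assoc flip: exp_add mult_2)
    define i where "i = 1 / z"
    have i: "z * i = 1" using z by (simp add: i_def)
    have div: "x / z = x * i" "x / (z * z) = x * (i * i)" for x by (simp_all add: i_def)
    have hm': "2 * m' = of_real q * i" by (simp add: m'_def i_def)
    have r2: "2 * (r * r) = 1" unfolding r(1) by simp
    have adj: "adjugate2 (cat_init mu) = mat2 r (- (r * i)) (z * r) r" and c: "cat_init mu = mat2 r (r * i) (- (z * r)) r"
      by (simp_all add: r z_def i_def)
    have C2: "C * C = 1 + s * s" using cs2 MN1 by algebra
    have Y: "?Y **
        mat2 C (- (s / z)) (- (z * s)) C = mat2 (m' * i * (s * s)) (m' * i * (w - s * C * i)) (m' * (s * C + z * w)) (- (m' * i * (s * s)))"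
      unfolding div mat2_mult mat2_eq using i C2 by (intro conjI; algebra)
    have s2: "4 * (s * s) = M * M + N * N - 2" "4 * (s * C) = M * M - N * N" using cs2 MN1 by algebra+
    obtain p11 p12 p21 p22 where p: "psi_E3 ?\<Phi> 0 1 w = mat2 p11 p12 p21 p22" by (cases "psi_E3 ?\<Phi> 0 1 w")
    have "mat2 p11 p12 p21 p22 = cat_init mu ** mat2 (m' * i * (s * s)) (m' * i * (w - s * C * i)) (m' * (s * C + z * w)) (- (m' * i * (s * s))) ** adjugate2 (cat_init mu)"
      using psi unfolding p Y[symmetric] by (simp only: matrix_mul_assoc)
    note P = this[unfolded c mat2_arith mat2_mult mat2_eq]
    have "2 * p11 = of_real q * (w * i)"
      using P[THEN conjunct1] i hm' r2 s2 by algebra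
    moreover have "4 * p12 = - (of_real q * (M * M - 1) * (i * i * i))"
      using P[THEN conjunct2, THEN conjunct1] i hm' r2 s2 by algebra
    moreover have "4 * p21 = - (of_real q * (N * N - 1) * i)"
      using P[THEN conjunct2, THEN conjunct2, THEN conjunct1] i hm' r2 s2 by algebra
    moreover have "2 * p22 = - (of_real q * (w * i))"
      using P[THEN conjunct2, THEN conjunct2, THEN conjunct2] i hm' r2 s2 by algebra
    ultimately have "p11 = of_real q / 2 * (w / z)" "p12 = of_real q / 2 * (- ((M * M - 1) / (2 * z ^ 3)))"
      "p21 = of_real q / 2 * (- ((N * N - 1) / (2 * z)))" "p22 = of_real q / 2 * (- w / z)"
      using z(1) by (simp_all add: i_def field_simps power3_eq_cube)
    then show ?thesis unfolding p EF mat2_arith by blast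
  qed
  let ?k = "q / 2 * (1 / (2 * mu ^ 3) + 1 / (2 * mu))"
  have "cat_immersion E3 q p w = motion (mat 1) (hm 0 (of_real ?k) 0) (model E3 q mu mu w)" for w
  proof -
    have c: "exp (2 * z * w) = of_real (exp (2 * mu * Re w)) * cis (2 * mu * Im w)"
      "cnj (exp (- 2 * z * w)) = of_real (exp (- 2 * mu * Re w)) * cis (2 * mu * Im w)"
      by (simp_all add: exp_eq_polar norm_exp_eq_Re z_def cis_cnj)
    define e1 e2 where e: "e1 = exp (2 * z * w)" "e2 = exp (- 2 * z * w)"
    define g where "g = - (of_real q / 2) * ((e1 - 1) / (2 * z ^ 3) + (cnj e2 - 1) / (2 * z))"
    have zc: "cnj z = z" by (simp add: z_def)
    have diag: "of_real q / 2 * (w / z) + cnj (of_real q / 2 * (w / z)) = of_real (q * Re w / mu)"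
      by (simp add: z_def complex_eq_iff)
    have "psi_E3 ?\<Phi> 0 1 w + cadj (psi_E3 ?\<Phi> 0 1 w) =
        mat2 (of_real (q * Re w / mu)) g (cnj g) (- of_real (q * Re w / mu))"
      unfolding psi mat2_arith mat2_eq e[symmetric] g_def diag[symmetric]
      by (simp add: zc add_divide_distrib distrib_left)
    moreover have "g = of_real (model_b q mu mu (Re w)) * cis (2 * mu * Im w) + of_real ?k"
    proof -
      define x y u where xyu: "x = exp (2 * mu * Re w)" "y = exp (- 2 * mu * Re w)" "u = cis (2 * mu * Im w)"
      have G: "g = - (of_real q / 2) * ((of_real x * u - 1) / (2 * z ^ 3) + (of_real y * u - 1) / (2 * z))"
        unfolding g_def e c xyu ..
      have B: "model_b q mu mu (Re w) = - (q / (4 * mu)) * (x / mu\<^sup>2 + y)"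
        by (simp add: model_b_def xyu)
      show ?thesis unfolding G B xyu(3)[symmetric] using mu(1)
        by (simp add: z_def field_simps power3_eq_cube power2_eq_square)
    qed
    ultimately show ?thesis
      unfolding cat_immersion_def cat_mu induced_immersion.simps
      by (simp add: motion_def model_def rot_def hm_def)
  qed
  then have "cat_immersion E3 q p = motion (mat 1) (hm 0 (of_real ?k) 0) \<circ> model E3 q mu mu" by (simp add: fun_eq_iff)
  moreover have "is_motion E3 (mat 1) (hm 0 (of_real ?k) 0)"
    by (simp add: is_motion_def del: space_of.simps)
  ultimately show ?thesis using that by blast
qed

section \<open>From rotational symmetry to normal form\<close>

text \<open>A trace-free Hermitian matrix of determinant \<open>-1\<close> is a point of the unit sphere, and the required unitary matrix
is the half-angle formula for the rotation that takes the north pole to it. The formula degenerates only at the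
south pole.\<close>

lemma diagonalize_unit_tangent:
  assumes "v \<in> space_of E3" "hip v v = 1"
  obtains U where "det U = 1" "U ** cadj U = mat 1" "v = congr_by U (hm 1 0 (-1))"
proof -
  obtain x b c where v: "v = hm x (Complex b c) (- x)" using assms(1) by (rule E3_cases)
  define z where "z = Complex b c"
  have n: "x * x + (cmod z)\<^sup>2 = 1" using assms(2) unfolding v hip_E3 z_def cmod_power2 by (simp add: power2_eq_square)
  show ?thesis
  proof (cases "x = -1")
    case True
    then have "z = 0" using n by simp
    then show ?thesis
      by (intro that[of "mat2 0 (-1) 1 0"]) (simp_all add: v True hm_def mat2_const flip: z_def)
  next
    case False
    have "x * x \<le> 1" using n zero_le_power2[of "cmod z"] by linarith
    then have "\<bar>x\<bar> \<le> 1" using abs_square_le_1[of x] by (simp add: power2_eq_square)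
    then have x: "1 + x > 0" using False by linarith
    define s where "s = sqrt ((1 + x) / 2)"
    have s: "s > 0" "s * s = (1 + x) / 2" using x by (auto simp: s_def)
    define S where "S = complex_of_real s"
    have "complex_of_real (2 * (s * s)) = of_real (1 + x)" unfolding s(2) by simp
    then have S: "S \<noteq> 0" "2 * (S * S) = 1 + of_real x" "cnj S = S"
      using s(1) by (auto simp: S_def)
    define y where "y = z / (2 * S)"
    have z: "z = 2 * S * y" using S by (simp add: y_def)
    have "z * cnj z = 1 - of_real x * of_real x"
    proof -
      have "of_real (x * x + (cmod z)\<^sup>2) = (1 :: complex)" using n by simp
      then show ?thesis unfolding of_real_add complex_norm_square by (simp add: algebra_simps)
    qed
    then have "2 * (2 * (S * S)) * (y * cnj y) = (1 + of_real x) * (1 - of_real x)"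
      unfolding z using S(3) by (simp add: algebra_simps)
    then have "(1 + of_real x) * (2 * (y * cnj y)) = (1 + of_real x) * (1 - of_real x)"
      unfolding S(2) by algebra
    moreover have "1 + complex_of_real x \<noteq> 0" using x
    proof -
      have "complex_of_real (1 + x) \<noteq> 0" using x by (metis of_real_eq_0_iff less_irrefl)
      then show ?thesis by simp
    qed
    ultimately have y: "2 * (y * cnj y) = 1 - of_real x"
      by (metis mult_left_cancel)
    have 2: "S * S + y * cnj y = 1" using S(2) y by algebra
    have 3: "S * S - y * cnj y = of_real x" using S(2) y by algebra
    show ?thesis
    proof (rule that[of "mat2 S (- y) (cnj y) S"])
      show "det (mat2 S (- y) (cnj y) S) = 1" using 2 by simp
      show "mat2 S (- y) (cnj y) S ** cadj (mat2 S (- y) (cnj y) S) = mat 1"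
        using 2 by (simp add: S mat2_const algebra_simps)
      show "v = congr_by (mat2 S (- y) (cnj y) S) (hm 1 0 (- 1))"
        using 3 unfolding v z_def[symmetric] z hm_def by (simp add: S algebra_simps)
    qed
  qed
qed

lemma geodesic_axis_motion:
  assumes "is_geodesic X l"
  obtains V c where "is_motion X V c" "\<And>s. motion V c (axis_geodesic X s) \<in> l"
proof -
  obtain p v where p: "p \<in> space_of X" and v: "v \<in> tangent_space X p" "hip v v = 1"
    and l: "l = range (geodesic X p v)" using assms unfolding is_geodesic_def by blast
  have "\<exists>V c. is_motion X V c \<and> p = motion V c (axis_point X) \<and> v = congr_by V (hm 1 0 (-1))"
  proof (cases X)
    case E3
    obtain U where U: "det U = 1" "U ** cadj U = mat 1" "v = congr_by U (hm 1 0 (-1))"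
      using diagonalize_unit_tangent[of v] v unfolding E3 tangent_space.simps by blast
    have "is_motion X U p" using U p by (simp add: is_motion_def E3 del: space_of.simps)
    moreover have "p = motion U p (axis_point X)" by (simp add: E3 axis_point_def motion_def congr_by_linear)
    ultimately show ?thesis using U by blast
  next
    case H3
    obtain W where W: "det W = 1" "p = W ** cadj W" using H3_factorization p H3 by metis
    define v' where "v' = congr_by (adjugate2 W) v"
    have v': "v = congr_by W v'" using congr_by_adjugate[OF W(1)] by (simp add: v'_def)
    have "v' \<in> space_of E3" using v(1) tangent_H3_transport[OF W(1)] unfolding H3 W(2) v' by blast
    moreover have "hip v' v' = 1" using v(2) W(1) unfolding v' by simp
    ultimately obtain U where U: "det U = 1" "U ** cadj U = mat 1" "v' = congr_by U (hm 1 0 (-1))"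
      using diagonalize_unit_tangent by blast
    have "is_motion X (W ** U) 0" using U W by (simp add: is_motion_def H3 det_mul)
    moreover have "v = congr_by (W ** U) (hm 1 0 (-1))" unfolding v' U congr_by_compose ..
    moreover have "p = motion (W ** U) 0 (axis_point X)"
    proof -
      have "congr_by (W ** U) (mat 1) = W ** (U ** cadj U) ** cadj W" by (simp add: matrix_mul_assoc)
      then show ?thesis using U W by (simp add: H3 axis_point_def)
    qed
    ultimately show ?thesis by blast
  qed
  then obtain V c where V: "is_motion X V c" and p: "p = motion V c (axis_point X)"
    and v: "v = congr_by V (hm 1 0 (-1))" by blast
  have "geodesic X p v s = motion V c (axis_geodesic X s)" for s
    unfolding p v geodesic_motion[OF V] geodesic_axis ..
  then show ?thesis using that[OF V] l by (metis rangeI)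
qed

lemma axis_geodesic_space: "axis_geodesic X s \<in> space_of X"
  by (cases X) (simp_all add: axis_geodesic_def add_pos_pos flip: exp_add del: space_of.simps)

text \<open>In \<open>H3\<close> the hyperbolic cosine of the distance to the point with diagonal \<open>e\<^sup>s, e\<^sup>-\<^sup>s\<close> is
  \<open>(e\<^sup>s d + e\<^sup>-\<^sup>s a) / 2\<close>, so two values of \<open>s\<close> determine \<open>a\<close> and \<open>d\<close>. In \<open>E3\<close> two values determine the height
  and the distance from the axis.\<close>

lemma axis_distances:
  assumes x: "hm a b d \<in> space_of X" and y: "hm a' b' d' \<in> space_of X"
    and dist: "\<And>s. distance X (axis_geodesic X s) (hm a b d) = distance X (axis_geodesic X s) (hm a' b' d')"
  shows "a = a' \<and> d = d' \<and> cmod b = cmod b'"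
proof (cases X)
  case E3
  have d: "d = - a" "d' = - a'" using x y unfolding E3 space_E3_hm by auto
  have hip: "hip (hm s 0 (- s) - hm a b (- a)) (hm s 0 (- s) - hm a b (- a)) = (cmod b)\<^sup>2 + (s - a)\<^sup>2" for s a b
    unfolding cmod_power2 by (simp add: power2_eq_square field_simps)
  have *: "(cmod b)\<^sup>2 + (s - a)\<^sup>2 = (cmod b')\<^sup>2 + (s - a')\<^sup>2" for s
    using dist[of s] unfolding E3 d axis_geodesic_def ambient.case distance.simps hip by simp
  have "a = a'" using *[of 0] *[of 1] by (simp add: power2_eq_square algebra_simps)
  moreover have "cmod b = cmod b'" using *[of 0] calculation by simp
  ultimately show ?thesis using d by simp
next
  case H3
  have xy: "a > 0" "d > 0" "a * d \<ge> 1" "a' > 0" "d' > 0" "a' * d' \<ge> 1"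
    using H3_diagonal_pos x y unfolding H3 by blast+
  have ge: "(exp s * d + exp (- s) * a) / 2 \<ge> 1" if "a > 0" "d > 0" "a * d \<ge> 1" for a d s :: real
  proof -
    have "1 \<le> (exp s * d) * (exp (- s) * a)" using that by (simp add: mult.commute mult.left_commute exp_minus)
    also have "\<dots> \<le> ((exp s * d + exp (- s) * a) / 2)\<^sup>2"
      using sum_squares_ge_zero[of "exp s * d - exp (- s) * a" 0] by (simp add: power2_eq_square field_simps)
    finally have "1\<^sup>2 \<le> ((exp s * d + exp (- s) * a) / 2)\<^sup>2" by simp
    then show ?thesis by (rule power2_le_imp_le) (use that in \<open>simp add: add_nonneg_nonneg\<close>)
  qed
  have "arcosh ((exp s * d + exp (- s) * a) / 2) = arcosh ((exp s * d' + exp (- s) * a') / 2)" for s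
    using dist[of s] unfolding H3 axis_geodesic_def by simp
  then have "cosh (arcosh ((exp s * d + exp (- s) * a) / 2)) = cosh (arcosh ((exp s * d' + exp (- s) * a') / 2))" for s
    by (rule arg_cong)
  then have half: "(exp s * d + exp (- s) * a) / 2 = (exp s * d' + exp (- s) * a') / 2" for s
    unfolding cosh_arcosh_real[OF ge[OF xy(1-3)]] cosh_arcosh_real[OF ge[OF xy(4-6)]] .
  have *: "exp s * d + exp (- s) * a = exp s * d' + exp (- s) * a'" for s
    using half[of s] unfolding divide_cancel_right by simp
  have "a' = a + d - d'" using *[of 0] by simp
  then have "(exp 1 - exp (- 1)) * (d - d') = 0" using *[of 1] by algebra
  moreover have "exp 1 - exp (- 1 :: real) \<noteq> 0" by simp
  ultimately have "d = d'" "a = a'" using *[of 0] by auto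
  moreover have "(cmod b)\<^sup>2 = (cmod b')\<^sup>2"
  proof -
    have "a' * d' - (cmod b)\<^sup>2 = 1" "a' * d' - (cmod b')\<^sup>2 = 1"
      using x y unfolding H3 space_H3_hm calculation by blast+
    then show ?thesis by linarith
  qed
  ultimately show ?thesis by simp
qed

lemma has_derivative_along:
  assumes "\<And>w. (f has_derivative f' w) (at w)"
  shows "((\<lambda>s. f (Complex s v)) has_vector_derivative f' (Complex u v) 1) (at u)"
    "((\<lambda>t. f (Complex u t)) has_vector_derivative f' (Complex u v) \<i>) (at v)"
proof -
  have lin: "linear (f' w)" for w by (rule has_derivative_linear[OF assms])
  have 1: "((\<lambda>s. Complex s v) has_derivative (\<lambda>h. h *\<^sub>R 1)) (at u)"
  proof -
    have "((\<lambda>s. of_real s + \<i> * of_real v) has_derivative (\<lambda>h. h *\<^sub>R 1)) (at u)"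
      by (auto intro!: derivative_eq_intros simp: scaleR_conv_of_real)
    then show ?thesis by (simp only: complex_eq[of "Complex _ _", simplified, symmetric])
  qed
  have 2: "((\<lambda>t. Complex u t) has_derivative (\<lambda>h. h *\<^sub>R \<i>)) (at v)"
  proof -
    have "((\<lambda>t. of_real u + \<i> * of_real t) has_derivative (\<lambda>h. h *\<^sub>R \<i>)) (at v)"
      by (auto intro!: derivative_eq_intros simp: scaleR_conv_of_real mult.commute)
    then show ?thesis by (simp only: complex_eq[of "Complex _ _", simplified, symmetric])
  qed
  show "((\<lambda>s. f (Complex s v)) has_vector_derivative f' (Complex u v) 1) (at u)"
    unfolding has_vector_derivative_def
    using has_derivative_compose[OF 1 assms] by (simp add: linear_scale[OF lin])
  show "((\<lambda>t. f (Complex u t)) has_vector_derivative f' (Complex u v) \<i>) (at v)"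
    unfolding has_vector_derivative_def
    using has_derivative_compose[OF 2 assms] by (simp add: linear_scale[OF lin])
qed

text \<open>Uniqueness for a scalar linear equation, in the form in which it separates the variables below.\<close>

lemma linear_ode_quotient:
  fixes f g :: "real \<Rightarrow> complex"
  assumes f: "\<And>u. (f has_vector_derivative k u * f u) (at u)"
    and g: "\<And>u. (g has_vector_derivative k u * g u) (at u)" and nz: "\<And>u. g u \<noteq> 0"
  shows "f u / g u = f 0 / g 0"
proof -
  have "((\<lambda>u. f u / g u) has_derivative (\<lambda>h. 0)) (at u)" for u
  proof -
    have "((\<lambda>u. f u / g u) has_derivative
       (\<lambda>h. - f u * (inverse (g u) * (h *\<^sub>R (k u * g u)) * inverse (g u)) + (h *\<^sub>R (k u * f u)) / g u)) (at u)"
      using f g nz unfolding has_vector_derivative_def by (intro has_derivative_divide) auto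
    moreover have "(\<lambda>h. - f u * (inverse (g u) * (h *\<^sub>R (k u * g u)) * inverse (g u)) + (h *\<^sub>R (k u * f u)) / g u) = (\<lambda>h. 0)"
      using nz[of u] by (auto simp: field_simps scaleR_conv_of_real)
    ultimately show ?thesis by simp
  qed
  then obtain c where "\<And>u. f u / g u = c"
    using has_derivative_zero_constant[of UNIV "\<lambda>u. f u / g u"] by auto
  then show ?thesis by metis
qed

lemma vector_derivative_cong_unique:
  assumes "(f has_vector_derivative x) (at u)" "(g has_vector_derivative y) (at u)" "\<And>s. f s = g s"
  shows "x = y"
  using assms vector_derivative_unique_at by (metis ext)

lemma real_derivative_of_const:
  assumes "(f has_real_derivative x) (at u)" "\<And>s. f s = c" shows "x = 0"
proof -
  have "f = (\<lambda>s. c)" using assms(2) by auto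
  then show ?thesis using assms(1) DERIV_unique[OF _ DERIV_const] by metis
qed

lemma bounded_linear_entry: "bounded_linear (\<lambda>A :: cmat. A $ i $ j)"
  by (rule bounded_linear_compose[OF bounded_linear_vec_nth bounded_linear_vec_nth])

lemma symmetric_product: "z * cnj z' + z' * cnj z = of_real (2 * Re (z' * cnj z))"
  by (simp add: complex_eq_iff algebra_simps)

text \<open>The trace that rotational symmetry leaves on the matrix entries when the axis is the diagonal geodesic. Together
with conformality it forces the surface to turn at constant speed about the axis.\<close>

locale symmetric_surface =
  fixes X :: ambient and r :: "complex \<Rightarrow> cmat"
  assumes immersion: "conformal_immersion X r"
    and sym_entries: "\<And>w t. Re (r (lift_rot t w) $ 1 $ 1) = Re (r w $ 1 $ 1)"
      "\<And>w t. Re (r (lift_rot t w) $ 2 $ 2) = Re (r w $ 2 $ 2)"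
      "\<And>w t. cmod (r (lift_rot t w) $ 1 $ 2) = cmod (r w $ 1 $ 2)"
begin

definition "ru w = diff r w 1"
definition "rv w = diff r w \<i>"
definition "a w = Re (r w $ 1 $ 1)"
definition "b w = r w $ 1 $ 2"
definition "d w = Re (r w $ 2 $ 2)"
definition "au w = Re (ru w $ 1 $ 1)"
definition "bu w = ru w $ 1 $ 2"
definition "du w = Re (ru w $ 2 $ 2)"
definition "bv w = rv w $ 1 $ 2"

lemma C_2: "C_k 2 r"
  using immersion by (simp add: conformal_immersion_def smooth_def del: C_k.simps)

lemma r_deriv: "(r has_derivative diff r w) (at w)" "(ru has_derivative diff ru w) (at w)"
    "(rv has_derivative diff rv w) (at w)"
proof -
  have "r differentiable_on UNIV" "ru differentiable_on UNIV" "rv differentiable_on UNIV"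
    using C_2 unfolding numeral_2_eq_2 ru_def[abs_def] rv_def[abs_def] C_k.simps by blast+
  then show "(r has_derivative diff r w) (at w)" "(ru has_derivative diff ru w) (at w)"
    "(rv has_derivative diff rv w) (at w)"
    by (auto intro!: diff_works simp: differentiable_on_eq_differentiable_at)
qed

lemma in_space: "r w \<in> space_of X" using immersion by (auto simp: conformal_immersion_def)

lemma r_hm: "r w = hm (a w) (b w) (d w)"
  using in_space[of w] by (elim space_of_cases) (simp add: a_def b_def d_def hm_def)

lemma hermitian_diff: "hermitian (diff r w v)"
proof -
  have "bounded_linear cadj"
    by (rule linear_conv_bounded_linear[THEN iffD1], rule linearI) (simp_all add: cadj_def vec_eq_iff)
  from bounded_linear.has_derivative[OF this r_deriv(1)]
  have "((\<lambda>w. cadj (r w)) has_derivative (\<lambda>v. cadj (diff r w v))) (at w)" .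
  moreover have "cadj (r w) = r w" for w using hermitian_hm[of "a w" "b w" "d w"] unfolding hermitian_def r_hm[symmetric] .
  ultimately have "(r has_derivative (\<lambda>v. cadj (diff r w v))) (at w)" by simp
  from fun_cong[OF diff_eqI[OF this], of v] show ?thesis unfolding hermitian_def by (rule sym)
qed

lemma sym_Complex: "a (Complex u v) = a (Complex u 0)" "d (Complex u v) = d (Complex u 0)"
    "cmod (b (Complex u v)) = cmod (b (Complex u 0))"
proof -
  have "Complex u v = lift_rot v (Complex u 0)" by (simp add: lift_rot_def complex_eq_iff)
  then show "a (Complex u v) = a (Complex u 0)" "d (Complex u v) = d (Complex u 0)"
    "cmod (b (Complex u v)) = cmod (b (Complex u 0))"
    unfolding a_def b_def d_def using sym_entries by metis+
qed

lemmas along = has_derivative_along[OF r_deriv(1), folded ru_def rv_def]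

lemma entries_u:
  "((\<lambda>s. a (Complex s v)) has_real_derivative au (Complex u v)) (at u)"
  "((\<lambda>s. b (Complex s v)) has_vector_derivative bu (Complex u v)) (at u)"
  "((\<lambda>s. d (Complex s v)) has_real_derivative du (Complex u v)) (at u)"
  unfolding a_def b_def d_def au_def bu_def du_def has_real_derivative_iff_has_vector_derivative
  by (intro bounded_linear.has_vector_derivative[OF bounded_linear_Re]
      bounded_linear.has_vector_derivative[OF bounded_linear_entry] along)+

lemma entries_v:
  "((\<lambda>t. a (Complex u t)) has_real_derivative Re (rv (Complex u v) $ 1 $ 1)) (at v)"
  "((\<lambda>t. b (Complex u t)) has_vector_derivative bv (Complex u v)) (at v)"
  "((\<lambda>t. d (Complex u t)) has_real_derivative Re (rv (Complex u v) $ 2 $ 2)) (at v)"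
  unfolding a_def b_def d_def bv_def has_real_derivative_iff_has_vector_derivative
  by (intro bounded_linear.has_vector_derivative[OF bounded_linear_Re]
      bounded_linear.has_vector_derivative[OF bounded_linear_entry] along)+

lemma diff_forms: "ru w = hm (au w) (bu w) (du w)" "rv w = hm 0 (bv w) 0"
proof -
  show "ru w = hm (au w) (bu w) (du w)"
    using hermitian_diff[of w 1] unfolding ru_def[symmetric]
    by (elim hermitian_cases) (simp add: au_def bu_def du_def hm_def)
  obtain u v where w: "w = Complex u v" by (cases w)
  have "Re (rv w $ 1 $ 1) = 0" "Re (rv w $ 2 $ 2) = 0"
    unfolding w
    by (rule real_derivative_of_const[OF entries_v(1) sym_Complex(1)]
        real_derivative_of_const[OF entries_v(3) sym_Complex(2)])+
  then show "rv w = hm 0 (bv w) 0"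
    using hermitian_diff[of w \<i>] unfolding rv_def[symmetric]
    by (elim hermitian_cases) (simp add: bv_def hm_def)
qed

lemma conformality:
  "(cmod (bv w))\<^sup>2 = (cmod (bu w))\<^sup>2 - au w * du w" "Re (bu w * cnj (bv w)) = 0" "bv w \<noteq> 0"
proof -
  define E where "E = metric_coeff r w * (cmod (exp w))\<^sup>2"
  have E: "hip (diff r w v) (diff r w v) = E * (cmod v)\<^sup>2" for v
    using immersion unfolding conformal_immersion_def E_def dz_def norm_mult power_mult_distrib
    by (simp add: mult.assoc)
  have "hip (ru w) (ru w) = E" "hip (rv w) (rv w) = E" using E[of 1] E[of \<i>] by (simp_all add: ru_def rv_def)
  then have 1: "(cmod (bu w))\<^sup>2 - au w * du w = E" "(cmod (bv w))\<^sup>2 = E"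
    unfolding diff_forms hip_hm cmod_power2 by (simp_all add: power2_eq_square)
  then show "(cmod (bv w))\<^sup>2 = (cmod (bu w))\<^sup>2 - au w * du w" by simp
  have lin: "linear (diff r w)" by (rule has_derivative_linear[OF r_deriv(1)])
  have "diff r w (1 + \<i>) = ru w + rv w" unfolding ru_def rv_def by (rule linear_add[OF lin])
  then have "hip (ru w + rv w) (ru w + rv w) = E * 2" using E[of "1 + \<i>"] by (simp add: cmod_power2)
  then show "Re (bu w * cnj (bv w)) = 0"
    using 1 unfolding diff_forms hm_arith hip_hm cmod_power2 by (simp add: power2_eq_square algebra_simps)
  show "bv w \<noteq> 0"
  proof
    assume "bv w = 0"
    then have "diff r w \<i> = diff r w 0" using diff_forms(2)[of w] linear_0[OF lin]
      by (simp add: rv_def)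
    then have "\<i> = 0" using immersion unfolding conformal_immersion_def inj_def by blast
    then show False by simp
  qed
qed

lemma b_nonzero: "b w \<noteq> 0"
proof
  obtain u v where w: "w = Complex u v" by (cases w)
  assume "b w = 0"
  then have "cmod (b (Complex u t)) = 0" for t
    unfolding sym_Complex(3)[of u t] using sym_Complex(3)[of u v] w by simp
  then have "b (Complex u t) = 0" for t by simp
  then have "bv (Complex u v) = 0"
    using vector_derivative_cong_unique[OF entries_v(2) has_vector_derivative_const] by blast
  then show False using conformality(3) by blast
qed

lemma bv_orthogonal: "Re (bv w * cnj (b w)) = 0"
proof -
  obtain u v where w: "w = Complex u v" by (cases w)
  have "((\<lambda>t. b (Complex u t) * cnj (b (Complex u t))) has_vector_derivative
     b w * cnj (bv w) + bv w * cnj (b w)) (at v)"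
    unfolding w by (intro has_vector_derivative_mult has_vector_derivative_cnj entries_v)
  moreover have "b (Complex u t) * cnj (b (Complex u t)) = of_real ((cmod (b (Complex u 0)))\<^sup>2)" for t
    unfolding sym_Complex(3)[of u t, symmetric] complex_norm_square ..
  ultimately have "b w * cnj (bv w) + bv w * cnj (b w) = 0"
    using vector_derivative_cong_unique[OF _ has_vector_derivative_const] by blast
  then show ?thesis unfolding symmetric_product of_real_eq_0_iff mult_eq_0_iff by (elim disjE) simp_all
qed

definition "p u = Re (bu (Complex u 0) * cnj (b (Complex u 0))) / (cmod (b (Complex u 0)))\<^sup>2"

text \<open>The \<open>v\<close>-derivative of \<open>b\<close> is orthogonal to \<open>b\<close>, since \<open>\<bar>b\<bar>\<close> does not depend on \<open>v\<close>, and to the \<open>u\<close>-derivative,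
by conformality. In the plane the \<open>u\<close>-derivative is therefore a real multiple of \<open>b\<close>, and the factor is the
logarithmic derivative of \<open>\<bar>b\<bar>\<close>, a function of \<open>u\<close> alone.\<close>

lemma bu_eq: "bu (Complex u v) = of_real (p u) * b (Complex u v)"
proof -
  let ?w = "Complex u v"
  have der: "((\<lambda>s. b (Complex s v) * cnj (b (Complex s v))) has_vector_derivative
     b (Complex u v) * cnj (bu (Complex u v)) + bu (Complex u v) * cnj (b (Complex u v))) (at u)" for v
    by (intro has_vector_derivative_mult has_vector_derivative_cnj entries_u)
  have "b (Complex s v) * cnj (b (Complex s v)) = b (Complex s 0) * cnj (b (Complex s 0))" for s
    using sym_Complex(3)[of s v] by (metis complex_norm_square)
  from vector_derivative_cong_unique[OF der der this]
  have "Re (bu ?w * cnj (b ?w)) = Re (bu (Complex u 0) * cnj (b (Complex u 0)))"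
    unfolding symmetric_product of_real_eq_iff mult_cancel_left by (elim disjE) simp_all
  then have p: "Re (bu ?w * cnj (b ?w)) = p u * (cmod (b ?w))\<^sup>2"
    unfolding p_def sym_Complex(3)[of u v] using b_nonzero by simp
  \<comment> \<open>both factors on the right are imaginary, so the product is real\<close>
  have "bu ?w * cnj (b ?w) * of_real ((cmod (bv ?w))\<^sup>2) = (bu ?w * cnj (bv ?w)) * (bv ?w * cnj (b ?w))"
    unfolding complex_norm_square by simp
  moreover have "Im ((bu ?w * cnj (bv ?w)) * (bv ?w * cnj (b ?w))) = 0"
    unfolding times_complex.sel(2) using conformality(2) bv_orthogonal by simp
  ultimately have "Im (bu ?w * cnj (b ?w)) * (cmod (bv ?w))\<^sup>2 = 0" by (metis Im_complex_of_real mult_zero_right add_0 Re_complex_of_real times_complex.sel(2))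
  then have "Im (bu ?w * cnj (b ?w)) = 0" using conformality(3) by simp
  then have "bu ?w * cnj (b ?w) = of_real (p u * (cmod (b ?w))\<^sup>2)"
    using p by (simp only: complex_eq_iff Re_complex_of_real Im_complex_of_real)
  then have "bu ?w * cnj (b ?w) = of_real (p u) * b ?w * cnj (b ?w)"
    unfolding of_real_mult complex_norm_square by (simp only: mult.assoc)
  then show ?thesis using b_nonzero[of ?w] by simp
qed

lemma b_product: "b (Complex u v) / b (Complex u 0) = b (Complex 0 v) / b (Complex 0 0)"
  by (rule linear_ode_quotient[where k = "\<lambda>u. of_real (p u)"]; (rule b_nonzero)?)
     (use entries_u(2) in \<open>simp_all only: bu_eq\<close>)

lemma b_real: "b (Complex u 0) / cnj (b (Complex u 0)) = b (Complex 0 0) / cnj (b (Complex 0 0))"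
proof (rule linear_ode_quotient[where k = "\<lambda>u. of_real (p u)"])
  show b: "((\<lambda>u. b (Complex u 0)) has_vector_derivative of_real (p u) * b (Complex u 0)) (at u)" for u
    using entries_u(2)[of 0 u] by (simp only: bu_eq)
  show "((\<lambda>u. cnj (b (Complex u 0))) has_vector_derivative of_real (p u) * cnj (b (Complex u 0))) (at u)" for u
    using has_vector_derivative_cnj[OF b] by simp
qed (simp add: b_nonzero)

text \<open>The angular velocity along the line \<open>u = 0\<close>. Its square is determined by conformality and by quantities
that depend on \<open>u\<close> only, so it is constant, and by continuity it has constant sign.\<close>

definition "theta t = Im (bv (Complex 0 t) * cnj (b (Complex 0 t))) / (cmod (b (Complex 0 t)))\<^sup>2"

lemma bv_theta: "bv (Complex 0 t) = \<i> * of_real (theta t) * b (Complex 0 t)"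
proof -
  let ?w = "Complex 0 t"
  have "bv ?w * cnj (b ?w) = \<i> * of_real (theta t * (cmod (b ?w))\<^sup>2)"
    using bv_orthogonal[of ?w] b_nonzero[of ?w] by (simp add: complex_eq_iff theta_def)
  then have "bv ?w * cnj (b ?w) = \<i> * of_real (theta t) * b ?w * cnj (b ?w)"
    unfolding of_real_mult complex_norm_square by (simp only: mult.assoc)
  then show ?thesis using b_nonzero[of ?w] by simp
qed

lemma theta_square: "(theta t)\<^sup>2 = (theta 0)\<^sup>2"
proof -
  have au: "au (Complex u v) = au (Complex u 0)" for u v
    using entries_u(1)[of v u] entries_u(1)[of 0 u] unfolding sym_Complex(1)[of _ v] by (rule DERIV_unique)
  have du: "du (Complex u v) = du (Complex u 0)" for u v
    using entries_u(3)[of v u] entries_u(3)[of 0 u] unfolding sym_Complex(2)[of _ v] by (rule DERIV_unique)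
  have "(theta t)\<^sup>2 * (cmod (b (Complex 0 0)))\<^sup>2 =
      (p 0)\<^sup>2 * (cmod (b (Complex 0 0)))\<^sup>2 - au (Complex 0 0) * du (Complex 0 0)" for t
    using conformality(1)[of "Complex 0 t"] unfolding bu_eq bv_theta au[of 0 t] du[of 0 t]
    by (simp add: norm_mult power_mult_distrib sym_Complex(3)[of 0 t])
  from this[of t] this[of 0] have "(theta t)\<^sup>2 * (cmod (b (Complex 0 0)))\<^sup>2 = (theta 0)\<^sup>2 * (cmod (b (Complex 0 0)))\<^sup>2"
    by simp
  then show ?thesis using b_nonzero by simp
qed

lemma theta_const: "theta t = theta 0"
proof -
  have "continuous_on UNIV (\<lambda>t. bv (Complex 0 t))"
    unfolding bv_def using has_derivative_along(2)[OF r_deriv(3)]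
    by (intro continuous_at_imp_continuous_on ballI has_vector_derivative_continuous)
       (rule bounded_linear.has_vector_derivative[OF bounded_linear_entry])
  moreover have "continuous_on UNIV (\<lambda>t. b (Complex 0 t))"
    using entries_v(2) by (intro continuous_at_imp_continuous_on ballI has_vector_derivative_continuous)
  ultimately have "continuous_on UNIV theta"
    unfolding theta_def[abs_def] by (intro continuous_intros) (auto simp: b_nonzero)
  moreover have "theta ` UNIV \<subseteq> {theta 0, - theta 0}"
    using theta_square by (auto simp: power2_eq_iff)
  then have "finite (theta ` UNIV)" by (rule finite_subset) simp
  ultimately have "theta constant_on UNIV"
    using continuous_finite_range_constant[of "UNIV :: real set" theta] by simp
  then show ?thesis unfolding constant_on_def by auto
qed

lemma b_eq: "b (Complex u v) = b (Complex u 0) * cis (theta 0 * v)"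
proof -
  have "b (Complex 0 v) / cis (theta 0 * v) = b (Complex 0 0) / cis (theta 0 * 0)"
  proof (rule linear_ode_quotient[where k = "\<lambda>t. \<i> * of_real (theta 0)"])
    show "((\<lambda>t. b (Complex 0 t)) has_vector_derivative \<i> * of_real (theta 0) * b (Complex 0 t)) (at t)" for t
      using entries_v(2)[of 0 t] unfolding bv_theta theta_const[of t] .
    show "((\<lambda>t. cis (theta 0 * t)) has_vector_derivative \<i> * of_real (theta 0) * cis (theta 0 * t)) (at t)" for t
      unfolding has_vector_derivative_def
      by (auto intro!: derivative_eq_intros simp: scaleR_conv_of_real)
  qed simp
  then have "b (Complex 0 v) / b (Complex 0 0) = cis (theta 0 * v)"
    using b_nonzero[of "Complex 0 0"] by (simp add: field_simps)
  then show ?thesis using b_product[of u v] b_nonzero[of "Complex u 0"] by (simp add: field_simps)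
qed

lemma normal_form:
  obtains a0 b0 d0 a1 b1 d1 a2 b2 d2 om \<tau> where "revolution X a0 b0 d0 a1 b1 d1 a2 b2 d2 om"
    "r = congr_by (turn \<tau>) \<circ> rot a0 b0 d0 om"
proof -
  \<comment> \<open>the phase at the origin is the phase of \<open>b\<close> along the whole line \<open>v = 0\<close>\<close>
  define \<tau> where "\<tau> = Arg (b (Complex 0 0))"
  have \<tau>: "b (Complex 0 0) = of_real (cmod (b (Complex 0 0))) * cis \<tau>"
    using rcis_cmod_Arg[of "b (Complex 0 0)"] by (simp add: \<tau>_def rcis_def)
  define b0 where "b0 u = Re (b (Complex u 0) * cis (- \<tau>))" for u
  have y: "b (Complex u 0) * cis (- \<tau>) = of_real (b0 u)" for u
  proof -
    have "b (Complex u 0) * cnj (b (Complex 0 0)) = cnj (b (Complex u 0)) * b (Complex 0 0)"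
      using b_real[of u] b_nonzero by (simp add: field_simps)
    then have "b (Complex u 0) * cnj (of_real (cmod (b (Complex 0 0))) * cis \<tau>) =
        cnj (b (Complex u 0)) * (of_real (cmod (b (Complex 0 0))) * cis \<tau>)"
      unfolding \<tau>[symmetric] .
    then have "b (Complex u 0) * cis (- \<tau>) = cnj (b (Complex u 0)) * cis \<tau>"
      using b_nonzero[of "Complex 0 0"] by (simp add: cis_cnj)
    also have "\<dots> = cnj (b (Complex u 0) * cis (- \<tau>))" by (simp add: cis_cnj)
    finally show ?thesis unfolding b0_def by (metis complex_cnj_cancel_iff complex_is_Real_iff Reals_cnj_iff of_real_Re)
  qed
  have b0: "b (Complex u 0) = of_real (b0 u) * cis \<tau>" for u
    unfolding y[symmetric] by (simp add: mult.assoc cis_mult)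
  define b1 b2 where "b1 u = Re (bu (Complex u 0) * cis (- \<tau>))"
    and "b2 u = Re (diff ru (Complex u 0) 1 $ 1 $ 2 * cis (- \<tau>))" for u
  have b1_p: "b1 u = p u * b0 u" for u
    unfolding b1_def bu_eq mult.assoc y by simp
  have bv: "bv (Complex u 0) = \<i> * of_real (theta 0) * b (Complex u 0)" for u
  proof (rule vector_derivative_cong_unique[OF entries_v(2)])
    show "((\<lambda>t. b (Complex u 0) * cis (theta 0 * t)) has_vector_derivative \<i> * of_real (theta 0) * b (Complex u 0)) (at 0)"
      unfolding has_vector_derivative_def
      by (auto intro!: derivative_eq_intros simp: scaleR_conv_of_real)
  qed (rule b_eq)
  have lin: "bounded_linear (\<lambda>z. Re (z * cis (- \<tau>)))"
    by (rule bounded_linear_compose[OF bounded_linear_Re bounded_linear_mult_left])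
  note second = has_derivative_along(1)[OF r_deriv(2)]
  have rev: "revolution X (\<lambda>u. a (Complex u 0)) b0 (\<lambda>u. d (Complex u 0)) (\<lambda>u. au (Complex u 0)) b1 (\<lambda>u. du (Complex u 0))
     (\<lambda>u. Re (diff ru (Complex u 0) 1 $ 1 $ 1)) b2 (\<lambda>u. Re (diff ru (Complex u 0) 1 $ 2 $ 2)) (theta 0)"
  proof
    fix u
    show "((\<lambda>u. a (Complex u 0)) has_real_derivative au (Complex u 0)) (at u)"
      "((\<lambda>u. d (Complex u 0)) has_real_derivative du (Complex u 0)) (at u)"
      by (rule entries_u)+
    show "(b0 has_real_derivative b1 u) (at u)"
      unfolding b0_def[abs_def] b1_def has_real_derivative_iff_has_vector_derivative
      by (rule bounded_linear.has_vector_derivative[OF lin entries_u(2)])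
    show "((\<lambda>u. au (Complex u 0)) has_real_derivative Re (diff ru (Complex u 0) 1 $ 1 $ 1)) (at u)"
      "((\<lambda>u. du (Complex u 0)) has_real_derivative Re (diff ru (Complex u 0) 1 $ 2 $ 2)) (at u)"
      unfolding au_def du_def has_real_derivative_iff_has_vector_derivative
      by (intro bounded_linear.has_vector_derivative[OF bounded_linear_Re]
          bounded_linear.has_vector_derivative[OF bounded_linear_entry] second)+
    show "(b1 has_real_derivative b2 u) (at u)"
      unfolding b1_def[abs_def] b2_def bu_def has_real_derivative_iff_has_vector_derivative
      by (rule bounded_linear.has_vector_derivative[OF lin
            bounded_linear.has_vector_derivative[OF bounded_linear_entry second]])
    have space: "hm (a (Complex u 0)) (b (Complex u 0)) (d (Complex u 0)) \<in> space_of X"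
      using in_space[of "Complex u 0"] unfolding r_hm[of "Complex u 0", symmetric] .
    show "X = E3 \<Longrightarrow> d (Complex u 0) = - a (Complex u 0)"
      using space space_E3_hm by blast
    have cb: "cmod (b (Complex u 0)) = \<bar>b0 u\<bar>" unfolding b0 by (simp add: norm_mult)
    show "X = H3 \<Longrightarrow> a (Complex u 0) * d (Complex u 0) - (b0 u)\<^sup>2 = 1"
      "X = H3 \<Longrightarrow> a (Complex u 0) + d (Complex u 0) > 0"
      using space space_H3_hm cb by (metis power2_abs)+
    show "(b1 u)\<^sup>2 - au (Complex u 0) * du (Complex u 0) = (theta 0 * b0 u)\<^sup>2"
      using conformality(1)[of "Complex u 0"] unfolding bv bu_eq b1_p
      by (simp add: norm_mult power_mult_distrib cb)
    show "theta 0 \<noteq> 0" using conformality(3)[of "Complex 0 0"] bv[of 0] by auto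
    show "b0 u \<noteq> 0" using b_nonzero[of "Complex u 0"] b0[of u] by auto
  qed
  moreover have "r = congr_by (turn \<tau>) \<circ> rot (\<lambda>u. a (Complex u 0)) b0 (\<lambda>u. d (Complex u 0)) (theta 0)"
  proof
    fix w
    obtain u v where w: "w = Complex u v" by (cases w)
    have "r w = hm (a (Complex u 0)) (b (Complex u v)) (d (Complex u 0))"
      using r_hm[of w] sym_Complex(1,2)[of u v] by (simp add: w)
    then show "r w = (congr_by (turn \<tau>) \<circ> rot (\<lambda>u. a (Complex u 0)) b0 (\<lambda>u. d (Complex u 0)) (theta 0)) w"
      unfolding b_eq[of u v] b0 by (simp add: w rot_def congr_by_turn mult.commute mult.left_commute)
  qed
  ultimately show ?thesis using that by blast
qed

end

lemma conformal_immersion_motion: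
  assumes V: "is_motion X V c" and f: "conformal_immersion X f"
  shows "conformal_immersion X (motion V c \<circ> f)"
proof -
  have det: "det V = 1" using V by simp
  have "C_k (Suc 0) f" using f by (simp add: conformal_immersion_def smooth_def del: C_k.simps)
  then have "(f has_derivative diff f w) (at w)" for w
    by (auto intro!: diff_works simp: differentiable_on_eq_differentiable_at)
  then have diff: "diff (motion V c \<circ> f) w v = congr_by V (diff f w v)" for w v
    unfolding comp_def by (subst diff_eqI[OF motion_has_derivative]) auto
  have "metric_coeff (motion V c \<circ> f) w = metric_coeff f w" for w
  proof -
    have "d_z (motion V c \<circ> f) w = congr_by V (d_z f w)" "d_zbar (motion V c \<circ> f) w = congr_by V (d_zbar f w)"
      unfolding d_z_def d_zbar_def diff by (simp_all add: matrix_mult_bilinear)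
    then show ?thesis by (simp add: metric_coeff_def cip_congr_by[OF det])
  qed
  moreover have "inj (diff (motion V c \<circ> f) w)" for w
  proof -
    have "inj (congr_by V)" by (rule inj_on_inverseI[of _ "congr_by (adjugate2 V)"]) (rule congr_by_adjugate[OF det])
    then have "inj (congr_by V \<circ> diff f w)" using f by (intro inj_compose) (auto simp: conformal_immersion_def)
    moreover have "congr_by V \<circ> diff f w = diff (motion V c \<circ> f) w" by (simp add: fun_eq_iff diff)
    ultimately show ?thesis by simp
  qed
  moreover have "smooth (motion V c \<circ> f)" using f C_k_motion by (auto simp: conformal_immersion_def smooth_def)
  moreover have "range (motion V c \<circ> f) \<subseteq> space_of X"
    using f motion_space[OF V] by (auto simp: conformal_immersion_def)
  ultimately show ?thesis using f by (simp add: conformal_immersion_def diff hip_congr_by[OF det])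
qed

definition swap :: cmat where "swap = mat2 0 1 (-1) 0"

lemma congr_by_swap: "congr_by swap (hm a b d) = hm d (- cnj b) a"
  by (simp add: swap_def hm_def)

lemma admissible_swap: "is_motion X swap 0"
proof -
  have "(0::cmat) \<in> space_of E3" by (simp add: hm_const del: space_of.simps)
  then show ?thesis
    by (cases X) (simp_all add: is_motion_def swap_def mat2_const del: space_of.simps)
qed

text \<open>Half a turn about a geodesic orthogonal to the axis reverses the sense of rotation.\<close>

lemma rot_swap: "rot a b d om = congr_by swap \<circ> rot d (\<lambda>u. - b u) a (- om)"
  by (simp add: fun_eq_iff rot_def congr_by_swap cis_cnj)

lemma revolution_swap:
  assumes "revolution X a b d a1 b1 d1 a2 b2 d2 om"
  shows "revolution X d (\<lambda>u. - b u) a d1 (\<lambda>u. - b1 u) a1 d2 (\<lambda>u. - b2 u) a2 (- om)"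
proof -
  interpret revolution X a b d a1 b1 d1 a2 b2 d2 om by (rule assms)
  show ?thesis
    by unfold_locales
      (use deriv1 deriv2 in_E3 in_H3 conformal nonzero in \<open>auto simp: mult.commute add.commute intro: DERIV_minus\<close>)
qed

text \<open>An isometry that fixes the axis pointwise preserves the distances to its points. After moving the axis to the
diagonal, the diagonal entries and the modulus of the off-diagonal entry are thus functions of \<open>u\<close> alone.\<close>

lemma catenoid_normal_form:
  assumes "catenoid X g"
  obtains V c a b d a1 b1 d1 a2 b2 d2 om where "is_motion X V c"
    "revolution X a b d a1 b1 d1 a2 b2 d2 om" "om > 0" "g = motion V c \<circ> rot a b d om"
proof -
  obtain R where R: "rotation_group X R" "\<And>t. g \<circ> lift_rot t = R t \<circ> g"
    and g: "conformal_immersion X g" using assms unfolding catenoid_def by blast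
  obtain l where l: "is_geodesic X l" "\<And>t. rotation_about X l (R t)" using R(1) unfolding rotation_group_def by blast
  obtain V c where V: "is_motion X V c" and axis: "\<And>s. motion V c (axis_geodesic X s) \<in> l"
    using geodesic_axis_motion[OF l(1)] by blast
  obtain V' c' where I: "is_motion X V' c'" "\<And>x. motion V' c' (motion V c x) = x"
    "\<And>x. motion V c (motion V' c' x) = x" by (rule motion_inverse[OF V]) blast
  define r where "r = motion V' c' \<circ> g"
  have g_r: "g z = motion V c (r z)" for z by (simp add: r_def I)
  have r: "conformal_immersion X r" unfolding r_def by (rule conformal_immersion_motion[OF I(1) g])
  then have space: "r z \<in> space_of X" "g z \<in> space_of X" for z
    using g by (auto simp: conformal_immersion_def)
  have dist: "distance X (axis_geodesic X s) (r (lift_rot t w)) = distance X (axis_geodesic X s) (r w)" for s t w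
  proof -
    let ?y = "motion V c (axis_geodesic X s)"
    have y: "?y \<in> space_of X" using motion_space[OF V axis_geodesic_space] .
    have "distance X (axis_geodesic X s) (r (lift_rot t w)) = distance X ?y (g (lift_rot t w))"
      unfolding g_r motion_distance[OF V] ..
    also have "g (lift_rot t w) = R t (g w)" using R(2) by (metis comp_apply)
    also have "distance X ?y (R t (g w)) = distance X (R t ?y) (R t (g w))"
      using l(2) axis unfolding rotation_about_def by metis
    also have "\<dots> = distance X ?y (g w)"
      using l(2) y space unfolding rotation_about_def rigid_motion_def isometry_of_def by blast
    also have "\<dots> = distance X (axis_geodesic X s) (r w)" unfolding g_r motion_distance[OF V] ..
    finally show ?thesis .
  qed
  interpret symmetric_surface X r
  proof
    have *: "Re (r (lift_rot t w) $ 1 $ 1) = Re (r w $ 1 $ 1) \<and> Re (r (lift_rot t w) $ 2 $ 2) = Re (r w $ 2 $ 2) \<and>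
       cmod (r (lift_rot t w) $ 1 $ 2) = cmod (r w $ 1 $ 2)" for w t
    proof -
      obtain a b d where 1: "r (lift_rot t w) = hm a b d" using space(1) by (rule space_of_cases)
      obtain a' b' d' where 2: "r w = hm a' b' d'" using space(1) by (rule space_of_cases)
      have "a = a' \<and> d = d' \<and> cmod b = cmod b'"
        using axis_distances[of a b d X a' b' d'] space dist[of _ t w] by (metis 1 2)
      then show ?thesis unfolding 1 2 by (simp add: hm_def)
    qed
    show "Re (r (lift_rot t w) $ 1 $ 1) = Re (r w $ 1 $ 1)" "Re (r (lift_rot t w) $ 2 $ 2) = Re (r w $ 2 $ 2)"
       "cmod (r (lift_rot t w) $ 1 $ 2) = cmod (r w $ 1 $ 2)" for w t using * by blast+
  qed (rule r)
  obtain a0 b0 d0 a1 b1 d1 a2 b2 d2 om \<tau> where rev: "revolution X a0 b0 d0 a1 b1 d1 a2 b2 d2 om"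
    and r_rot: "r = congr_by (turn \<tau>) \<circ> rot a0 b0 d0 om" by (rule normal_form)
  obtain V1 c1 where V1: "is_motion X V1 c1" "\<And>x. motion V c (congr_by (turn \<tau>) x) = motion V1 c1 x"
    using motion_compose[OF V admissible_turn[of X \<tau>]] unfolding motion_0 by blast
  have g1: "g = motion V1 c1 \<circ> rot a0 b0 d0 om" using g_r r_rot V1(2) by auto
  have "om \<noteq> 0" using revolution.nonzero(1)[OF rev] .
  then consider "om > 0" | "om < 0" by linarith
  then show ?thesis
  proof cases
    case 1
    then show ?thesis using that[OF V1(1) rev _ g1] by blast
  next
    case 2
    obtain V2 c2 where V2: "is_motion X V2 c2" "\<And>x. motion V1 c1 (congr_by swap x) = motion V2 c2 x"
      using motion_compose[OF V1(1) admissible_swap] unfolding motion_0 by blast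
    have "g = motion V2 c2 \<circ> rot d0 (\<lambda>u. - b0 u) a0 (- om)"
      unfolding g1 rot_swap[of a0] using V2(2) by auto
    then show ?thesis using that[OF V2(1) revolution_swap[OF rev]] 2 by simp
  qed
qed

section \<open>The profile curve equations\<close>

lemma DERIV_eq_0_const:
  assumes "\<And>u. (f has_real_derivative 0) (at u)" shows "f u = f (0::real)"
  using DERIV_isconst_all assms by blast

lemma clear_half: "x - y / 2 = z \<Longrightarrow> 2 * x - y = 2 * z" for x y z :: real
  by simp

context revolution
begin

text \<open>The momentum along the axis: the inner product of the profile's velocity with the Killing field of the translations
along the axis.\<close>

definition "kappa u = (a1 u * d u - a u * d1 u) / 2"

lemma conformal_deriv: "2 * b1 u * b2 u - a2 u * d1 u - a1 u * d2 u = 2 * om\<^sup>2 * b u * b1 u"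
proof -
  have "((\<lambda>u. (b1 u)\<^sup>2 - a1 u * d1 u - (om * b u)\<^sup>2) has_real_derivative
      2 * b1 u * b2 u - a2 u * d1 u - a1 u * d2 u - 2 * om\<^sup>2 * b u * b1 u) (at u)"
    by (auto intro!: derivative_eq_intros deriv1 deriv2 simp: power2_eq_square algebra_simps)
  from real_derivative_of_const[OF this, of 0] show ?thesis using conformal by simp
qed

text \<open>The equation for the mean curvature and the derivative of the conformality relation are linear in the two unknown
second derivatives, with determinant the squared speed, which is nonzero. They state that the immersion is harmonic.\<close>

lemma E3_equations:
  assumes X: "X = E3" and H: "\<And>u. Luu u + Lvv u = 2 * cmc X * (om * b u)\<^sup>2"
  shows "a2 u = 0" "b2 u = om\<^sup>2 * b u" "Lvv u = - om * a1 u"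
proof -
  have d1: "d1 = (\<lambda>u. - a1 u)" using d1_E3[OF X] by auto
  have "(d1 has_real_derivative - a2 u) (at u)" unfolding d1 by (rule DERIV_minus[OF deriv2(1)])
  then have d2: "d2 u = - a2 u" using deriv2(3) DERIV_unique by blast
  have n: "om * b u * n1 u = - b1 u" "om * b u * n2 u = a1 u" "om * b u * n3 u = b1 u"
    using nonzero unfolding n1_def n2_def n3_def A_def B_def D_def unfolding X d1 by simp_all
  show Lvv: "Lvv u = - om * a1 u" unfolding Lvv_def using n by algebra
  have conf: "(b1 u)\<^sup>2 + (a1 u)\<^sup>2 = om\<^sup>2 * (b u)\<^sup>2"
    using conformal[of u] unfolding d1 by (simp add: power2_eq_square algebra_simps)
  have pos: "(b1 u)\<^sup>2 + (a1 u)\<^sup>2 \<noteq> 0" unfolding conf using nonzero by simp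
  have 1: "b1 u * b2 u + a1 u * a2 u = om\<^sup>2 * b u * b1 u"
    using conformal_deriv[of u] d2 unfolding d1 by simp
  have "Luu u = om * a1 u" using H[of u] Lvv X by (simp add: cmc_def)
  then have "b2 u * n2 u - (a2 u * n3 u + - a2 u * n1 u) / 2 = om * a1 u"
    unfolding Luu_def d2 .
  then have "2 * (b2 u * n2 u) - (a2 u * n3 u + - a2 u * n1 u) = 2 * (om * a1 u)" by (rule clear_half)
  then have "2 * (b2 u * (om * b u * n2 u)) - a2 u * (om * b u * n3 u) + a2 u * (om * b u * n1 u) = 2 * om\<^sup>2 * b u * a1 u"
    by algebra
  then have 2: "b2 u * a1 u - a2 u * b1 u = om\<^sup>2 * b u * a1 u" unfolding n by simp
  have "((b1 u)\<^sup>2 + (a1 u)\<^sup>2) * a2 u = 0" using 1 2 by algebra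
  then show "a2 u = 0" using pos by (metis mult_eq_0_iff)
  have "((b1 u)\<^sup>2 + (a1 u)\<^sup>2) * (b2 u - om\<^sup>2 * b u) = 0" using 1 2 by algebra
  then show "b2 u = om\<^sup>2 * b u" using pos by (metis mult_eq_0_iff eq_iff_diff_eq_0)
qed

text \<open>As in Euclidean space, the second derivatives solve a nondegenerate linear system, formed by the mean curvature
equation and the derivatives of the determinant and conformality relations. All relations are multiplied by
\<open>a d = 1 + b\<^sup>2\<close>, so that only the products \<open>a2 d\<close> and \<open>a d2\<close> occur. The first equation is the balancing law for the
momentum \<open>kappa\<close>.\<close>

lemma H3_equations:
  assumes X: "X = H3" and H: "\<And>u. Luu u + Lvv u = 2 * cmc X * (om * b u)\<^sup>2"
  shows "a2 u * d u - a u * d2 u = - 4 * om * b u * b1 u"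
    "b2 u = (om\<^sup>2 + 2 * om\<^sup>2 * (b u)\<^sup>2 + 2 * om * kappa u) * b u"
    "Lvv u = - om * kappa u" "(b1 u)\<^sup>2 + (kappa u)\<^sup>2 = om\<^sup>2 * (b u)\<^sup>2 * (1 + (b u)\<^sup>2)"
proof -
  have S: "a u * d u = 1 + (b u)\<^sup>2" using in_H3(1)[OF X, of u] by simp
  have k: "a1 u * d u = b u * b1 u + kappa u" "a u * d1 u = b u * b1 u - kappa u"
    using tangent_H3[OF X, of u] unfolding kappa_def by (simp_all add: field_simps)
  have n: "om * b u * n1 u = b u * a1 u - a u * b1 u" "om * b u * n2 u = kappa u"
     "om * b u * n3 u = d u * b1 u - b u * d1 u"
    using nonzero unfolding n1_def n2_def n3_def A_def B_def D_def kappa_def unfolding X by simp_all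
  show Lvv: "Lvv u = - om * kappa u" unfolding Lvv_def using n by algebra
  have c: "(b1 u)\<^sup>2 - a1 u * d1 u = om\<^sup>2 * (b u)\<^sup>2" using conformal[of u] by (simp add: power_mult_distrib)
  show conf: "(b1 u)\<^sup>2 + (kappa u)\<^sup>2 = om\<^sup>2 * (b u)\<^sup>2 * (1 + (b u)\<^sup>2)"
    using c k S by algebra
  have pos: "(b1 u)\<^sup>2 + (kappa u)\<^sup>2 \<noteq> 0"
  proof -
    have "1 + (b u)\<^sup>2 > 0" by (simp add: add_pos_nonneg)
    then show ?thesis unfolding conf using nonzero by simp
  qed
  have "((\<lambda>u. a1 u * d u + a u * d1 u - 2 * b u * b1 u) has_real_derivative
     a2 u * d u + 2 * a1 u * d1 u + a u * d2 u - 2 * (b1 u)\<^sup>2 - 2 * b u * b2 u) (at u)"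
    by (auto intro!: derivative_eq_intros deriv1 deriv2 simp: power2_eq_square algebra_simps)
  from real_derivative_of_const[OF this, of 0]
  have "a2 u * d u + 2 * a1 u * d1 u + a u * d2 u - 2 * (b1 u)\<^sup>2 - 2 * b u * b2 u = 0"
    using tangent_H3[OF X] by simp
  then have s: "a2 u * d u + a u * d2 u = 2 * b u * b2 u + 2 * om\<^sup>2 * (b u)\<^sup>2"
    using c by algebra
  define D' where "D' = a2 u * d u - a u * d2 u"
  have xy: "2 * (a2 u * d u) = 2 * b u * b2 u + 2 * om\<^sup>2 * (b u)\<^sup>2 + D'"
    "2 * (a u * d2 u) = 2 * b u * b2 u + 2 * om\<^sup>2 * (b u)\<^sup>2 - D'"
    using s unfolding D'_def by simp_all
  define Y where "Y = b2 u - om\<^sup>2 * b u - 2 * om\<^sup>2 * b u * (b u)\<^sup>2"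
  \<comment> \<open>the derivative of the conformality relation\<close>
  have "(a u * d u) * (2 * b1 u * b2 u - 2 * om\<^sup>2 * b u * b1 u) = (a2 u * d u) * (a u * d1 u) + (a1 u * d u) * (a u * d2 u)"
    using conformal_deriv[of u] by algebra
  then have 1: "2 * b1 u * Y + D' * kappa u = 0"
    unfolding S k Y_def using xy by algebra
  \<comment> \<open>the mean curvature equation\<close>
  have "Luu u = 2 * om\<^sup>2 * (b u)\<^sup>2 + om * kappa u" using H[of u] Lvv X by (simp add: cmc_def power_mult_distrib)
  then have "2 * (b2 u * n2 u) - (a2 u * n3 u + d2 u * n1 u) = 2 * (2 * om\<^sup>2 * (b u)\<^sup>2 + om * kappa u)"
    unfolding Luu_def by (rule clear_half)
  then have "2 * (b2 u * (om * b u * n2 u)) - (a2 u * (om * b u * n3 u) + d2 u * (om * b u * n1 u)) =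
     om * b u * (2 * (2 * om\<^sup>2 * (b u)\<^sup>2 + om * kappa u))" by algebra
  then have "2 * (b2 u * kappa u) - (a2 u * (d u * b1 u - b u * d1 u) + d2 u * (b u * a1 u - a u * b1 u)) =
     om * b u * (2 * (2 * om\<^sup>2 * (b u)\<^sup>2 + om * kappa u))" unfolding n .
  then have "(a u * d u) * (2 * (b2 u * kappa u) - om * b u * (4 * om\<^sup>2 * (b u)\<^sup>2 + 2 * om * kappa u)) =
     (a2 u * d u) * ((a u * d u) * b1 u - b u * (a u * d1 u)) + (a u * d2 u) * (b u * (a1 u * d u) - (a u * d u) * b1 u)"
    by algebra
  then have 2: "2 * kappa u * Y - D' * b1 u = 4 * om ^ 3 * b u ^ 3 * (1 + (b u)\<^sup>2)"
    unfolding S k Y_def using xy by algebra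
  have "((b1 u)\<^sup>2 + (kappa u)\<^sup>2) * D' = - 4 * om ^ 3 * b u ^ 3 * (1 + (b u)\<^sup>2) * b1 u" using 1 2 by algebra
  also have "\<dots> = ((b1 u)\<^sup>2 + (kappa u)\<^sup>2) * (- 4 * om * b u * b1 u)" unfolding conf by algebra
  finally show "a2 u * d u - a u * d2 u = - 4 * om * b u * b1 u" using pos unfolding D'_def by (metis mult_left_cancel)
  have "((b1 u)\<^sup>2 + (kappa u)\<^sup>2) * (2 * Y) = 4 * om ^ 3 * b u ^ 3 * (1 + (b u)\<^sup>2) * kappa u" using 1 2 by algebra
  also have "\<dots> = ((b1 u)\<^sup>2 + (kappa u)\<^sup>2) * (2 * (2 * om * kappa u * b u))" unfolding conf by algebra
  finally have "2 * Y = 2 * (2 * om * kappa u * b u)" using pos by (metis mult_left_cancel)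
  then have "Y = 2 * om * kappa u * b u" by simp
  then show "b2 u = (om\<^sup>2 + 2 * om\<^sup>2 * (b u)\<^sup>2 + 2 * om * kappa u) * b u" unfolding Y_def by algebra
qed

end

context revolution
begin

text \<open>By the balancing law \<open>kappa + om b\<^sup>2\<close> is constant in \<open>H3\<close>, as is the slope of the height in \<open>E3\<close>. The constant \<open>q\<close>
is the Hopf differential, and the equation for the profile becomes linear with constant coefficients.\<close>

lemma first_integrals:
  assumes H: "\<And>u. Luu u + Lvv u = 2 * cmc X * (om * b u)\<^sup>2"
  obtains q where "\<And>u. Lvv u = cmc X * (om * b u)\<^sup>2 - 2 * q"
    "\<And>u. b2 u = (om\<^sup>2 + 4 * cmc X * q) * b u"
    "\<And>u. (b1 u)\<^sup>2 = (om\<^sup>2 + 4 * cmc X * q) * (b u)\<^sup>2 - (2 * q / om)\<^sup>2"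
    "\<And>u. X = E3 \<Longrightarrow> a1 u = 2 * q / om"
    "\<And>u. X = H3 \<Longrightarrow> kappa u = 2 * q / om - om * (b u)\<^sup>2"
proof (cases X)
  case E3
  note eqs = E3_equations[OF E3 H]
  define q where "q = om * a1 0 / 2"
  have "(a1 has_real_derivative 0) (at u)" for u using deriv2(1)[of u] unfolding eqs(1) .
  then have "a1 u = a1 0" for u by (rule DERIV_eq_0_const)
  then have a1: "a1 u = 2 * q / om" for u using nonzero(1) by (simp add: q_def)
  have c: "cmc X = 0" by (simp add: E3)
  show ?thesis
  proof (rule that[of q])
    fix u
    show "Lvv u = cmc X * (om * b u)\<^sup>2 - 2 * q"
      unfolding eqs(3) a1 c using nonzero(1) by simp
    show "b2 u = (om\<^sup>2 + 4 * cmc X * q) * b u" unfolding eqs(2) c by simp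
    show "(b1 u)\<^sup>2 = (om\<^sup>2 + 4 * cmc X * q) * (b u)\<^sup>2 - (2 * q / om)\<^sup>2"
      using conformal[of u] unfolding c d1_E3[OF E3] a1 by (simp add: power2_eq_square algebra_simps)
    show "X = E3 \<Longrightarrow> a1 u = 2 * q / om" by (rule a1)
    show "X = H3 \<Longrightarrow> kappa u = 2 * q / om - om * (b u)\<^sup>2" using E3 by simp
  qed
next
  case H3
  note eqs = H3_equations[OF H3 H]
  define q where "q = om * (kappa 0 + om * (b 0)\<^sup>2) / 2"
  have c: "cmc X = 1" by (simp add: H3)
  have "((\<lambda>u. kappa u + om * (b u)\<^sup>2) has_real_derivative
      (a2 u * d u - a u * d2 u) / 2 + 2 * om * b u * b1 u) (at u)" for u
    unfolding kappa_def
    by (auto intro!: derivative_eq_intros deriv1 deriv2 simp: field_simps)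
  then have "((\<lambda>u. kappa u + om * (b u)\<^sup>2) has_real_derivative 0) (at u)" for u
    unfolding eqs(1) by simp
  then have "kappa u + om * (b u)\<^sup>2 = kappa 0 + om * (b 0)\<^sup>2" for u
    by (rule DERIV_eq_0_const)
  then have k: "kappa u = 2 * q / om - om * (b u)\<^sup>2" for u
    using nonzero(1) by (simp add: q_def eq_diff_eq)
  show ?thesis
  proof (rule that[of q])
    fix u
    show "Lvv u = cmc X * (om * b u)\<^sup>2 - 2 * q"
      unfolding eqs(3) k c using nonzero(1) by (simp add: power2_eq_square algebra_simps)
    show "b2 u = (om\<^sup>2 + 4 * cmc X * q) * b u"
      unfolding eqs(2) k c using nonzero(1) by (simp add: power2_eq_square algebra_simps)
    show "(b1 u)\<^sup>2 = (om\<^sup>2 + 4 * cmc X * q) * (b u)\<^sup>2 - (2 * q / om)\<^sup>2"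
    proof -
      have "om * (2 * q / om) = 2 * q" using nonzero(1) by simp
      then show ?thesis using eqs(4)[of u] unfolding k c by algebra
    qed
    show "X = E3 \<Longrightarrow> a1 u = 2 * q / om" using H3 by simp
    show "X = H3 \<Longrightarrow> kappa u = 2 * q / om - om * (b u)\<^sup>2" by (rule k)
  qed
qed

end

section \<open>Matching a catenoid with the model\<close>

text \<open>The profile is a sum of two exponentials, and its energy shows that the coefficients have a positive product. A
translation of the parameter adjusts their quotient and a sign their common sign.\<close>

lemma profile_is_model:
  fixes b b1 :: "real \<Rightarrow> real"
  assumes pos: "mu > 0" "nu > 0" "q \<noteq> 0"
    and b: "\<And>u. (b has_real_derivative b1 u) (at u)" "\<And>u. (b1 has_real_derivative 4 * mu\<^sup>2 * b u) (at u)"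
    and energy: "\<And>u. (b1 u)\<^sup>2 = 4 * mu\<^sup>2 * (b u)\<^sup>2 - (q / nu)\<^sup>2"
  obtains s u0 where "s = 1 \<or> s = -1" "\<And>u. b u = s * model_b q mu nu (u + u0)"
    "\<And>u. b1 u = s * model_b1 q mu nu (u + u0)"
proof -
  \<comment> \<open>\<open>P\<close> and \<open>M\<close> isolate the growing and the decaying exponential of the solution\<close>
  define P M where "P u = (2 * mu * b u + b1 u) * exp (- 2 * mu * u)"
    and "M u = (2 * mu * b u - b1 u) * exp (2 * mu * u)" for u
  define P0 M0 where "P0 = P 0" and "M0 = M 0"
  have "(P has_real_derivative 0) (at u)" for u
    unfolding P_def[abs_def] by (auto intro!: derivative_eq_intros b simp: power2_eq_square algebra_simps)
  then have P: "P u = P0" for u unfolding P0_def by (rule DERIV_eq_0_const)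
  have "(M has_real_derivative 0) (at u)" for u
    unfolding M_def[abs_def] by (auto intro!: derivative_eq_intros b simp: power2_eq_square algebra_simps)
  then have M: "M u = M0" for u unfolding M0_def by (rule DERIV_eq_0_const)
  have PM: "P0 * M0 = (q / nu)\<^sup>2"
    using energy[of 0] by (simp add: P0_def M0_def P_def M_def power2_eq_square algebra_simps)
  then have "P0 * M0 > 0" using pos by simp
  then have Mnz: "M0 \<noteq> 0" and ratio: "P0 / M0 > 0" by (auto simp: zero_less_mult_iff zero_less_divide_iff)
  have b_PM: "4 * mu * b u = P0 * exp (2 * mu * u) + M0 * exp (- 2 * mu * u)" for u
  proof -
    have e: "exp (- 2 * mu * u) * exp (2 * mu * u) = 1" by (simp flip: exp_add)
    have "P0 * exp (2 * mu * u) + M0 * exp (- 2 * mu * u) = P u * exp (2 * mu * u) + M u * exp (- 2 * mu * u)"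
      using P[of u] M[of u] by simp
    also have "\<dots> = 4 * mu * b u * (exp (- 2 * mu * u) * exp (2 * mu * u))"
      unfolding P_def M_def by (simp add: algebra_simps)
    finally show ?thesis unfolding e by simp
  qed
  \<comment> \<open>\<open>z\<close> becomes the value of \<open>exp (2 mu u0)\<close>\<close>
  define y where "y = sqrt (P0 / M0)"
  have y: "y > 0" using ratio by (simp add: y_def)
  define z where "z = mu * y"
  have z: "z > 0" "z * z * M0 = mu\<^sup>2 * P0"
  proof -
    have "P0 = y * y * M0"
      unfolding y_def real_sqrt_mult_self abs_of_pos[OF ratio] using Mnz by simp
    then show "z * z * M0 = mu\<^sup>2 * P0" unfolding z_def by (simp only: power2_eq_square mult_ac)
  qed (use y pos in \<open>simp add: z_def\<close>)
  define s where "s = - (M0 * nu * z / (q * mu))"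
  define u0 where "u0 = ln z / (2 * mu)"
  have u0: "exp (2 * mu * (u + u0)) = exp (2 * mu * u) * z" "exp (- 2 * mu * (u + u0)) = exp (- 2 * mu * u) / z" for u
  proof -
    have "2 * mu * u0 = ln z" using pos by (simp add: u0_def)
    then have "2 * mu * (u + u0) = 2 * mu * u + ln z" "- 2 * mu * (u + u0) = - 2 * mu * u - ln z"
      by (simp_all add: algebra_simps)
    then show "exp (2 * mu * (u + u0)) = exp (2 * mu * u) * z" "exp (- 2 * mu * (u + u0)) = exp (- 2 * mu * u) / z"
      using z(1) by (simp_all only: exp_add exp_diff exp_ln)
  qed
  have "s * s * (q * mu)\<^sup>2 = M0 * nu\<^sup>2 * (z * z * M0)"
    using pos by (simp add: s_def power2_eq_square)
  also have "\<dots> = nu\<^sup>2 * mu\<^sup>2 * (P0 * M0)" unfolding z(2) by simp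
  also have "\<dots> = 1 * (q * mu)\<^sup>2" unfolding PM using pos by (simp add: power2_eq_square)
  finally have "s * s = 1" using pos by (metis mult_right_cancel mult_eq_0_iff power_eq_0_iff less_irrefl)
  then have s: "s = 1 \<or> s = -1" by (simp add: square_eq_1_iff)
  have Mz: "M0 * nu * z = - (s * q * mu)" using pos by (simp add: s_def)
  have b_eq: "b u = s * model_b q mu nu (u + u0)" for u
  proof -
    define E F where EF: "E = exp (2 * mu * u)" "F = exp (- 2 * mu * u)"
    have Pz: "P0 * nu * mu = - (s * q * z)"
    proof -
      have "mu * (P0 * nu * mu) = mu * (- (s * q * z))" using Mz z(2) by algebra
      then show ?thesis using pos by (metis mult_left_cancel less_irrefl)
    qed
    have "4 * mu * nu * mu * z * b u = nu * mu * z * (P0 * E + M0 * F)"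
      using b_PM[of u] unfolding EF by algebra
    also have "\<dots> = - (s * q * z * (E * z)) - s * q * mu * mu * F" using Pz Mz by algebra
    finally have "b u = (- (s * q * z * (E * z)) - s * q * mu * mu * F) / (4 * mu * nu * mu * z)"
      using pos z(1) by (simp add: field_simps)
    also have "\<dots> = s * model_b q mu nu (u + u0)"
      unfolding model_b_def u0 EF[symmetric] using pos z(1) by (simp add: field_simps power2_eq_square)
    finally show ?thesis .
  qed
  have "b1 u = s * model_b1 q mu nu (u + u0)" for u
  proof -
    have "((\<lambda>u. s * model_b q mu nu (u + u0)) has_real_derivative s * model_b1 q mu nu (u + u0)) (at u)"
      by (intro DERIV_cmult DERIV_shift[THEN iffD1] model_b_deriv(1)[OF pos(1,2)])
    moreover have "b = (\<lambda>u. s * model_b q mu nu (u + u0))" using b_eq by blast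
    ultimately show ?thesis using b(1)[of u] DERIV_unique by metis
  qed
  then show ?thesis using that s b_eq by blast
qed

definition stretch :: "real \<Rightarrow> cmat" where
  "stretch m = mat2 (of_real m) 0 0 (1 / of_real m)"

lemma congr_by_stretch: "m > 0 \<Longrightarrow> congr_by (stretch m) (hm a b d) = hm (m\<^sup>2 * a) b (d / m\<^sup>2)"
  by (simp add: stretch_def hm_def power2_eq_square)

lemma admissible_stretch: "m > 0 \<Longrightarrow> is_motion H3 (stretch m) 0"
  by (simp add: is_motion_def stretch_def)

lemma solve_sum_diff: "x + y = 2 * p * r \<Longrightarrow> x - y = 2 * k \<Longrightarrow> x = p * r + k" for x y p r k :: real
  by simp

text \<open>A nonzero \<open>q\<close> makes the energy equation force a real growth rate \<open>\<mu>\<close>; in \<open>H3\<close> this is the positivity of \<open>p + q\<close>.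
Once the profiles agree, the diagonal entries satisfy the same first order equation, so they differ by a constant,
additive in \<open>E3\<close> and multiplicative in \<open>H3\<close>. It is absorbed by a translation along the axis.\<close>

lemma (in revolution) rot_is_model:
  assumes om: "om > 0" and H: "\<And>u. Luu u + Lvv u = 2 * cmc X * (om * b u)\<^sup>2"
    and nonflat: "\<not> (\<forall>u. Luu u = cmc X * (om * b u)\<^sup>2 \<and> Lvv u = cmc X * (om * b u)\<^sup>2)"
  obtains q mu V c u0 where "cat_model X q mu (om / 2)" "is_motion X V c"
    "\<And>w. rot a b d om w = motion V c (model X q mu (om / 2) (w + of_real u0))"
proof -
  obtain q where q: "\<And>u. Lvv u = cmc X * (om * b u)\<^sup>2 - 2 * q"
    "\<And>u. b2 u = (om\<^sup>2 + 4 * cmc X * q) * b u"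
    "\<And>u. (b1 u)\<^sup>2 = (om\<^sup>2 + 4 * cmc X * q) * (b u)\<^sup>2 - (2 * q / om)\<^sup>2"
    "\<And>u. X = E3 \<Longrightarrow> a1 u = 2 * q / om"
    "\<And>u. X = H3 \<Longrightarrow> kappa u = 2 * q / om - om * (b u)\<^sup>2"
    by (rule first_integrals[OF H]) blast
  have q0: "q \<noteq> 0"
  proof
    assume "q = 0"
    then have "Lvv u = cmc X * (om * b u)\<^sup>2" for u using q(1) by simp
    moreover from this have "Luu u = cmc X * (om * b u)\<^sup>2" for u using H[of u] by simp
    ultimately show False using nonflat by blast
  qed
  define k where "k = om\<^sup>2 + 4 * cmc X * q"
  have "k * (b 0)\<^sup>2 = (b1 0)\<^sup>2 + (2 * q / om)\<^sup>2" using q(3)[of 0] by (simp add: k_def)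
  also have "\<dots> > 0" using q0 om by (intro add_nonneg_pos) auto
  finally have k: "k > 0" by (simp add: zero_less_mult_iff)
  define mu where "mu = sqrt k / 2"
  define nu where "nu = om / 2"
  have mu: "mu > 0" "4 * mu\<^sup>2 = k" using k by (simp_all add: mu_def power_divide)
  have nu: "nu > 0" "om = 2 * nu" using om by (simp_all add: nu_def)
  have cat: "cat_model X q mu nu"
  proof
    show "mu\<^sup>2 = (case X of E3 \<Rightarrow> nu\<^sup>2 | H3 \<Rightarrow> nu\<^sup>2 + q)"
      using mu(2) unfolding k_def nu cmc_def by (cases X) (simp_all add: power_mult_distrib)
  qed (use mu nu q0 in auto)
  interpret m: cat_model X q mu nu by (rule cat)
  have "(b1 has_real_derivative 4 * mu\<^sup>2 * b u) (at u)" "(b1 u)\<^sup>2 = 4 * mu\<^sup>2 * (b u)\<^sup>2 - (q / nu)\<^sup>2" for u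
    using deriv2(2)[of u] q(2,3)[of u] unfolding mu k_def nu by simp_all
  then obtain s u0 where s: "s = 1 \<or> s = -1" and b: "\<And>u. b u = s * model_b q mu nu (u + u0)"
    "\<And>u. b1 u = s * model_b1 q mu nu (u + u0)"
    using profile_is_model[OF mu(1) nu(1) q0 deriv1(2)] by blast
  have ss: "s * s = 1" using s by auto
  obtain \<tau> where \<tau>: "cis \<tau> = of_real s" using s by (metis cis_pi cis_zero of_real_1 of_real_minus)
  have model: "model X q mu nu (w + of_real u0) = hm (m.a (Re w + u0))
     (of_real (m.b (Re w + u0)) * cis (om * Im w)) (m.d (Re w + u0))" for w
    by (simp add: model_def rot_def nu)
  have bs: "cis \<tau> * (of_real (m.b (Re w + u0)) * cis (om * Im w)) = of_real (b (Re w)) * cis (om * Im w)" for w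
    unfolding \<tau> b by simp
  show ?thesis
  proof (cases X)
    case E3
    define h where "h = a 0 - (q / nu) * u0"
    have a: "a u = (q / nu) * (u + u0) + h" for u
    proof -
      have "((\<lambda>u. a u - (q / nu) * u) has_real_derivative a1 u - q / nu) (at u)" for u
        using nu(1) by (auto intro!: derivative_eq_intros deriv1)
      then have "((\<lambda>u. a u - (q / nu) * u) has_real_derivative 0) (at u)" for u
        using q(4)[OF E3] nu by simp
      then have "a u - (q / nu) * u = a 0 - (q / nu) * 0" by (rule DERIV_eq_0_const)
      then show ?thesis by (simp add: h_def algebra_simps add_divide_distrib)
    qed
    have V: "is_motion X (turn \<tau>) (hm h 0 (- h))"
      using admissible_turn[of X \<tau>] by (simp add: is_motion_def E3 del: space_of.simps)
    have "rot a b d om w = motion (turn \<tau>) (hm h 0 (- h)) (model X q mu nu (w + of_real u0))" for w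
      unfolding motion_def model congr_by_turn bs by (simp add: rot_def in_E3[OF E3] E3 a)
    then show ?thesis using that[OF _ V] cat unfolding nu_def by blast
  next
    case H3
    have pos: "a u > 0" "d u > 0" "m.a u > 0" "m.d u > 0" for u
      using H3_diagonal_pos[of "a u" "of_real (b u)" "d u"] H3_diagonal_pos[of "m.a u" "of_real (m.b u)" "m.d u"]
        in_H3[OF H3, of u] m.in_H3[OF H3, of u] by (simp_all del: space_of.simps)
    have ad: "a u * d u = m.a (u + u0) * m.d (u + u0)" for u
    proof -
      have "(b u)\<^sup>2 = (m.b (u + u0))\<^sup>2" using ss unfolding b by algebra
      then show ?thesis using in_H3(1)[OF H3, of u] m.in_H3(1)[OF H3, of "u + u0"] by linarith
    qed
    have a1d: "a1 u * d u = m.a1 (u + u0) * m.d (u + u0)" for u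
    proof -
      have "a1 u * d u = b u * b1 u + kappa u"
        using tangent_H3[OF H3, of u] unfolding kappa_def by (simp add: field_simps)
      moreover have "m.a1 (u + u0) * m.d (u + u0) = m.b (u + u0) * m.b1 (u + u0) + (q / nu - 2 * nu * (m.b (u + u0))\<^sup>2)"
        by (rule solve_sum_diff[OF m.tangent_H3[OF H3] m.hyperbolic_identities(2)[OF H3]])
      moreover have "b u * b1 u = m.b (u + u0) * m.b1 (u + u0)"
        "(b u)\<^sup>2 = (m.b (u + u0))\<^sup>2" using ss unfolding b by algebra+
      ultimately show ?thesis unfolding q(5)[OF H3] nu by simp
    qed
    have quot: "a u / m.a (u + u0) = a 0 / m.a (0 + u0)" for u
    proof (rule DERIV_eq_0_const[where f = "\<lambda>u. a u / m.a (u + u0)"])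
      fix u
      have "(a1 u * m.a (u + u0) - a u * m.a1 (u + u0)) * (d u * m.d (u + u0)) = 0"
        using ad[of u] a1d[of u] by algebra
      then have "a1 u * m.a (u + u0) - a u * m.a1 (u + u0) = 0" using pos[of u] pos[of "u + u0"] by simp
      moreover have "((\<lambda>u. m.a (u + u0)) has_real_derivative m.a1 (u + u0)) (at u)"
        using m.deriv1(1) by (rule DERIV_shift[THEN iffD1])
      then have "((\<lambda>u. a u / m.a (u + u0)) has_real_derivative
         (a1 u * m.a (u + u0) - a u * m.a1 (u + u0)) / (m.a (u + u0) * m.a (u + u0))) (at u)"
        using pos[of "u + u0"] by (intro DERIV_divide deriv1) auto
      ultimately show "((\<lambda>u. a u / m.a (u + u0)) has_real_derivative 0) (at u)" by simp
    qed
    \<comment> \<open>\<open>congr_by (stretch t)\<close> is the translation along the axis by \<open>2 ln t\<close>\<close>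
    define t where "t = sqrt (a 0 / m.a (0 + u0))"
    have "a 0 / m.a (0 + u0) > 0" by (intro divide_pos_pos pos)
    then have t: "t > 0" "t\<^sup>2 = a 0 / m.a (0 + u0)" by (simp_all add: t_def del: add_0)
    have a: "a u = t\<^sup>2 * m.a (u + u0)" for u
      using quot[of u] pos(3)[of "u + u0"] unfolding t(2)[symmetric] by (simp add: field_simps)
    have d: "d u = m.d (u + u0) / t\<^sup>2" for u
      using ad[of u] pos(3)[of "u + u0"] t(1) unfolding a by (simp add: field_simps)
    obtain V c where V: "is_motion X V c" "\<And>x. congr_by (stretch t) (congr_by (turn \<tau>) x) = motion V c x"
      using motion_compose[OF admissible_stretch[OF t(1)] admissible_turn[of H3 \<tau>]] unfolding motion_0 H3 by blast
    have "rot a b d om w = motion V c (model X q mu nu (w + of_real u0))" for w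
      unfolding V(2)[symmetric] model congr_by_turn bs congr_by_stretch[OF t(1)] by (simp only: rot_def a d)
    then show ?thesis using that[OF _ V(1)] cat unfolding nu_def by blast
  qed
qed

lemma cat_immersion_is_model:
  assumes "cat_admissible X q p"
  obtains V c where "cat_model X q (cat_mu X q p) (sqrt p)" "is_motion X V c"
    "cat_immersion X q p = motion V c \<circ> model X q (cat_mu X q p) (sqrt p)"
proof -
  have qp: "q \<noteq> 0" "p > 0" "X = H3 \<Longrightarrow> p + q > 0" using assms by (auto simp: cat_admissible_def)
  have model: "cat_model X q (cat_mu X q p) (sqrt p)"
    by unfold_locales (use qp in \<open>cases X; simp\<close>)+
  show ?thesis
  proof (cases X)
    case E3
    have "sqrt p > 0" "(sqrt p)\<^sup>2 = p" using qp(2) by simp_all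
    from induced_E3[OF this qp(1)] obtain c where "is_motion E3 (mat 1) c"
      "cat_immersion E3 q p = motion (mat 1) c \<circ> model E3 q (sqrt p) (sqrt p)" by blast
    then show ?thesis using that model unfolding E3 cat_mu.simps by blast
  next
    case H3
    have "sqrt (p + q) > 0" "(sqrt (p + q))\<^sup>2 = p + q" "sqrt p > 0" "(sqrt p)\<^sup>2 = p" using qp(2) qp(3)[OF H3] by simp_all
    from induced_H3[OF this qp(1)] obtain V where "is_motion H3 V 0"
      "cat_immersion H3 q p = motion V 0 \<circ> model H3 q (sqrt (p + q)) (sqrt p)" by blast
    then show ?thesis using that model unfolding H3 cat_mu.simps by blast
  qed
qed

text \<open>The Hopf differential of a surface of revolution vanishes exactly if the two coefficients of the second form agree,
so the assumption that a catenoid is not flat is what the matching with the model requires.\<close>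

lemma catenoid_is_model:
  assumes "catenoid X g"
  obtains q mu nu V c u0 where "cat_model X q mu nu" "is_motion X V c"
    "\<And>w. g w = motion V c (model X q mu nu (w + of_real u0))"
proof -
  obtain V c a b d a1 b1 d1 a2 b2 d2 om where V: "is_motion X V c"
    and rev: "revolution X a b d a1 b1 d1 a2 b2 d2 om" and om: "om > 0" and g: "g = motion V c \<circ> rot a b d om"
    by (rule catenoid_normal_form[OF assms])
  interpret revolution X a b d a1 b1 d1 a2 b2 d2 om by (rule rev)
  have "mean_curvature X g (\<lambda>w. cmc X)" "\<not> flat X g"
    using assms unfolding catenoid_def cmc_def by blast+
  then obtain Q where "second_form X g Q (\<lambda>w. cmc X)" unfolding mean_curvature_def by blast
  then have sf: "cmc X * (om * b (Re w))\<^sup>2 + 2 * Re (Q w * (exp w)\<^sup>2) = Luu (Re w)"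
    "cmc X * (om * b (Re w))\<^sup>2 - 2 * Re (Q w * (exp w)\<^sup>2) = Lvv (Re w)" for w
    unfolding g second_form_rot[OF V] by blast+
  have H: "Luu u + Lvv u = 2 * cmc X * (om * b u)\<^sup>2" for u
    using sf[of "of_real u"] by simp
  have nonflat: "\<not> (\<forall>u. Luu u = cmc X * (om * b u)\<^sup>2 \<and> Lvv u = cmc X * (om * b u)\<^sup>2)"
  proof
    assume "\<forall>u. Luu u = cmc X * (om * b u)\<^sup>2 \<and> Lvv u = cmc X * (om * b u)\<^sup>2"
    then have "second_form X g (\<lambda>w. 0) (\<lambda>w. cmc X)" unfolding g second_form_rot[OF V] by simp
    then show False using \<open>\<not> flat X g\<close> unfolding flat_def hopf_differential_def by blast
  qed
  obtain q mu V1 c1 u0 where m: "cat_model X q mu (om / 2)" "is_motion X V1 c1"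
    "\<And>w. rot a b d om w = motion V1 c1 (model X q mu (om / 2) (w + of_real u0))"
    by (rule rot_is_model[OF om H nonflat]) blast
  obtain V2 c2 where V2: "is_motion X V2 c2" "\<And>x. motion V c (motion V1 c1 x) = motion V2 c2 x"
    using motion_compose[OF V m(2)] by blast
  have "g w = motion V2 c2 (model X q mu (om / 2) (w + of_real u0))" for w
    by (simp add: g m(3) V2(2))
  then show ?thesis using that[OF m(1) V2(1)] by blast
qed

lemma biholomorphic_translation: "biholomorphic_change (\<lambda>w. w + c)"
proof -
  have "inv (\<lambda>w. w + c) = (\<lambda>w. w - c)"
    by (rule inv_equality) auto
  moreover have "bij (\<lambda>w. w + c)" by (rule bij_betwI[where g = "\<lambda>w. w - c"]) auto
  ultimately show ?thesis
    unfolding biholomorphic_change_def by (simp add: holomorphic_on_add holomorphic_on_diff)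
qed

theorem theorem6p10:
  fixes X :: ambient
  shows "(\<forall>q p. cat_admissible X q p \<longrightarrow>
       catenoid X (cat_immersion X q p) \<and>
       hopf_differential X (cat_immersion X q p) (\<lambda>w. of_real q / (exp w)\<^sup>2) \<and>
       wrapping_number (cat_immersion X q p) (2 * sqrt p) \<and>
       (\<forall>w. let \<mu> = cat_mu X q p; r = cmod (exp w) in
          metric_coeff (cat_immersion X q p) w =
            q\<^sup>2 / (4 * \<mu>\<^sup>2) * (r powr (2 * \<mu>) / \<mu> + \<mu> * r powr (- 2 * \<mu>))\<^sup>2 * r powr (- 2)))
    \<and> (\<forall>g. catenoid X g \<longrightarrow>
       (\<exists>q p J \<phi>. cat_admissible X q p \<and> rigid_motion X J \<and> biholomorphic_change \<phi> \<and>
          g = J \<circ> cat_immersion X q p \<circ> \<phi>))"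
proof (intro conjI allI impI)
  fix q p assume adm: "cat_admissible X q p"
  obtain V c where m: "cat_model X q (cat_mu X q p) (sqrt p)" and V: "is_motion X V c"
    and f: "cat_immersion X q p = motion V c \<circ> model X q (cat_mu X q p) (sqrt p)"
    by (rule cat_immersion_is_model[OF adm])
  interpret m: cat_model X q "cat_mu X q p" "sqrt p" by (rule m)
  show "catenoid X (cat_immersion X q p)"
    "hopf_differential X (cat_immersion X q p) (\<lambda>w. of_real q / (exp w)\<^sup>2)"
    "wrapping_number (cat_immersion X q p) (2 * sqrt p)"
    unfolding f by (rule m.catenoid_model[OF V])+
  show "let \<mu> = cat_mu X q p; r = cmod (exp w) in
          metric_coeff (cat_immersion X q p) w =
            q\<^sup>2 / (4 * \<mu>\<^sup>2) * (r powr (2 * \<mu>) / \<mu> + \<mu> * r powr (- 2 * \<mu>))\<^sup>2 * r powr (- 2)" for w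
  proof -
    define \<mu> where "\<mu> = cat_mu X q p"
    have mu: "\<mu> > 0" using m.pos(1) by (simp add: \<mu>_def)
    define E F G where "E = exp (2 * \<mu> * Re w)" and "F = exp (- 2 * \<mu> * Re w)" and "G = exp (Re w)"
    have powr: "cmod (exp w) powr (2 * \<mu>) = E" "cmod (exp w) powr (- 2 * \<mu>) = F"
      "cmod (exp w) powr (- 2) = 1 / G\<^sup>2"
      by (simp_all add: E_def F_def G_def powr_def norm_exp_eq_Re exp_minus inverse_eq_divide flip: exp_double)
    have "metric_coeff (cat_immersion X q p) w = (q / 2 * (E / \<mu>\<^sup>2 + F) / G)\<^sup>2"
      unfolding f m.catenoid_model(4)[OF V] E_def F_def G_def \<mu>_def ..
    also have "\<dots> = q\<^sup>2 / (4 * \<mu>\<^sup>2) * (E / \<mu> + \<mu> * F)\<^sup>2 * (1 / G\<^sup>2)"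
    proof -
      have "E / \<mu>\<^sup>2 + F = (E / \<mu> + \<mu> * F) / \<mu>" using mu by (simp add: field_simps power2_eq_square)
      then show ?thesis by (simp add: power_divide power_mult_distrib)
    qed
    finally show ?thesis unfolding Let_def \<mu>_def[symmetric] powr .
  qed
next
  fix g assume "catenoid X g"
  then obtain q mu nu V c u0 where m: "cat_model X q mu nu" and V: "is_motion X V c"
    and g: "\<And>w. g w = motion V c (model X q mu nu (w + of_real u0))" by (rule catenoid_is_model) blast
  interpret m: cat_model X q mu nu by (rule m)
  define p where "p = nu\<^sup>2"
  have rel: "mu\<^sup>2 = (case X of E3 \<Rightarrow> p | H3 \<Rightarrow> p + q)" using m.relation unfolding p_def .
  have mu2: "mu\<^sup>2 > 0" using m.pos by simp
  have "cat_admissible X q p"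
    using m.pos m.q rel mu2 by (cases X) (auto simp: cat_admissible_def p_def)
  then obtain V1 c1 where V1: "is_motion X V1 c1"
    and f: "cat_immersion X q p = motion V1 c1 \<circ> model X q (cat_mu X q p) (sqrt p)"
    by (rule cat_immersion_is_model)
  have "sqrt p = nu" "cat_mu X q p = mu"
    using m.pos rel by (simp add: p_def) (cases X; use m.pos rel in \<open>simp add: real_sqrt_unique\<close>)
  with f have f: "cat_immersion X q p = motion V1 c1 \<circ> model X q mu nu" by simp
  obtain V2 c2 where V2: "is_motion X V2 c2" "\<And>x. motion V2 c2 (motion V1 c1 x) = x"
    by (rule motion_inverse[OF V1]) blast
  obtain V3 c3 where V3: "is_motion X V3 c3" "\<And>x. motion V c (motion V2 c2 x) = motion V3 c3 x"
    using motion_compose[OF V V2(1)] by blast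
  have "g = motion V3 c3 \<circ> cat_immersion X q p \<circ> (\<lambda>w. w + of_real u0)"
    by (simp add: fun_eq_iff g f V2(2) flip: V3(2))
  then show "\<exists>q p J \<phi>. cat_admissible X q p \<and> rigid_motion X J \<and> biholomorphic_change \<phi> \<and>
          g = J \<circ> cat_immersion X q p \<circ> \<phi>"
    using \<open>cat_admissible X q p\<close> motion_rigid[OF V3(1)] biholomorphic_translation by blast
qed

end
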